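(* Let $M$ be a complex manifold biholomorphic to a ball and let $F:M\times\mathbb{P}^k\to\mathbb{P}^k$ be a holomorphic map such that $f_\lambda:=F(\lambda,\cdot)$ has algebraic degree $d\ge2$ for all $\lambda\in M$. Let $U\subset\mathbb{P}^k$ be an open set, a trapping region of codimension $p$ with $f_\lambda(U)\Subset U$ for all $\lambda\in M$. Assume that there exists $r_0>0$ with $r_U(\lambda)\ge r_0$ for all $\lambda\in M$ and that: (a) for all $\lambda,\lambda'\in M$, $x\in\mathbb{P}^k$ and $\sigma\in B_W(r_0/2)$ there exists $\sigma'\in B_W(r_0)$ such that $f_\lambda\circ\sigma(x)=f_{\lambda'}\circ\sigma'(x)$; (b) for all $\lambda,\lambda'\in M$, if $V$ is an open subset such that $f_\lambda(V_{\eta(r_0/2)})\Subset V$ then $f_{\lambda'}(V)\Subset V$. Assume that for each $\lambda\in M$ there exists a unique attracting current $\tau(\lambda)$ in $\mathcal{C}_p(U)$ with respect to $f_\lambda$. Denote by $A_\lambda:=\bigcap_{n\ge0}f_\lambda^n(U)$ the attracting set associated to $U$ with respect to $f_\lambda$. Let $\lambda_0\in M$. If $\lambda\mapsto\tau(\lambda)$ is continuous at $\lambda_0$ (for the weak topology on currents) and if $A_{\lambda_0}=\mathrm{supp}(\tau(\lambda_0))$, then the map $\lambda\mapsto A_\lambda$ is continuous at $\lambda_0$ (for the Hausdorff metric on compact sets).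
   Context: Throughout $s=k-p$. $\omega$ is the normalized Fubini-Study form on $\mathbb{P}^k$. For $E\subset\mathbb{P}^k$, $\mathcal{C}_p(E)$ is the set of (strongly) positive closed $(p,p)$-currents $S$ on $\mathbb{P}^k$ with $\mathrm{supp}(S)\subset E$ and $\langle S,\omega^{s}\rangle=1$. Convergence of currents is weak. For an endomorphism $f$ of degree $d$, a trapping region is a non-empty open set $V$ with $f(V)\Subset V$; its attracting set is $A=\bigcap_{n\ge0}f^n(V)$. $V$ (or $A$) has codimension $p$ (dimension $s$) if $\mathcal{C}_p(A)\ne\varnothing$ and $\mathcal{C}_{p-1}(A)=\varnothing$ (the latter void if $p=0$). A current $\tau\in\mathcal{C}_p(V)$ is attractive on a codimension $p$ trapping region $V$ if $\lim_n\frac1n\sum_{i=1}^nd^{-is}(f^i)_*R=\tau$ for all $R\in\mathcal{C}_p(V)$ given by continuous forms. An attracting current of bidegree $(p,p)$ is one which is attractive on some codimension $p$ trapping region. $W$ is a fixed small neighborhood of $\mathrm{Id}$ in $\mathrm{Aut}(\mathbb{P}^k)$, identified biholomorphically with the unit ball $\mathbb{B}(0,1)$ of $\mathbb{C}^{k^2+2k}$ with $\mathrm{Id}$ corresponding to $0$; $B_W(r)\subset W$ corresponds to $\mathbb{B}(0,r)$, $0<r\le1$. For $0<r\le1$, $\eta(r)>0$ is a fixed number such that for all $x,y\in\mathbb{P}^k$ with $\mathrm{dist}(x,y)\le\eta(r)$ (Fubini-Study distance) there is $\sigma\in B_W(r)$ with $\sigma(x)=y$. For $E\subset\mathbb{P}^k$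 and $\eta>0$, $E_\eta:=\{x:\mathrm{dist}(x,E)<\eta\}$. $r_U(\lambda)$ is the maximum of the numbers $0<r\le1$ such that $f_\lambda\circ\sigma(\overline U)\subset U$ for all $\sigma\in B_W(r)$. *)

theory Defs
  imports "HOL-Analysis.Analysis"
begin

section \<open>Complex scalar multiplication and holomorphic maps of several variables\<close>

class complex_space = real_vector +
  fixes scaleC :: "complex \<Rightarrow> 'a \<Rightarrow> 'a"  (infixr \<open>*\<^sub>C\<close> 75)
  assumes scaleC_add_right: "c *\<^sub>C (x + y) = c *\<^sub>C x + c *\<^sub>C y"
    and scaleC_add_left: "(b + c) *\<^sub>C x = b *\<^sub>C x + c *\<^sub>C x"
    and scaleC_scaleC: "b *\<^sub>C (c *\<^sub>C x) = (b * c) *\<^sub>C x"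
    and scaleC_of_real: "complex_of_real r *\<^sub>C x = r *\<^sub>R x"

instantiation complex :: complex_space
begin
definition scaleC_complex :: "complex \<Rightarrow> complex \<Rightarrow> complex" where
  "scaleC_complex c x = c * x"
instance
  by standard (auto simp: scaleC_complex_def algebra_simps scaleR_conv_of_real)
end

instantiation vec :: (complex_space, finite) complex_space
begin
definition scaleC_vec :: "complex \<Rightarrow> 'a ^ 'b \<Rightarrow> 'a ^ 'b" where
  "scaleC_vec c x = (\<chi> i. c *\<^sub>C (x $ i))"
instance
  by standard (auto simp: scaleC_vec_def vec_eq_iff scaleC_add_right scaleC_add_left
      scaleC_scaleC scaleC_of_real)
end

instantiation prod :: (complex_space, complex_space) complex_space
begin
definition scaleC_prod :: "complex \<Rightarrow> 'a \<times> 'b \<Rightarrow> 'a \<times> 'b" where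
  "scaleC_prod c x = (c *\<^sub>C fst x, c *\<^sub>C snd x)"
instance
  by standard (auto simp: scaleC_prod_def prod_eq_iff scaleC_add_right scaleC_add_left
      scaleC_scaleC scaleC_of_real)
end

definition hol_on ::
  "'a::{complex_space,real_normed_vector} set \<Rightarrow> ('a \<Rightarrow> 'b::{complex_space,real_normed_vector}) \<Rightarrow> bool"
  where "hol_on S f \<longleftrightarrow>
    (\<forall>x\<in>S. \<exists>D. (f has_derivative D) (at x) \<and> (\<forall>c v. D (c *\<^sub>C v) = c *\<^sub>C D v))"


section \<open>The complex projective space with the Fubini-Study distance\<close>

text \<open>The points of \<open>\<P>\<^sup>k\<close>, with \<open>k = CARD('k) \<ge> 1\<close>, are the complex lines through the origin of
  \<open>\<complex>\<^sup>k\<^sup>+\<^sup>1\<close>; the homogeneous coordinates are indexed by \<^typ>\<open>'k option\<close>, so that the affine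
  coordinates of the chart where the \<^const>\<open>None\<close> coordinate is nonzero are indexed by \<^typ>\<open>'k\<close>.
  The distance is the angle between complex lines; its topology is the usual (quotient) one.\<close>

type_synonym 'k hvec = "complex ^ ('k option)"

definition cline :: "'k::finite hvec \<Rightarrow> 'k hvec set" where
  "cline z = range (\<lambda>c. c *\<^sub>C z)"

typedef (overloaded) ('k::finite) pspace = "cline ` (- {0 :: 'k hvec})"
proof
  have "axis None 1 \<noteq> (0 :: 'k hvec)" by simp
  then show "cline (axis None 1) \<in> cline ` (- {0 :: 'k hvec})" by blast
qed

definition pt :: "'k::finite hvec \<Rightarrow> 'k pspace" where
  "pt z = Abs_pspace (cline z)"

definition hrep :: "'k::finite pspace \<Rightarrow> 'k hvec" where
  "hrep x = (SOME z. z \<noteq> 0 \<and> pt z = x)"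

definition herm :: "'k::finite hvec \<Rightarrow> 'k hvec \<Rightarrow> complex" where
  "herm v w = (\<Sum>i\<in>UNIV. v $ i * cnj (w $ i))"

lemma hrep: "hrep x \<noteq> 0 \<and> pt (hrep x) = x"
proof -
  obtain z where "z \<noteq> 0" "Rep_pspace x = cline z"
    using Rep_pspace[of x] by blast
  then have "z \<noteq> 0 \<and> pt z = x"
    unfolding pt_def using Rep_pspace_inverse[of x] by simp
  then show ?thesis unfolding hrep_def by (rule someI)
qed

lemma pt_scaleC: assumes "c \<noteq> 0" shows "pt (c *\<^sub>C z) = pt z"
proof -
  have "cline (c *\<^sub>C z) = cline z"
  proof
    show "cline (c *\<^sub>C z) \<subseteq> cline z" by (auto simp: cline_def scaleC_scaleC)
    show "cline z \<subseteq> cline (c *\<^sub>C z)"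
    proof
      fix x assume "x \<in> cline z"
      then obtain b where "x = b *\<^sub>C z" by (auto simp: cline_def)
      then have "x = (b / c) *\<^sub>C (c *\<^sub>C z)" using assms by (simp add: scaleC_scaleC)
      then show "x \<in> cline (c *\<^sub>C z)" unfolding cline_def by blast
    qed
  qed
  then show ?thesis by (simp add: pt_def)
qed

lemma herm_scaleC_left: "herm (c *\<^sub>C v) w = c * herm v w"
  by (simp add: herm_def scaleC_vec_def scaleC_complex_def sum_distrib_left mult.assoc)

lemma herm_add_left: "herm (u + v) w = herm u w + herm v w"
  by (simp add: herm_def algebra_simps sum.distrib)

lemma herm_commute: "herm w v = cnj (herm v w)"
  by (simp add: herm_def mult.commute)

lemma Re_herm: "Re (herm v w) = v \<bullet> w"
  by (simp add: herm_def inner_vec_def inner_complex_def)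

lemma herm_self: "herm v v = complex_of_real ((norm v)\<^sup>2)"
proof (rule complex_eqI)
  show "Im (herm v v) = Im (complex_of_real ((norm v)\<^sup>2))"
    using arg_cong[OF herm_commute[of v v], of Im] by simp
qed (simp add: Re_herm power2_norm_eq_inner)

lemma norm_scaleC: "norm (c *\<^sub>C (v :: 'k::finite hvec)) = cmod c * norm v"
proof -
  have "(\<Sum>i\<in>UNIV. (cmod c * cmod (v $ i))\<^sup>2) = (cmod c)\<^sup>2 * (\<Sum>i\<in>UNIV. (cmod (v $ i))\<^sup>2)"
    by (simp add: sum_distrib_left power_mult_distrib)
  then show ?thesis
    by (simp add: norm_vec_def L2_set_def scaleC_vec_def scaleC_complex_def norm_mult
        real_sqrt_mult)
qed

lemma phase_exists: "\<exists>c. cmod c = 1 \<and> c * w = complex_of_real (cmod w)"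
proof (cases "w = 0")
  case True then show ?thesis by (intro exI[of _ 1]) simp
next
  case False
  have "cnj w / cmod w * w = (w * cnj w) / cmod w" by (simp add: mult.commute)
  also have "\<dots> = cmod w"
    using False by (simp only: complex_norm_square[symmetric]) (simp add: power2_eq_square)
  finally have "cnj w / cmod w * w = cmod w" .
  moreover have "cmod (cnj w / cmod w) = 1" using False by (simp add: norm_divide)
  ultimately show ?thesis by blast
qed

lemma cmod_herm_le: "cmod (herm v w) \<le> norm v * norm w"
proof -
  obtain c where c: "cmod c = 1" "c * herm v w = complex_of_real (cmod (herm v w))"
    using phase_exists by blast
  have "cmod (herm v w) = (c *\<^sub>C v) \<bullet> w"
    by (simp only: Re_herm[symmetric] herm_scaleC_left c(2) Re_complex_of_real)
  also have "\<dots> \<le> norm (c *\<^sub>C v) * norm w" by (rule norm_cauchy_schwarz)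
  finally show ?thesis by (simp add: norm_scaleC c)
qed

definition fs_cos :: "'k::finite pspace \<Rightarrow> 'k pspace \<Rightarrow> real" where
  "fs_cos x y = cmod (herm (hrep x) (hrep y)) / (norm (hrep x) * norm (hrep y))"

lemma fs_cos_bounds: "0 \<le> fs_cos x y" "fs_cos x y \<le> 1"
  using cmod_herm_le[of "hrep x" "hrep y"] hrep[of x] hrep[of y]
  by (auto simp: fs_cos_def divide_simps)

lemma fs_cos_commute: "fs_cos x y = fs_cos y x"
  by (simp add: fs_cos_def herm_commute[of "hrep y"] mult.commute)

definition urep :: "'k::finite pspace \<Rightarrow> 'k hvec" where
  "urep x = complex_of_real (inverse (norm (hrep x))) *\<^sub>C hrep x"

lemma urep: "norm (urep x) = 1" "pt (urep x) = x"
  using hrep[of x] by (simp_all add: urep_def norm_scaleC norm_inverse pt_scaleC)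

lemma herm_scaleC_right: "herm v (c *\<^sub>C w) = cnj c * herm v w"
  by (subst herm_commute, subst herm_scaleC_left) (simp add: herm_commute[of w v])

lemma fs_cos_urep: "fs_cos x y = cmod (herm (urep x) (urep y))"
  by (simp add: urep_def fs_cos_def herm_scaleC_left herm_scaleC_right norm_mult norm_inverse
      divide_inverse)

lemma eq_of_inner_eq_1:
  fixes u v :: "'a::real_inner"
  assumes "norm u = 1" "norm v = 1" "u \<bullet> v = 1"
  shows "u = v"
proof -
  have "(norm (u - v))\<^sup>2 = (norm u)\<^sup>2 + (norm v)\<^sup>2 - 2 * (u \<bullet> v)"
    by (simp add: power2_norm_eq_inner inner_diff_left inner_diff_right inner_commute[of v u])
  then show ?thesis using assms by simp
qed

lemma aligned:
  assumes "norm (v :: 'k::finite hvec) = 1"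
  obtains g where "cmod g = 1" "norm (g *\<^sub>C v) = 1" "(g *\<^sub>C v) \<bullet> w = cmod (herm v w)"
proof -
  obtain g where g: "cmod g = 1" "g * herm v w = complex_of_real (cmod (herm v w))"
    using phase_exists by blast
  have "(g *\<^sub>C v) \<bullet> w = Re (herm (g *\<^sub>C v) w)" by (simp only: Re_herm)
  also have "\<dots> = cmod (herm v w)" by (simp only: herm_scaleC_left g(2) Re_complex_of_real)
  finally show ?thesis using that g assms by (simp add: norm_scaleC)
qed

lemma arccos_triangle:
  fixes a b c :: "'a::real_inner"
  assumes "norm a = 1" "norm b = 1" "norm c = 1"
  shows "arccos (a \<bullet> c) \<le> arccos (a \<bullet> b) + arccos (b \<bullet> c)"
proof -
  have bnd: "\<bar>u \<bullet> v\<bar> \<le> 1" if "norm u = 1" "norm v = 1" for u v :: 'a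
    using Cauchy_Schwarz_ineq2[of u v] that by simp
  define s t where "s = a \<bullet> b" and "t = b \<bullet> c"
  have s: "\<bar>s\<bar> \<le> 1" and t: "\<bar>t\<bar> \<le> 1" using bnd assms by (auto simp: s_def t_def)
  have aa: "a \<bullet> a = 1" "b \<bullet> b = 1" "c \<bullet> c = 1" using assms by (auto simp: dot_square_norm)
  have "norm (a - s *\<^sub>R b) = sqrt (1 - s\<^sup>2)"
    by (simp add: norm_eq_sqrt_inner inner_diff_left inner_diff_right aa s_def
        power2_eq_square inner_commute)
  moreover have "norm (c - t *\<^sub>R b) = sqrt (1 - t\<^sup>2)"
    by (simp add: norm_eq_sqrt_inner inner_diff_left inner_diff_right aa t_def
        power2_eq_square inner_commute)
  moreover have "(a - s *\<^sub>R b) \<bullet> (c - t *\<^sub>R b) = a \<bullet> c - s * t"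
    by (simp add: inner_diff_left inner_diff_right aa s_def t_def inner_commute)
  ultimately have "s * t - sqrt (1 - s\<^sup>2) * sqrt (1 - t\<^sup>2) \<le> a \<bullet> c"
    using Cauchy_Schwarz_ineq2[of "a - s *\<^sub>R b" "c - t *\<^sub>R b"] by auto
  then have le: "cos (arccos s + arccos t) \<le> a \<bullet> c"
    using s t by (simp add: cos_add sin_arccos_abs cos_arccos_abs)
  have ac: "\<bar>a \<bullet> c\<bar> \<le> 1" using bnd assms by auto
  show ?thesis
  proof (cases "arccos s + arccos t \<le> pi")
    case True
    have nn: "0 \<le> arccos s + arccos t" using s t by (simp add: arccos_lbound abs_le_iff)
    have "arccos (a \<bullet> c) \<le> arccos (cos (arccos s + arccos t))"
      by (rule arccos_le_arccos) (use le ac in auto)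
    also have "\<dots> = arccos s + arccos t" using nn True by (rule arccos_cos)
    finally show ?thesis by (simp add: s_def t_def)
  next
    case False
    then show ?thesis using arccos_ubound[of "a \<bullet> c"] ac by (auto simp: s_def t_def abs_le_iff)
  qed
qed

instantiation pspace :: (finite) metric_space
begin

definition dist_pspace :: "'a pspace \<Rightarrow> 'a pspace \<Rightarrow> real" where
  "dist_pspace x y = arccos (fs_cos x y)"

definition uniformity_pspace :: "('a pspace \<times> 'a pspace) filter" where
  "uniformity_pspace = (INF e\<in>{0<..}. principal {(x, y). dist x y < e})"

definition open_pspace :: "'a pspace set \<Rightarrow> bool" where
  "open_pspace U \<longleftrightarrow> (\<forall>x\<in>U. \<forall>\<^sub>F (x', y) in uniformity. x' = x \<longrightarrow> y \<in> U)"

instance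
proof
  fix x y z :: "'a pspace"
  show "dist x y = 0 \<longleftrightarrow> x = y"
  proof
    assume "x = y"
    then show "dist x y = 0" using hrep[of y]
      by (simp add: dist_pspace_def fs_cos_urep herm_self urep)
  next
    assume "dist x y = 0"
    then have 1: "fs_cos x y = 1"
      using fs_cos_bounds[of x y] cos_arccos[of "fs_cos x y"] by (simp add: dist_pspace_def)
    obtain g where g: "cmod g = 1" "norm (g *\<^sub>C urep x) = 1" "(g *\<^sub>C urep x) \<bullet> urep y = 1"
      using aligned[OF urep(1)[of x], of "urep y"] 1 by (auto simp: fs_cos_urep)
    then have "g *\<^sub>C urep x = urep y"
      using eq_of_inner_eq_1 urep(1)[of y] by blast
    moreover have "g \<noteq> 0" using g by auto
    ultimately show "x = y" using pt_scaleC[of g "urep x"] by (simp add: urep)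
  qed
next
  fix x y z :: "'a pspace"
  obtain g where g: "cmod g = 1" "norm (g *\<^sub>C urep x) = 1"
      "(g *\<^sub>C urep x) \<bullet> urep z = fs_cos x z"
    using aligned[OF urep(1)[of x], of "urep z"] by (auto simp: fs_cos_urep)
  obtain h where h: "cmod h = 1" "norm (h *\<^sub>C urep y) = 1"
      "(h *\<^sub>C urep y) \<bullet> urep z = fs_cos y z"
    using aligned[OF urep(1)[of y], of "urep z"] by (auto simp: fs_cos_urep)
  have "\<bar>(g *\<^sub>C urep x) \<bullet> (h *\<^sub>C urep y)\<bar> \<le> cmod (herm (g *\<^sub>C urep x) (h *\<^sub>C urep y))"
    using abs_Re_le_cmod[of "herm (g *\<^sub>C urep x) (h *\<^sub>C urep y)"] by (simp only: Re_herm)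
  also have "\<dots> = fs_cos x y"
    by (simp add: herm_scaleC_left herm_scaleC_right norm_mult g h fs_cos_urep)
  finally have le: "(g *\<^sub>C urep x) \<bullet> (h *\<^sub>C urep y) \<le> fs_cos x y"
      "- 1 \<le> (g *\<^sub>C urep x) \<bullet> (h *\<^sub>C urep y)"
    using fs_cos_bounds(2)[of x y] by auto
  have "dist x y \<le> arccos ((g *\<^sub>C urep x) \<bullet> (h *\<^sub>C urep y))"
    unfolding dist_pspace_def using le fs_cos_bounds(2)[of x y] by (intro arccos_le_arccos) auto
  also have "\<dots> \<le> arccos ((g *\<^sub>C urep x) \<bullet> urep z) + arccos (urep z \<bullet> (h *\<^sub>C urep y))"
    using g h by (intro arccos_triangle) (auto simp: urep)
  finally show "dist x y \<le> dist x z + dist y z"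
    by (simp only: g h dist_pspace_def inner_commute[of "urep z"])
qed (auto simp: uniformity_pspace_def open_pspace_def)

end


section \<open>Endomorphisms of the projective space\<close>

definition homogeneous_poly :: "nat \<Rightarrow> ('k::finite hvec \<Rightarrow> complex) \<Rightarrow> bool" where
  "homogeneous_poly d q \<longleftrightarrow>
    (\<exists>c. \<forall>z. q z = (\<Sum>a | (\<Sum>i\<in>UNIV. a i) = d. c a * (\<Prod>i\<in>UNIV. (z $ i) ^ a i)))"

definition algebraic_degree :: "('k::finite pspace \<Rightarrow> 'k pspace) \<Rightarrow> nat \<Rightarrow> bool" where
  "algebraic_degree f d \<longleftrightarrow>
    (\<exists>P. (\<forall>i. homogeneous_poly d (\<lambda>z. P z $ i)) \<and>
         (\<forall>z. z \<noteq> 0 \<longrightarrow> P z \<noteq> 0 \<and> f (pt z) = pt (P z)))"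

definition rel_compact_in :: "'a::topological_space set \<Rightarrow> 'a set \<Rightarrow> bool"  (infix \<open>\<Subset>\<close> 50)
  where "A \<Subset> B \<longleftrightarrow> compact (closure A) \<and> closure A \<subseteq> B"

definition trapping_region :: "('k::finite pspace \<Rightarrow> 'k pspace) \<Rightarrow> 'k pspace set \<Rightarrow> bool" where
  "trapping_region f V \<longleftrightarrow> V \<noteq> {} \<and> open V \<and> f ` V \<Subset> V"

definition attracting_set :: "('k::finite pspace \<Rightarrow> 'k pspace) \<Rightarrow> 'k pspace set \<Rightarrow> 'k pspace set"
  where "attracting_set f V = (\<Inter>n. (f ^^ n) ` V)"


section \<open>Differential forms\<close>

text \<open>A differential form on \<open>\<P>\<^sup>k\<close> is identified with its pull-back under \<^const>\<open>pt\<close>, i.e. with a form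
  on \<open>\<complex>\<^sup>k\<^sup>+\<^sup>1 - {0}\<close> which is invariant under nonzero homotheties and vanishes as soon as one of its
  arguments is tangent to the fibre.  An \<open>m\<close>-form is complex valued; at the point \<open>z\<close> it takes the
  arguments \<open>v 0, \<dots>, v (m - 1)\<close>.  To have equality of forms coincide with equality of functions, it
  ignores \<open>v i\<close> for \<open>i \<ge> m\<close> and is \<open>0\<close> at \<open>z = 0\<close>.\<close>

type_synonym 'k form = "'k hvec \<Rightarrow> (nat \<Rightarrow> 'k hvec) \<Rightarrow> complex"

definition diff_form :: "nat \<Rightarrow> 'k::finite form \<Rightarrow> bool" where
  "diff_form m \<alpha> \<longleftrightarrow>
    (\<forall>z v v'. (\<forall>i<m. v i = v' i) \<longrightarrow> \<alpha> z v = \<alpha> z v') \<and>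
    (\<forall>v. \<alpha> 0 v = 0) \<and>
    (\<forall>z v i. i < m \<longrightarrow> linear (\<lambda>x. \<alpha> z (v(i := x)))) \<and>
    (\<forall>z v i j. i < j \<and> j < m \<and> v i = v j \<longrightarrow> \<alpha> z v = 0) \<and>
    (\<forall>z v c. c \<noteq> 0 \<longrightarrow> \<alpha> (c *\<^sub>C z) (\<lambda>i. c *\<^sub>C v i) = \<alpha> z v) \<and>
    (\<forall>z v i c. i < m \<and> v i = c *\<^sub>C z \<longrightarrow> \<alpha> z v = 0)"

definition deriv_along ::
  "'a::real_normed_vector list \<Rightarrow> ('a \<Rightarrow> 'b::real_normed_vector) \<Rightarrow> 'a \<Rightarrow> 'b" where
  "deriv_along ws g = foldr (\<lambda>w h x. frechet_derivative h (at x) w) ws g"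

definition smooth_on :: "'a::real_normed_vector set \<Rightarrow> ('a \<Rightarrow> 'b::real_normed_vector) \<Rightarrow> bool" where
  "smooth_on X g \<longleftrightarrow> (\<forall>ws. \<forall>x\<in>X. deriv_along ws g differentiable (at x))"

definition smooth_form :: "nat \<Rightarrow> 'k::finite form \<Rightarrow> bool" where
  "smooth_form m \<alpha> \<longleftrightarrow> diff_form m \<alpha> \<and> (\<forall>v. smooth_on (- {0}) (\<lambda>z. \<alpha> z v))"

definition continuous_form :: "nat \<Rightarrow> 'k::finite form \<Rightarrow> bool" where
  "continuous_form m \<alpha> \<longleftrightarrow> diff_form m \<alpha> \<and> (\<forall>v. continuous_on (- {0}) (\<lambda>z. \<alpha> z v))"

text \<open>For an \<open>(a + b)\<close>-form this says that it is of type \<open>(a,b)\<close>: the summands of its decomposition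
  by type are the eigenspaces of the simultaneous multiplication of all arguments by \<open>c\<close>.\<close>

definition of_bidegree :: "nat \<Rightarrow> nat \<Rightarrow> 'k::finite form \<Rightarrow> bool" where
  "of_bidegree a b \<alpha> \<longleftrightarrow> (\<forall>z v c. \<alpha> z (\<lambda>i. c *\<^sub>C v i) = c ^ a * cnj c ^ b * \<alpha> z v)"

definition wedge :: "nat \<Rightarrow> nat \<Rightarrow> 'k::finite form \<Rightarrow> 'k form \<Rightarrow> 'k form" where
  "wedge a b \<alpha> \<beta> z v =
    (\<Sum>\<pi> | \<pi> permutes {..<a + b}.
        of_int (sign \<pi>) * \<alpha> z (\<lambda>i. v (\<pi> i)) * \<beta> z (\<lambda>i. v (\<pi> (a + i)))) / (fact a * fact b)"

definition ext_deriv :: "nat \<Rightarrow> 'k::finite form \<Rightarrow> 'k form" where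
  "ext_deriv m \<beta> z v =
    (if z = 0 then 0
     else \<Sum>i\<le>m. (- 1) ^ i *
       frechet_derivative (\<lambda>y. \<beta> y (\<lambda>j. if j < i then v j else v (Suc j))) (at z) (v i))"

text \<open>The Fubini-Study form \<open>dd\<^sup>c log |z|\<close> with \<open>dd\<^sup>c = (\<i> / \<pi>) \<partial>\<partial>'\<close>, whose \<open>k\<close>-th power has integral \<open>1\<close>: if
  \<open>h = |z|\<^sup>-\<^sup>4 (|z|\<^sup>2 \<langle>v,w\<rangle> - \<langle>v,z\<rangle> \<langle>z,w\<rangle>)\<close> is the Levi form of \<open>log |z|\<^sup>2\<close>, it takes the value
  \<open>(\<i> / 2\<pi>) (h(v,w) - h(w,v)) = - Im h(v,w) / \<pi>\<close>.\<close>

definition fs_form :: "'k::finite form" where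
  "fs_form z v =
    (if z = 0 then 0
     else - complex_of_real (Im
       ((of_real ((norm z)\<^sup>2) * herm (v 0) (v 1) - herm (v 0) z * herm z (v 1)) /
         of_real ((norm z) ^ 4)) / pi))"

primrec fs_power :: "nat \<Rightarrow> 'k::finite form" where
  "fs_power 0 = (\<lambda>z v. if z = 0 then 0 else 1)"
| "fs_power (Suc s) = wedge (2 * s) 2 (fs_power s) fs_form"

definition form_support :: "'k::finite form \<Rightarrow> 'k pspace set" where
  "form_support \<alpha> = closure {x. \<exists>z v. z \<noteq> 0 \<and> pt z = x \<and> \<alpha> z v \<noteq> 0}"

definition real_frame :: "(nat \<Rightarrow> 'k::finite hvec) \<Rightarrow> nat \<Rightarrow> 'k hvec" where
  "real_frame v i = (if even i then v (i div 2) else \<i> *\<^sub>C v (i div 2))"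

text \<open>Weak positivity of an \<open>(s,s)\<close>-form: its restriction to every \<open>s\<close>-dimensional complex subspace of
  the tangent space is nonnegative for the orientation \<open>v\<^sub>0, \<i>v\<^sub>0, v\<^sub>1, \<i>v\<^sub>1, \<dots>\<close>.\<close>

definition weakly_positive :: "'k::finite form \<Rightarrow> bool" where
  "weakly_positive \<alpha> \<longleftrightarrow> (\<forall>z v. \<alpha> z (real_frame v) \<in> \<real>\<^sub>\<ge>\<^sub>0)"

text \<open>Integral of a \<open>2k\<close>-form, computed in the affine chart where the \<^const>\<open>None\<close> coordinate is \<open>1\<close>;
  the hyperplane at infinity is negligible.  The orientation does not depend on the enumeration of
  the coordinates.\<close>

definition affine_pt :: "complex ^ 'k \<Rightarrow> 'k::finite hvec" where
  "affine_pt w = (\<chi> i. case i of None \<Rightarrow> 1 | Some j \<Rightarrow> w $ j)"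

definition coord_enum :: "nat \<Rightarrow> 'k::finite" where
  "coord_enum = (SOME e. bij_betw e {..<CARD('k)} UNIV)"

definition form_integral :: "'k::finite form \<Rightarrow> complex" where
  "form_integral \<beta> =
    (LINT w|lborel. \<beta> (affine_pt w) (real_frame (\<lambda>j. axis (Some (coord_enum j)) 1)))"

definition local_lift ::
  "('k::finite pspace \<Rightarrow> 'k pspace) \<Rightarrow> 'k hvec \<Rightarrow> ('k hvec \<Rightarrow> 'k hvec) \<Rightarrow> bool" where
  "local_lift f z G \<longleftrightarrow>
    (\<exists>N. open N \<and> z \<in> N \<and> hol_on N G \<and>
         (\<forall>y\<in>N. y \<noteq> 0 \<and> G y \<noteq> 0 \<and> f (pt y) = pt (G y)))"

text \<open>The pull-back does not depend on the choice of the local lift, since the form \<open>\<alpha>\<close> comes from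
  \<open>\<P>\<^sup>k\<close>.\<close>

definition pullback :: "('k::finite pspace \<Rightarrow> 'k pspace) \<Rightarrow> 'k form \<Rightarrow> 'k form" where
  "pullback f \<alpha> z v =
    (if z = 0 then 0
     else let G = (SOME G. local_lift f z G)
          in \<alpha> (G z) (\<lambda>i. frechet_derivative G (at z) (v i)))"


section \<open>Currents\<close>

text \<open>A current of dimension \<open>m\<close> is a continuous linear functional on the Frechet space of smooth
  \<open>m\<close>-forms (continuity is tested on sequences).  It is extended by \<open>0\<close> to functions which are not
  smooth \<open>m\<close>-forms, so that equality of currents is equality of functions.\<close>

type_synonym 'k functional = "'k form \<Rightarrow> complex"

definition form_tendsto_0 :: "(nat \<Rightarrow> 'k::finite form) \<Rightarrow> bool" where
  "form_tendsto_0 A \<longleftrightarrow>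
    (\<forall>v ws. uniform_limit (sphere 0 1) (\<lambda>n. deriv_along ws (\<lambda>z. A n z v)) (\<lambda>_. 0) sequentially)"

definition current :: "nat \<Rightarrow> 'k::finite functional \<Rightarrow> bool" where
  "current m S \<longleftrightarrow>
    (\<forall>\<alpha>. \<not> smooth_form m \<alpha> \<longrightarrow> S \<alpha> = 0) \<and>
    (\<forall>\<alpha> \<beta>. smooth_form m \<alpha> \<and> smooth_form m \<beta> \<longrightarrow> S (\<lambda>z v. \<alpha> z v + \<beta> z v) = S \<alpha> + S \<beta>) \<and>
    (\<forall>c \<alpha>. smooth_form m \<alpha> \<longrightarrow> S (\<lambda>z v. c * \<alpha> z v) = c * S \<alpha>) \<and>
    (\<forall>A. (\<forall>n. smooth_form m (A n)) \<and> form_tendsto_0 A \<longrightarrow> (\<lambda>n. S (A n)) \<longlonglongrightarrow> 0)"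

definition current_support :: "nat \<Rightarrow> 'k::finite functional \<Rightarrow> 'k pspace set" where
  "current_support m S =
    - \<Union>{V. open V \<and> (\<forall>\<alpha>. smooth_form m \<alpha> \<and> form_support \<alpha> \<subseteq> V \<longrightarrow> S \<alpha> = 0)}"

text \<open>Currents of bidegree \<open>(p,p)\<close>: \<open>s = k - p\<close>.\<close>

definition bidim_current :: "nat \<Rightarrow> 'k::finite functional \<Rightarrow> bool" where
  "bidim_current s S \<longleftrightarrow> current (2 * s) S \<and>
    (\<forall>a b \<alpha>. a + b = 2 * s \<and> a \<noteq> b \<and> smooth_form (2 * s) \<alpha> \<and> of_bidegree a b \<alpha> \<longrightarrow> S \<alpha> = 0)"

definition strongly_positive :: "nat \<Rightarrow> 'k::finite functional \<Rightarrow> bool" where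
  "strongly_positive s S \<longleftrightarrow>
    (\<forall>\<alpha>. smooth_form (2 * s) \<alpha> \<and> of_bidegree s s \<alpha> \<and> weakly_positive \<alpha> \<longrightarrow> S \<alpha> \<in> \<real>\<^sub>\<ge>\<^sub>0)"

definition closed_current :: "nat \<Rightarrow> 'k::finite functional \<Rightarrow> bool" where
  "closed_current m S \<longleftrightarrow>
    (\<forall>n \<beta>. m = Suc n \<and> smooth_form n \<beta> \<longrightarrow> S (ext_deriv n \<beta>) = 0)"

definition \<C> :: "nat \<Rightarrow> 'k::finite pspace set \<Rightarrow> 'k functional set" where
  "\<C> p E = {S. p \<le> CARD('k) \<and>
    (let s = CARD('k) - p in
       bidim_current s S \<and> strongly_positive s S \<and> closed_current (2 * s) S \<and>
       current_support (2 * s) S \<subseteq> E \<and> S (fs_power s) = 1)}"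

definition given_by_continuous_form :: "nat \<Rightarrow> 'k::finite functional \<Rightarrow> bool" where
  "given_by_continuous_form p R \<longleftrightarrow>
    (let s = CARD('k) - p in
     \<exists>\<rho>. continuous_form (2 * p) \<rho> \<and> of_bidegree p p \<rho> \<and>
         (\<forall>\<alpha>. smooth_form (2 * s) \<alpha> \<longrightarrow> R \<alpha> = form_integral (wedge (2 * p) (2 * s) \<rho> \<alpha>)))"

definition pushforward ::
  "nat \<Rightarrow> ('k::finite pspace \<Rightarrow> 'k pspace) \<Rightarrow> 'k functional \<Rightarrow> 'k functional" where
  "pushforward m f R \<alpha> = (if smooth_form m \<alpha> then R (pullback f \<alpha>) else 0)"

definition trapping_region_codim ::
  "nat \<Rightarrow> ('k::finite pspace \<Rightarrow> 'k pspace) \<Rightarrow> 'k pspace set \<Rightarrow> bool" where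
  "trapping_region_codim p f V \<longleftrightarrow> trapping_region f V \<and>
    \<C> p (attracting_set f V) \<noteq> {} \<and> (p \<noteq> 0 \<longrightarrow> \<C> (p - 1) (attracting_set f V) = {})"

definition attractive_on ::
  "nat \<Rightarrow> nat \<Rightarrow> ('k::finite pspace \<Rightarrow> 'k pspace) \<Rightarrow> 'k pspace set \<Rightarrow> 'k functional \<Rightarrow> bool" where
  "attractive_on d p f V \<tau> \<longleftrightarrow> \<tau> \<in> \<C> p V \<and>
    (let s = CARD('k) - p in
     \<forall>R\<in>\<C> p V. given_by_continuous_form p R \<longrightarrow>
       (\<forall>\<alpha>. smooth_form (2 * s) \<alpha> \<longrightarrow>
         (\<lambda>n. 1 / of_nat n * (\<Sum>i=1..n. pushforward (2 * s) (f ^^ i) R \<alpha> / of_nat d ^ (i * s)))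
           \<longlonglongrightarrow> \<tau> \<alpha>))"

definition attracting_current ::
  "nat \<Rightarrow> nat \<Rightarrow> ('k::finite pspace \<Rightarrow> 'k pspace) \<Rightarrow> 'k functional \<Rightarrow> bool" where
  "attracting_current d p f \<tau> \<longleftrightarrow> (\<exists>V. trapping_region_codim p f V \<and> attractive_on d p f V \<tau>)"


section \<open>Parametrised neighbourhoods of the identity in the automorphism group\<close>

definition pgl :: "complex ^ ('k option) ^ ('k option) \<Rightarrow> 'k::finite pspace \<Rightarrow> 'k pspace" where
  "pgl A x = pt (A *v hrep x)"

text \<open>The automorphism group of \<open>\<P>\<^sup>k\<close> is \<open>PGL(k+1,\<complex>)\<close>, with the complex structure for which
  \<^const>\<open>pgl\<close>, restricted to the invertible matrices, is a holomorphic principal bundle.  The map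
  \<open>\<Theta>\<close> is a biholomorphism of the unit ball of dimension \<open>k\<^sup>2 + 2k\<close> onto an open neighbourhood \<open>W\<close> of the
  identity: it has local holomorphic lifts to matrices, and its inverse is holomorphic when
  composed with \<^const>\<open>pgl\<close>.\<close>

definition aut_parametrization :: "(complex ^ 'w \<Rightarrow> 'k::finite pspace \<Rightarrow> 'k pspace) \<Rightarrow> bool" where
  "aut_parametrization \<Theta> \<longleftrightarrow>
    CARD('w) = CARD('k)\<^sup>2 + 2 * CARD('k) \<and>
    \<Theta> 0 = id \<and> inj_on \<Theta> (ball 0 1) \<and>
    (\<forall>a\<in>ball 0 1. \<exists>N L. open N \<and> a \<in> N \<and> hol_on N L \<and>
        (\<forall>b \<in> N \<inter> ball 0 1. invertible (L b) \<and> \<Theta> b = pgl (L b))) \<and>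
    (let GW = {A. invertible A \<and> pgl A \<in> \<Theta> ` ball 0 1}
     in open GW \<and> hol_on GW (\<lambda>A. inv_into (ball 0 1) \<Theta> (pgl A)))"

definition B_W :: "(complex ^ 'w \<Rightarrow> 'k::finite pspace \<Rightarrow> 'k pspace) \<Rightarrow> real \<Rightarrow> ('k pspace \<Rightarrow> 'k pspace) set"
  where "B_W \<Theta> r = \<Theta> ` ball 0 r"

definition trapping_radius ::
  "(complex ^ 'w \<Rightarrow> 'k::finite pspace \<Rightarrow> 'k pspace) \<Rightarrow> ('k pspace \<Rightarrow> 'k pspace) \<Rightarrow> 'k pspace set \<Rightarrow> real"
  where "trapping_radius \<Theta> f U =
    (GREATEST r. 0 < r \<and> r \<le> 1 \<and> (\<forall>\<sigma>\<in>B_W \<Theta> r. (f \<circ> \<sigma>) ` closure U \<subseteq> U))"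

text \<open>The set of points at distance less than \<open>\<epsilon>\<close> from \<open>E\<close> (empty if \<open>E\<close> is empty, which a
  definition by \<^const>\<open>infdist\<close> would not give).\<close>

definition nbhd :: "'a::metric_space set \<Rightarrow> real \<Rightarrow> 'a set" where
  "nbhd E \<epsilon> = (\<Union>y\<in>E. ball y \<epsilon>)"

definition hausdorff_dist :: "'a::metric_space set \<Rightarrow> 'a set \<Rightarrow> real" where
  "hausdorff_dist A B = max (SUP a\<in>A. infdist a B) (SUP b\<in>B. infdist b A)"


section \<open>Complex manifolds and holomorphic families of maps\<close>

type_synonym ('m, 'j) atlas = "('m set \<times> ('m \<Rightarrow> complex ^ 'j)) set"

definition complex_manifold :: "'m::topological_space set \<Rightarrow> ('m, 'j::finite) atlas \<Rightarrow> bool" where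
  "complex_manifold M \<A> \<longleftrightarrow>
    Hausdorff_space (top_of_set M) \<and> second_countable (top_of_set M) \<and>
    (\<Union>(D, \<phi>)\<in>\<A>. D) = M \<and>
    (\<forall>(D, \<phi>)\<in>\<A>. openin (top_of_set M) D \<and> open (\<phi> ` D) \<and>
        homeomorphism D (\<phi> ` D) \<phi> (inv_into D \<phi>)) \<and>
    (\<forall>(D, \<phi>)\<in>\<A>. \<forall>(D', \<phi>')\<in>\<A>. hol_on (\<phi> ` (D \<inter> D')) (\<phi>' \<circ> inv_into D \<phi>))"

definition biholomorphic_to_ball :: "'m::topological_space set \<Rightarrow> ('m, 'j::finite) atlas \<Rightarrow> bool" where
  "biholomorphic_to_ball M \<A> \<longleftrightarrow>
    (\<exists>\<Phi> \<Psi>. homeomorphism M (ball (0 :: complex ^ 'j) 1) \<Phi> \<Psi> \<and>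
       (\<forall>(D, \<phi>)\<in>\<A>. hol_on (\<phi> ` D) (\<Phi> \<circ> inv_into D \<phi>) \<and> hol_on (\<Phi> ` D) (\<phi> \<circ> \<Psi>)))"

text \<open>Holomorphy of \<open>F : M \<times> \<P>\<^sup>k \<rightarrow> \<P>\<^sup>k\<close>: in every chart of \<open>M\<close>, \<open>F\<close> is given locally by holomorphic
  homogeneous coordinates without common zeros, as functions of the parameter and of the
  homogeneous coordinates of the point.\<close>

definition holomorphic_family ::
  "'m::topological_space set \<Rightarrow> ('m, 'j::finite) atlas \<Rightarrow> ('m \<Rightarrow> 'k::finite pspace \<Rightarrow> 'k pspace) \<Rightarrow> bool"
  where "holomorphic_family M \<A> F \<longleftrightarrow>
    (\<forall>(D, \<phi>)\<in>\<A>. \<forall>t\<in>\<phi> ` D. \<forall>z. z \<noteq> 0 \<longrightarrow>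
       (\<exists>N L. open N \<and> (t, z) \<in> N \<and> N \<subseteq> \<phi> ` D \<times> (- {0}) \<and> hol_on N L \<and>
          (\<forall>(t', y)\<in>N. L (t', y) \<noteq> 0 \<and> F (inv_into D \<phi> t') (pt y) = pt (L (t', y)))))"

end

theory Submission
  imports Defs
begin

text \<open>Upper semicontinuity of \<open>\<lambda> \<mapsto> A\<^sub>\<lambda>\<close> holds for every continuous family with a common trapping region.
  Lower semicontinuity follows from the weak continuity of \<open>\<tau>\<close> at \<open>\<lambda>\<^sub>0\<close>, because
  \<open>A\<^sub>\<lambda>\<^sub>0 = supp \<tau>(\<lambda>\<^sub>0)\<close>, as soon as \<open>supp \<tau>(\<lambda>) \<subseteq> A\<^sub>\<lambda>\<close> for every \<open>\<lambda>\<close>.  For the latter, let \<open>V\<close> be a trapping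
  region on which \<open>\<tau> = \<tau>(\<lambda>)\<close> is attractive.  If \<open>\<C>\<^sub>p(V)\<close> contains a current given by a continuous form,
  the Cesaro limit gives \<open>f\<^sub>* \<tau> = d\<^sup>s \<tau>\<close>, hence \<open>supp \<tau> \<subseteq> f\<^sup>n(supp \<tau>) \<subseteq> f\<^sup>n(U)\<close> for all \<open>n\<close>.  Otherwise every
  element of \<open>\<C>\<^sub>p(U \<inter> V)\<close> is vacuously attracting, so that \<open>\<C>\<^sub>p(U \<inter> V) = {\<tau>}\<close> by uniqueness; then \<open>\<tau>\<close> is
  invariant under small unitary transformations, its support is \<open>\<P>\<^sup>k\<close>, and \<open>A\<^sub>\<lambda> = \<P>\<^sup>k\<close> since
  \<open>f\<close> is surjective.\<close>

section \<open>Topology of the projective space\<close>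

text \<open>Attraction constrains \<tau> only through currents of \<open>\<C> p V\<close> given by
  continuous forms, and nothing in its definition provides such a current: this forces the case
  distinction. The region V depends on \<lambda> and is tied to U only through \<tau>, whose support
  lies in both. Uniqueness concerns \<open>\<C> p U\<close> and vacuous attraction concerns
  \<open>\<C> p V\<close>, so the two meet on U \<inter> V. Unitary maps suit the second case
  because they preserve the Fubini-Study form, hence the normalisation in \<open>\<C> p\<close>, and
  because a point can be moved to any sufficiently close one by a unitary map that displaces every
  point only a little. A current fixed by all of these has an open support, and connectedness of the
  projective space makes it everything. Surjectivity of endomorphisms is obtained from a minimum
  principle for homogeneous polynomial maps, which involves only elementary estimates along one
  complex line.\<close>

lemma scaleC_nth [simp]: "(c *\<^sub>C (z :: complex ^ 'i)) $ i = c * z $ i"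
  by (simp add: scaleC_vec_def scaleC_complex_def)

lemma scaleC_one [simp]: "1 *\<^sub>C (z :: 'a::complex_space) = z"
  using scaleC_of_real[of 1 z] by simp

lemma scaleC_zero_left [simp]: "0 *\<^sub>C (z :: 'a::complex_space) = 0"
  using scaleC_of_real[of 0 z] by simp

lemma scaleC_eq_0_iff [simp]: "c *\<^sub>C (z :: complex ^ 'i) = 0 \<longleftrightarrow> c = 0 \<or> z = 0"
  by (auto simp: vec_eq_iff)

lemma herm_add_right: "herm u (v + w) = herm u v + herm u w"
  by (simp add: herm_def algebra_simps sum.distrib)

text \<open>With this, a complex linear map that preserves norms, hence real inner products,
  preserves the Hermitian product as well.\<close>

lemma herm_eq_inner: "herm v w = Complex (v \<bullet> w) (((- \<i>) *\<^sub>C v) \<bullet> w)"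
  by (rule complex_eqI) (simp_all flip: Re_herm add: herm_scaleC_left)

lemma mem_cline [simp]: "z \<in> cline z"
  unfolding cline_def by (rule range_eqI[of _ _ 1]) simp

lemma pt_eq_iff:
  assumes "z \<noteq> 0" "w \<noteq> 0"
  shows "pt z = pt w \<longleftrightarrow> (\<exists>c. c \<noteq> 0 \<and> z = c *\<^sub>C w)"
proof
  assume "pt z = pt w"
  then have "cline z = cline w"
    unfolding pt_def using assms by (subst (asm) Abs_pspace_inject) auto
  then have "z \<in> cline w" using mem_cline[of z] by simp
  then obtain c where "z = c *\<^sub>C w" unfolding cline_def by blast
  then show "\<exists>c. c \<noteq> 0 \<and> z = c *\<^sub>C w" using assms by auto
qed (auto simp: pt_scaleC)

lemma fs_cos_pt:
  assumes "z \<noteq> 0" "w \<noteq> 0"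
  shows "fs_cos (pt z) (pt w) = cmod (herm z w) / (norm z * norm w)"
proof -
  obtain a where a: "a \<noteq> 0" "hrep (pt z) = a *\<^sub>C z"
    using hrep[of "pt z"] pt_eq_iff[of "hrep (pt z)" z] assms by auto
  obtain b where b: "b \<noteq> 0" "hrep (pt w) = b *\<^sub>C w"
    using hrep[of "pt w"] pt_eq_iff[of "hrep (pt w)" w] assms by auto
  show ?thesis using a b
    by (simp add: fs_cos_def herm_scaleC_left herm_scaleC_right norm_mult norm_scaleC)
qed

lemma dist_pt:
  assumes "z \<noteq> 0" "w \<noteq> 0"
  shows "dist (pt z) (pt w) = arccos (cmod (herm z w) / (norm z * norm w))"
  using assms by (simp add: dist_pspace_def fs_cos_pt)

lemma cos_dist: "cos (dist x y) = fs_cos (x :: 'k::finite pspace) y"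
  using fs_cos_bounds[of x y] by (simp add: dist_pspace_def)

lemma dist_pspace_bounds: "0 \<le> dist x y" "dist x (y :: 'k::finite pspace) \<le> pi / 2"
  using fs_cos_bounds[of x y] arccos_le_pi2[of "fs_cos x y"] zero_le_dist[of x y]
  by (auto simp: dist_pspace_def)

lemma continuous_on_herm_left: "continuous_on S (\<lambda>z. herm z w)"
  unfolding herm_def by (intro continuous_intros)

lemma continuous_on_pt: "continuous_on (- {0}) pt"
  unfolding continuous_on_def
proof
  fix w :: "'a hvec" assume w: "w \<in> - {0}"
  let ?g = "\<lambda>z. arccos (cmod (herm z w) / (norm z * norm w))"
  have "continuous_on (- {0}) ?g"
  proof (rule continuous_on_compose2[OF continuous_on_arccos'])
    show "continuous_on (- {0}) (\<lambda>z. cmod (herm z w) / (norm z * norm w))"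
      using w by (intro continuous_intros continuous_on_herm_left) auto
    show "(\<lambda>z. cmod (herm z w) / (norm z * norm w)) ` (- {0}) \<subseteq> {- 1..1}"
    proof (rule image_subsetI)
      fix z :: "'a hvec" assume "z \<in> - {0}"
      then have "cmod (herm z w) / (norm z * norm w) \<le> 1"
        using w cmod_herm_le[of z w] by simp
      moreover have "- 1 \<le> cmod (herm z w) / (norm z * norm w)"
        by (rule order_trans[of _ 0]) simp_all
      ultimately show "cmod (herm z w) / (norm z * norm w) \<in> {- 1..1}" by simp
    qed
  qed
  then have "(?g \<longlongrightarrow> ?g w) (at w within - {0})"
    using w by (simp add: continuous_on_def)
  moreover have "?g w = 0" using w by (simp add: herm_self power2_eq_square norm_mult)
  ultimately have "(?g \<longlongrightarrow> 0) (at w within - {0})" by simp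
  then have "((\<lambda>z. dist (pt z) (pt w)) \<longlongrightarrow> 0) (at w within - {0})"
    by (rule Lim_transform_eventually)
       (use w in \<open>auto simp: eventually_at_filter dist_pt\<close>)
  then show "(pt \<longlongrightarrow> pt w) (at w within - {0})" by (subst tendsto_dist_iff)
qed

text \<open>Among the lifts of x of the same norm as z, take the one whose phase makes its product
  with z real and nonnegative; the law of cosines then expresses its distance to z through the
  distance downstairs.\<close>

lemma lift_near:
  assumes "z \<noteq> 0"
  obtains y where "y \<noteq> 0" "pt y = x"
    "(norm (y - z))\<^sup>2 = 2 * (norm z)\<^sup>2 * (1 - cos (dist x (pt z)))"
proof -
  define v where "v = urep x"
  have v: "norm v = 1" "pt v = x" by (simp_all add: v_def urep)
  then have v0: "v \<noteq> 0" by auto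
  obtain g where g: "cmod g = 1" "norm (g *\<^sub>C v) = 1" "(g *\<^sub>C v) \<bullet> z = cmod (herm v z)"
    using aligned[OF v(1)] by metis
  define y where "y = norm z *\<^sub>R (g *\<^sub>C v)"
  have g0: "g \<noteq> 0" using g(1) by auto
  have y': "y = (of_real (norm z) * g) *\<^sub>C v"
    unfolding y_def by (simp flip: scaleC_of_real scaleC_scaleC)
  have "pt y = x" unfolding y' using g0 assms v by (subst pt_scaleC) auto
  moreover have "y \<noteq> 0" unfolding y' using g0 assms v0 by simp
  moreover have "cos (dist x (pt z)) = cmod (herm v z) / norm z"
    using fs_cos_pt[OF v0 assms] v by (simp add: cos_dist)
  moreover have "(norm (y - z))\<^sup>2 = (norm y)\<^sup>2 + (norm z)\<^sup>2 - 2 * (y \<bullet> z)"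
    by (simp add: power2_norm_eq_inner inner_diff_left inner_diff_right inner_commute[of z y])
  moreover have "norm y = norm z" "y \<bullet> z = norm z * cmod (herm v z)"
    unfolding y_def using g by simp_all
  ultimately show ?thesis using that[of y] assms by (simp add: power2_eq_square algebra_simps)
qed

text \<open>By \<open>lift_near\<close>, points close to \<open>pt z\<close> have lifts close to z.
  Openness of \<open>pt\<close> is what lets continuity on the projective space be checked on
  lifts.\<close>

lemma open_pt_image:
  assumes "open S" "0 \<notin> S"
  shows "open (pt ` S)"
  unfolding open_dist
proof
  fix u assume "u \<in> pt ` S"
  then obtain z where z: "z \<in> S" "u = pt z" by blast
  then have z0: "z \<noteq> 0" using assms by auto
  obtain e where e: "e > 0" "ball z e \<subseteq> S" using assms z open_contains_ball by blast
  have "((\<lambda>t. 2 * (norm z)\<^sup>2 * (1 - cos t)) \<longlongrightarrow> 2 * (norm z)\<^sup>2 * (1 - cos 0)) (at 0)"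
    by (intro tendsto_intros)
  then have "\<forall>\<^sub>F t in at 0. 2 * (norm z)\<^sup>2 * (1 - cos t) < e\<^sup>2"
    by (rule order_tendstoD) (use e in auto)
  then obtain \<delta> where \<delta>: "\<delta> > 0" "\<And>t::real. t \<noteq> 0 \<Longrightarrow> \<bar>t\<bar> < \<delta> \<Longrightarrow> 2 * (norm z)\<^sup>2 * (1 - cos t) < e\<^sup>2"
    unfolding eventually_at by (auto simp: dist_real_def)
  have "x \<in> pt ` S" if "dist x u < \<delta>" for x
  proof -
    obtain y where y: "y \<noteq> 0" "pt y = x"
      "(norm (y - z))\<^sup>2 = 2 * (norm z)\<^sup>2 * (1 - cos (dist x (pt z)))"
      using lift_near[OF z0] by metis
    have "(norm (y - z))\<^sup>2 < e\<^sup>2"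
      using \<delta>(2)[of "dist x u"] that y(3) z e(1) by (cases "dist x u = 0") auto
    then have "norm (y - z) < e" using e(1) by (simp add: power2_less_imp_less)
    then have "y \<in> S" using e by (auto simp: dist_norm norm_minus_commute)
    then show ?thesis using y by blast
  qed
  then show "\<exists>e>0. \<forall>x. dist x u < e \<longrightarrow> x \<in> pt ` S" using \<delta>(1) by blast
qed

lemma pt_sphere: "pt ` sphere 0 1 = (UNIV :: 'k::finite pspace set)"
proof -
  have "x \<in> pt ` sphere 0 1" for x :: "'k pspace"
    using urep[of x] by (intro image_eqI[of _ _ "urep x"]) auto
  then show ?thesis by blast
qed

lemma continuous_on_pt_sphere: "continuous_on (sphere 0 1) pt"
  by (rule continuous_on_subset[OF continuous_on_pt]) auto

lemma compact_pspace: "compact (UNIV :: 'k::finite pspace set)"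
  using compact_continuous_image[OF continuous_on_pt_sphere compact_sphere] by (simp add: pt_sphere)

lemma connected_pspace: "connected (UNIV :: 'k::finite pspace set)"
proof -
  have "connected (sphere (0 :: 'k hvec) 1)"
    by (rule connected_sphere) simp
  then show ?thesis
    using connected_continuous_image[OF continuous_on_pt_sphere] by (metis pt_sphere)
qed

lemma compact_closed_pspace: "closed S \<Longrightarrow> compact (S :: 'k::finite pspace set)"
  using compact_Int_closed[OF compact_pspace, of S] by simp

lemma bounded_bilinear_scaleC: "bounded_bilinear ((*\<^sub>C) :: complex \<Rightarrow> 'k::finite hvec \<Rightarrow> 'k hvec)"
proof
  show "\<exists>K. \<forall>a (b :: 'k hvec). norm (a *\<^sub>C b) \<le> norm a * norm b * K"
    by (intro exI[of _ 1]) (simp add: norm_scaleC)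
  fix r :: real and a :: complex and b :: "'k hvec"
  show "(r *\<^sub>R a) *\<^sub>C b = r *\<^sub>R a *\<^sub>C b"
    by (simp add: vec_eq_iff)
  show "a *\<^sub>C r *\<^sub>R b = r *\<^sub>R a *\<^sub>C b"
    by (simp add: vec_eq_iff)
qed (simp_all add: scaleC_add_right scaleC_add_left)

section \<open>Differentiability of higher order\<close>

text \<open>\<open>k + 1\<close> times differentiable; the derivatives are those of \<^const>\<open>deriv_along\<close>.\<close>

primrec Ck :: "nat \<Rightarrow> 'a::real_normed_vector set \<Rightarrow> ('a \<Rightarrow> 'b::real_normed_vector) \<Rightarrow> bool" where
  "Ck 0 X g \<longleftrightarrow> (\<forall>x\<in>X. g differentiable (at x))"
| "Ck (Suc k) X g \<longleftrightarrow> (\<forall>x\<in>X. g differentiable (at x)) \<and>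
     (\<forall>w. Ck k X (\<lambda>x. frechet_derivative g (at x) w))"

lemma deriv_along_snoc: "deriv_along (ws @ [w]) g = deriv_along ws (\<lambda>x. frechet_derivative g (at x) w)"
  by (simp add: deriv_along_def)

lemma deriv_along_Nil [simp]: "deriv_along [] g = g"
  by (simp add: deriv_along_def)

lemma deriv_along_Cons: "deriv_along (w # ws) g = (\<lambda>x. frechet_derivative (deriv_along ws g) (at x) w)"
  by (simp add: deriv_along_def)

text \<open>\<open>Ck\<close> peels off the derivative taken first, the last entry of the list, so
  that inductions on the order can generalise over the function; \<open>deriv_along_Cons\<close>
  peels off the derivative taken last.\<close>

lemma Ck_iff_deriv_along:
  "Ck k X g \<longleftrightarrow> (\<forall>ws. length ws \<le> k \<longrightarrow> (\<forall>x\<in>X. deriv_along ws g differentiable (at x)))"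
proof (induction k arbitrary: g)
  case 0 then show ?case by simp
next
  case (Suc k)
  have "(\<forall>ws. length ws \<le> Suc k \<longrightarrow> P ws) \<longleftrightarrow> P [] \<and> (\<forall>w ws. length ws \<le> k \<longrightarrow> P (ws @ [w]))"
    for P :: "'a list \<Rightarrow> bool"
  proof (intro iffI allI impI)
    fix ws :: "'a list" assume "P [] \<and> (\<forall>w ws. length ws \<le> k \<longrightarrow> P (ws @ [w]))" "length ws \<le> Suc k"
    then show "P ws" by (cases ws rule: rev_cases) auto
  qed auto
  then show ?case by (simp add: Suc.IH deriv_along_snoc)
qed

lemma smooth_on_iff_Ck: "smooth_on X g \<longleftrightarrow> (\<forall>k. Ck k X g)"
  by (auto simp: smooth_on_def Ck_iff_deriv_along)

lemma Ck_imp_differentiable: "Ck k X g \<Longrightarrow> x \<in> X \<Longrightarrow> g differentiable (at x)"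
  by (cases k) auto

lemma Ck_imp_has_derivative:
  "Ck k X g \<Longrightarrow> x \<in> X \<Longrightarrow> (g has_derivative frechet_derivative g (at x)) (at x)"
  using Ck_imp_differentiable frechet_derivative_works by blast

lemma Ck_Suc_imp: "Ck (Suc k) X g \<Longrightarrow> Ck k X g"
  by (auto simp: Ck_iff_deriv_along)

lemma has_derivative_cong_open:
  assumes "open X" "x \<in> X" "\<And>x. x \<in> X \<Longrightarrow> f x = g x" "(f has_derivative D) (at x)"
  shows "(g has_derivative D) (at x)"
  using has_derivative_transform_within_open[OF assms(4,1,2)] assms(3) by auto

lemma Ck_cong:
  assumes "open X" "\<And>x. x \<in> X \<Longrightarrow> f x = g x" "Ck k X f"
  shows "Ck k X g"
  using assms(2,3)
proof (induction k arbitrary: f g)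
  case (0 f g)
  then show ?case
    using has_derivative_cong_open[OF assms(1)] unfolding differentiable_def Ck.simps by metis
next
  case (Suc k f g)
  have D: "(g has_derivative frechet_derivative f (at x)) (at x)" if "x \<in> X" for x
    by (rule has_derivative_cong_open[OF assms(1) that Suc.prems(1)
        Ck_imp_has_derivative[OF Suc.prems(2) that]])
  have "frechet_derivative g (at x) = frechet_derivative f (at x)" if "x \<in> X" for x
    using frechet_derivative_at[OF D[OF that]] by simp
  then have "Ck k X (\<lambda>x. frechet_derivative g (at x) w)" for w
    using Suc.IH[of "\<lambda>x. frechet_derivative f (at x) w" "\<lambda>x. frechet_derivative g (at x) w"]
      Suc.prems(2) by simp
  then show ?case using D by (auto simp: differentiable_def)
qed

text \<open>Lets the closure properties below work with an explicit derivative D instead of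
  \<open>frechet_derivative\<close>.\<close>

lemma Ck_SucI:
  assumes "open X" "\<And>x. x \<in> X \<Longrightarrow> (g has_derivative D x) (at x)" "\<And>w. Ck k X (\<lambda>x. D x w)"
  shows "Ck (Suc k) X g"
proof -
  have "D x w = frechet_derivative g (at x) w" if "x \<in> X" for x w
    using frechet_derivative_at[OF assms(2)[OF that]] by simp
  then have "Ck k X (\<lambda>x. frechet_derivative g (at x) w)" for w
    by (intro Ck_cong[OF assms(1) _ assms(3)[of w]])
  then show ?thesis using assms(2) by (auto simp: differentiable_def)
qed

lemma Ck_const: "Ck k X (\<lambda>x. c)"
  by (induction k arbitrary: c) (simp_all add: frechet_derivative_const)

lemma Ck_bounded_linear:
  assumes "open X" "bounded_linear L" "Ck k X g"
  shows "Ck k X (\<lambda>x. L (g x))"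
  using assms(3)
proof (induction k arbitrary: g)
  case (0 g)
  then show ?case
    unfolding differentiable_def Ck.simps using bounded_linear.has_derivative[OF assms(2)] by blast
next
  case (Suc k g)
  have "((\<lambda>x. L (g x)) has_derivative (\<lambda>w. L (frechet_derivative g (at x) w))) (at x)"
    if "x \<in> X" for x
    by (rule bounded_linear.has_derivative[OF assms(2) Ck_imp_has_derivative[OF Suc.prems that]])
  then show ?case by (rule Ck_SucI[OF assms(1)]) (use Suc in auto)
qed

lemma Ck_ident: 
  assumes "open X" shows "Ck k X (\<lambda>x. x)"
proof (cases k)
  case (Suc k)
  then show ?thesis using assms Ck_SucI[of X "\<lambda>x. x" "\<lambda>_ w. w"] Ck_const by auto
qed simp

lemma Ck_linear:
  assumes "open X" "bounded_linear L" shows "Ck k X L"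
  using Ck_bounded_linear[OF assms Ck_ident[OF assms(1)]] .

lemma Ck_add:
  assumes "open X" "Ck k X f" "Ck k X g"
  shows "Ck k X (\<lambda>x. f x + g x)"
  using assms(2,3)
proof (induction k arbitrary: f g)
  case (0 f g)
  then show ?case by (auto intro: differentiable_add)
next
  case (Suc k f g)
  have "((\<lambda>x. f x + g x) has_derivative
      (\<lambda>w. frechet_derivative f (at x) w + frechet_derivative g (at x) w)) (at x)" if "x \<in> X" for x
    by (intro has_derivative_add Ck_imp_has_derivative[OF Suc.prems(1) that]
        Ck_imp_has_derivative[OF Suc.prems(2) that])
  then show ?case by (rule Ck_SucI[OF assms(1)]) (use Suc in auto)
qed

lemma Ck_sum:
  assumes "open X" "\<And>i. i \<in> I \<Longrightarrow> Ck k X (f i)"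
  shows "Ck k X (\<lambda>x. \<Sum>i\<in>I. f i x)"
  using assms(2)
  by (induction I rule: infinite_finite_induct) (auto intro: Ck_const Ck_add[OF assms(1)])

lemma Ck_bilinear:
  assumes "open X" "bounded_bilinear B" "Ck k X f" "Ck k X g"
  shows "Ck k X (\<lambda>x. B (f x) (g x))"
  using assms(3,4)
proof (induction k arbitrary: f g)
  case (0 f g)
  then show ?case
    unfolding differentiable_def Ck.simps using bounded_bilinear.FDERIV[OF assms(2)] by blast
next
  case (Suc k f g)
  have "((\<lambda>x. B (f x) (g x)) has_derivative
      (\<lambda>w. B (f x) (frechet_derivative g (at x) w) + B (frechet_derivative f (at x) w) (g x))) (at x)"
    if "x \<in> X" for x
    by (intro bounded_bilinear.FDERIV[OF assms(2)] Ck_imp_has_derivative[OF Suc.prems(1) that]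
        Ck_imp_has_derivative[OF Suc.prems(2) that])
  moreover have "Ck k X (\<lambda>x. B (f x) (frechet_derivative g (at x) w) + B (frechet_derivative f (at x) w) (g x))"
    for w
    using Suc Ck_Suc_imp[OF Suc.prems(1)] Ck_Suc_imp[OF Suc.prems(2)]
    by (intro Ck_add[OF assms(1)]) auto
  ultimately show ?case by (rule Ck_SucI[OF assms(1)])
qed

lemmas Ck_mult = Ck_bilinear[OF _ bounded_bilinear_mult]

lemma Ck_prod:
  fixes f :: "'i \<Rightarrow> 'a::real_normed_vector \<Rightarrow> 'b::real_normed_field"
  assumes "open X" "\<And>i. i \<in> I \<Longrightarrow> Ck k X (f i)"
  shows "Ck k X (\<lambda>x. \<Prod>i\<in>I. f i x)"
  using assms(2)
  by (induction I rule: infinite_finite_induct) (auto intro: Ck_const Ck_mult[OF assms(1)])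

lemma Ck_inverse:
  fixes f :: "'a::real_normed_vector \<Rightarrow> 'b::real_normed_field"
  assumes "open X" "Ck k X f" "\<And>x. x \<in> X \<Longrightarrow> f x \<noteq> 0"
  shows "Ck k X (\<lambda>x. inverse (f x))"
  using assms(2)
proof (induction k)
  case 0
  have "(\<lambda>x. inverse (f x)) differentiable (at x)" if "x \<in> X" for x
    using Deriv.has_derivative_inverse[OF assms(3)[OF that] Ck_imp_has_derivative[OF 0 that]]
    by (auto simp: differentiable_def)
  then show ?case by simp
next
  case (Suc k)
  have "((\<lambda>x. inverse (f x)) has_derivative
      (\<lambda>w. - (inverse (f x) * frechet_derivative f (at x) w * inverse (f x)))) (at x)"
    if "x \<in> X" for x
    by (rule Deriv.has_derivative_inverse[OF assms(3)[OF that] Ck_imp_has_derivative[OF Suc.prems that]])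
  moreover have "Ck k X (\<lambda>x. - (inverse (f x) * frechet_derivative f (at x) w * inverse (f x)))" for w
    using Suc.IH[OF Ck_Suc_imp[OF Suc.prems]] Suc.prems
    by (intro Ck_bounded_linear[OF assms(1) bounded_linear_minus[OF bounded_linear_ident]]
        Ck_mult[OF assms(1)]) auto
  ultimately show ?case by (rule Ck_SucI[OF assms(1)])
qed

lemma Ck_compose:
  fixes f :: "'a::real_normed_vector \<Rightarrow> 'b::euclidean_space"
  assumes "open X" "f ` X \<subseteq> Y" "Ck k Y g" "Ck k X f"
  shows "Ck k X (\<lambda>x. g (f x))"
  using assms(3,4)
proof (induction k arbitrary: g)
  case (0 g)
  then show ?case using assms(2) differentiable_compose[of g f] by fastforce
next
  case (Suc k g)
  \<comment> \<open>In the chain rule the outer derivative is taken in a direction that varies with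
    x, whereas \<open>Ck\<close> controls only fixed directions; expanding in the basis turns it
    into a finite sum of products to which the induction hypothesis applies.\<close>
  define D where "D x w = (\<Sum>b\<in>Basis. (frechet_derivative f (at x) w \<bullet> b) *\<^sub>R frechet_derivative g (at (f x)) b)"
    for x w
  have "((\<lambda>x. g (f x)) has_derivative D x) (at x)" if "x \<in> X" for x
  proof -
    have fx: "f x \<in> Y" using assms(2) that by blast
    note g' = Ck_imp_has_derivative[OF Suc.prems(1) fx]
    have "linear (frechet_derivative g (at (f x)))"
      using has_derivative_bounded_linear[OF g'] bounded_linear.linear by blast
    then have "frechet_derivative g (at (f x)) v = (\<Sum>b\<in>Basis. (v \<bullet> b) *\<^sub>R frechet_derivative g (at (f x)) b)" for v
      by (subst euclidean_representation[of v, symmetric])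
         (simp add: linear_sum linear_scale del: euclidean_representation)
    then have "(\<lambda>w. frechet_derivative g (at (f x)) (frechet_derivative f (at x) w)) = D x"
      unfolding D_def by blast
    then show ?thesis
      using has_derivative_compose[OF Ck_imp_has_derivative[OF Suc.prems(2) that] g'] by simp
  qed
  moreover have "Ck k X (\<lambda>x. D x w)" for w
    unfolding D_def
  proof (intro Ck_sum[OF assms(1)] Ck_bilinear[OF assms(1) bounded_bilinear_scaleR]
      Ck_bounded_linear[OF assms(1) bounded_linear_inner_left])
    show "Ck k X (\<lambda>x. frechet_derivative f (at x) w)" using Suc.prems by simp
    show "Ck k X (\<lambda>x. frechet_derivative g (at (f x)) b)" for b
      using Suc.IH[of "\<lambda>y. frechet_derivative g (at y) b"] Suc.prems Ck_Suc_imp by auto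
  qed
  ultimately show ?case by (rule Ck_SucI[OF assms(1)])
qed

section \<open>Plateau functions and supports of currents\<close>

text \<open>For m = 0 this is the classical flat function exp(-1/t). The extra power of 1/t makes
  the family closed under differentiation, up to linear combinations, so smoothness follows by an
  induction over all m at once.\<close>

definition flat :: "nat \<Rightarrow> real \<Rightarrow> real" where
  "flat m t = (if t > 0 then (1 / t) ^ m * exp (- (1 / t)) else 0)"

lemma flat_tendsto_0: "(flat m \<longlongrightarrow> 0) (at 0)"
proof (rule filterlim_split_at_real)
  show "(flat m \<longlongrightarrow> 0) (at_left 0)"
    by (rule Lim_transform_eventually[OF tendsto_const])
       (auto simp: eventually_at_filter flat_def)
  have "((\<lambda>t::real. (inverse t) ^ m / exp (inverse t)) \<longlongrightarrow> 0) (at_right 0)"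
    by (rule filterlim_compose[OF tendsto_power_div_exp_0 filterlim_inverse_at_top_right])
  then show "(flat m \<longlongrightarrow> 0) (at_right 0)"
    by (rule Lim_transform_eventually)
       (auto simp: eventually_at_filter flat_def exp_minus divide_simps)
qed

lemma flat_has_derivative:
  "(flat m has_derivative (\<lambda>w. w * (flat (m + 2) t - m * flat (m + 1) t))) (at t)"
proof -
  consider "t > 0" | "t < 0" | "t = 0" by linarith
  then have "(flat m has_real_derivative (flat (m + 2) t - m * flat (m + 1) t)) (at t)"
  proof cases
    case 1
    have "((\<lambda>t. (1 / t) ^ m * exp (- (1 / t))) has_real_derivative
        m * (1 / t) ^ (m - 1) * (- (1 / t\<^sup>2)) * exp (- (1 / t)) + (1 / t) ^ m * (exp (- (1 / t)) * (1 / t\<^sup>2))) (at t)"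
      using 1 by (auto intro!: derivative_eq_intros simp: power2_eq_square)
    also have "m * (1 / t) ^ (m - 1) * (- (1 / t\<^sup>2)) * exp (- (1 / t)) + (1 / t) ^ m * (exp (- (1 / t)) * (1 / t\<^sup>2)) =
        flat (m + 2) t - m * flat (m + 1) t"
      using 1 by (cases m) (simp_all add: flat_def power2_eq_square divide_simps)
    finally have "((\<lambda>t. (1 / t) ^ m * exp (- (1 / t))) has_real_derivative
        flat (m + 2) t - m * flat (m + 1) t) (at t)" .
    then show ?thesis
      by (rule has_field_derivative_transform_within_open[where S = "{0<..}"])
         (use 1 in \<open>auto simp: flat_def\<close>)
  next
    case 2
    have "((\<lambda>t. 0) has_real_derivative 0) (at t)" by simp
    then have "(flat m has_real_derivative 0) (at t)"
      by (rule has_field_derivative_transform_within_open[where S = "{..<0}"])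
         (use 2 in \<open>auto simp: flat_def\<close>)
    then show ?thesis using 2 by (simp add: flat_def)
  next
    case 3
    \<comment> \<open>Away from h = 0 the difference quotient of \<open>flat m\<close> at 0 is
      \<open>flat (Suc m)\<close>.\<close>
    have "((\<lambda>h. (flat m (0 + h) - flat m 0) / h) \<longlongrightarrow> 0) (at 0)"
      by (rule Lim_transform_eventually[OF flat_tendsto_0[of "Suc m"]])
         (auto simp: flat_def eventually_at_filter)
    then show ?thesis using 3 by (simp add: DERIV_def flat_def)
  qed
  then show ?thesis
    by (simp add: has_field_derivative_def mult.commute[of _ "flat (m + 2) t - m * flat (m + 1) t"])
       (simp add: mult_commute_abs)
qed

lemma Ck_flat: "Ck k UNIV (flat m)"
proof (induction k arbitrary: m)
  case 0
  then show ?case using flat_has_derivative by (auto simp: differentiable_def)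
next
  case (Suc k m)
  have "Ck k UNIV (\<lambda>t. w * (flat (m + 2) t + (- real m) * flat (m + 1) t))" for w
    by (intro Ck_mult Ck_add Ck_const Suc) auto
  then show ?case
    by (intro Ck_SucI[OF open_UNIV flat_has_derivative]) simp
qed

definition smooth_step :: "real \<Rightarrow> real" where
  "smooth_step t = flat 0 t * inverse (flat 0 t + flat 0 (1 - t))"

lemma smooth_step_eq: "t \<le> 0 \<Longrightarrow> smooth_step t = 0" "t \<ge> 1 \<Longrightarrow> smooth_step t = 1"
  by (auto simp: smooth_step_def flat_def)

lemma Ck_smooth_step: "Ck k UNIV smooth_step"
  unfolding smooth_step_def
proof (intro Ck_mult Ck_inverse Ck_add Ck_flat open_UNIV)
  show "Ck k UNIV (\<lambda>t. flat 0 (1 - t))"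
  proof (rule Ck_compose[OF open_UNIV _ Ck_flat])
    have "Ck k UNIV (\<lambda>t::real. 1 + (- t))"
      by (intro Ck_add Ck_const Ck_linear bounded_linear_minus bounded_linear_ident open_UNIV)
    then show "Ck k UNIV (\<lambda>t::real. 1 - t)" by simp
  qed simp
  \<comment> \<open>The numbers t and 1 - t are never both nonpositive, so one of the two summands
    is positive.\<close>
  show "flat 0 t + flat 0 (1 - t) \<noteq> 0" for t
    using exp_gt_zero[of "- (1 / t)"] exp_gt_zero[of "- (1 / (1 - t))"]
    by (cases "t > 0"; cases "t < 1") (simp_all add: flat_def add_pos_pos less_imp_neq[symmetric])
qed

text \<open>The square removes the modulus, which is not smooth where it vanishes: what remains is a
  quotient of quadratic forms in z, the real and imaginary parts of \<open>herm z w\<close> being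
  inner products with w and with \<i> times w.\<close>

lemma fs_cos_smooth:
  "Ck k (- {0}) (\<lambda>z. (fs_cos (pt z) x)\<^sup>2)"
proof -
  obtain w where w: "w \<noteq> 0" "pt w = x" using hrep by metis
  let ?A = "\<lambda>z. (z \<bullet> w) * (z \<bullet> w) + (z \<bullet> (\<i> *\<^sub>C w)) * (z \<bullet> (\<i> *\<^sub>C w))"
  have o: "open (- {0 :: 'a hvec})" by auto
  have "Ck k (- {0}) (\<lambda>z. ?A z * inverse ((z \<bullet> z) * (w \<bullet> w)))"
    using w by (intro Ck_mult[OF o] Ck_add[OF o] Ck_inverse[OF o] Ck_const
        Ck_bilinear[OF o bounded_bilinear_inner] Ck_ident[OF o]) auto
  moreover have "?A z * inverse ((z \<bullet> z) * (w \<bullet> w)) = (fs_cos (pt z) x)\<^sup>2" if "z \<in> - {0}" for z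
  proof -
    have "z \<bullet> (\<i> *\<^sub>C w) = Im (herm z w)"
      by (simp flip: Re_herm add: herm_scaleC_right)
    then have "?A z = (cmod (herm z w))\<^sup>2"
      by (simp add: cmod_power2 Re_herm flip: power2_eq_square)
    then show ?thesis using that w fs_cos_pt[of z w]
      by (simp add: power_divide power_mult_distrib divide_inverse inverse_mult_distrib power_inverse flip: power2_norm_eq_inner)
  qed
  ultimately show ?thesis by (rule Ck_cong[OF o, rotated])
qed

definition smooth_fun :: "('k::finite pspace \<Rightarrow> real) \<Rightarrow> bool" where
  "smooth_fun h \<longleftrightarrow> smooth_on (- {0}) (\<lambda>z. h (pt z))"

lemma bump_exists:
  fixes x :: "'k::finite pspace"
  assumes "open V" "x \<in> V"
  shows "\<exists>N \<psi>. open N \<and> x \<in> N \<and> smooth_fun \<psi> \<and> (\<forall>y\<in>N. \<psi> y = 1) \<and>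
    closure {y. \<psi> y \<noteq> 0} \<subseteq> V"
proof -
  obtain e where e: "e > 0" "ball x e \<subseteq> V" using assms open_contains_ball by blast
  define \<delta> where "\<delta> = min e 1"
  have \<delta>: "0 < \<delta>" "\<delta> \<le> 1" "ball x \<delta> \<subseteq> V" using e by (auto simp: \<delta>_def)
  \<comment> \<open>Distances are at most \<pi>/2 and the squared cosine decreases on [0, \<pi>/2],
    so its thresholds a and b encode the radii \<delta>/2 and \<delta>/4; the bound \<delta> \<le> 1
    keeps both radii in that interval.\<close>
  define a b where "a = (cos (\<delta> / 2))\<^sup>2" and "b = (cos (\<delta> / 4))\<^sup>2"
  have pi: "pi > 3" using pi_gt3 .
  have mono: "(cos s)\<^sup>2 < (cos t)\<^sup>2" if "0 \<le> t" "t < s" "s \<le> pi / 2" for s t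
    using that pi by (intro power_strict_mono cos_monotone_0_pi cos_ge_zero) auto
  have ab: "a < b" unfolding a_def b_def using \<delta> pi by (intro mono) auto
  define \<psi> where "\<psi> y = smooth_step (((fs_cos y x)\<^sup>2 - a) / (b - a))" for y
  have "smooth_fun \<psi>"
    unfolding smooth_fun_def smooth_on_iff_Ck
  proof
    fix k
    have o: "open (- {0 :: 'k hvec})" by auto
    have "Ck k (- {0 :: 'k hvec}) (\<lambda>z. smooth_step (((fs_cos (pt z) x)\<^sup>2 + (- a)) * inverse (b - a)))"
      by (rule Ck_compose[OF o _ Ck_smooth_step]; (intro Ck_mult[OF o] Ck_add[OF o] fs_cos_smooth Ck_const)?) auto
    then show "Ck k (- {0 :: 'k hvec}) (\<lambda>z. \<psi> (pt z))" by (simp add: \<psi>_def divide_inverse)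
  qed
  moreover have "\<psi> y = 1" if "y \<in> ball x (\<delta> / 4)" for y
  proof -
    have "b < (cos (dist y x))\<^sup>2"
      unfolding b_def using that \<delta> pi by (intro mono) (auto simp: dist_commute)
    then show ?thesis using ab by (simp add: \<psi>_def cos_dist smooth_step_eq)
  qed
  moreover have "closure {y. \<psi> y \<noteq> 0} \<subseteq> V"
  proof -
    have "y \<in> cball x (\<delta> / 2)" if "\<psi> y \<noteq> 0" for y
    proof (rule ccontr)
      assume "y \<notin> cball x (\<delta> / 2)"
      then have "(cos (dist y x))\<^sup>2 < a"
        unfolding a_def using dist_pspace_bounds[of y x] \<delta> by (intro mono) (auto simp: dist_commute)
      then have "\<psi> y = 0"
        using ab by (simp add: \<psi>_def cos_dist smooth_step_eq divide_nonpos_pos)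
      then show False using that by simp
    qed
    then have "closure {y. \<psi> y \<noteq> 0} \<subseteq> cball x (\<delta> / 2)"
      by (intro closure_minimal) auto
    also have "\<dots> \<subseteq> ball x \<delta>" using \<delta> by auto
    finally show ?thesis using \<delta> by simp
  qed
  ultimately show ?thesis
    using \<delta>(1) by (intro exI[of _ "ball x (\<delta> / 4)"] exI[of _ \<psi>]) auto
qed

section \<open>Forms, and the vanishing of a current off its support\<close>

lemma diff_formI:
  assumes "\<And>z v v'. (\<And>i. i < m \<Longrightarrow> v i = v' i) \<Longrightarrow> \<alpha> z v = \<alpha> z v'"
    and "\<And>v. \<alpha> 0 v = 0"
    and "\<And>z v i. i < m \<Longrightarrow> linear (\<lambda>x. \<alpha> z (v(i := x)))"
    and "\<And>z v i j. i < j \<Longrightarrow> j < m \<Longrightarrow> v i = v j \<Longrightarrow> \<alpha> z v = 0"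
    and "\<And>z v c. c \<noteq> 0 \<Longrightarrow> \<alpha> (c *\<^sub>C z) (\<lambda>i. c *\<^sub>C v i) = \<alpha> z v"
    and "\<And>z v i c. i < m \<Longrightarrow> v i = c *\<^sub>C z \<Longrightarrow> \<alpha> z v = 0"
  shows "diff_form m \<alpha>"
  unfolding diff_form_def
proof (intro conjI allI impI, goal_cases)
  case (1 z v v')
  then show ?case by (intro assms(1)) blast
next
  case (4 z v i j)
  then show ?case by (elim conjE) (rule assms(4))
next
  case (6 z v i c)
  then show ?case by (elim conjE) (rule assms(6))
qed (fact assms(2), erule assms(3), erule assms(5))

lemma diff_formD:
  assumes "diff_form m \<alpha>"
  shows "(\<And>i. i < m \<Longrightarrow> v i = v' i) \<Longrightarrow> \<alpha> z v = \<alpha> z v'"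
    and "\<alpha> 0 v = 0"
    and "i < m \<Longrightarrow> linear (\<lambda>x. \<alpha> z (v(i := x)))"
    and "i < j \<Longrightarrow> j < m \<Longrightarrow> v i = v j \<Longrightarrow> \<alpha> z v = 0"
    and "c \<noteq> 0 \<Longrightarrow> \<alpha> (c *\<^sub>C z) (\<lambda>i. c *\<^sub>C v i) = \<alpha> z v"
    and "i < m \<Longrightarrow> v i = c' *\<^sub>C z \<Longrightarrow> \<alpha> z v = 0"
proof -
  note A = assms[unfolded diff_form_def]
  note * = A[THEN conjunct1]
    A[THEN conjunct2, THEN conjunct2, THEN conjunct2, THEN conjunct1]
    A[THEN conjunct2, THEN conjunct2, THEN conjunct2, THEN conjunct2, THEN conjunct2]
  show "\<alpha> z v = \<alpha> z v'" if "\<And>i. i < m \<Longrightarrow> v i = v' i"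
    using *(1)[rule_format, of v v'] that by simp
  show "\<alpha> z v = 0" if "i < j" "j < m" "v i = v j"
    using *(2)[rule_format, of i j v] that by simp
  show "\<alpha> z v = 0" if "i < m" "v i = c' *\<^sub>C z"
    using *(3)[rule_format, of i v c' z] that by simp
qed (use assms in \<open>simp_all add: diff_form_def\<close>)

lemma smooth_form_mult:
  assumes "smooth_fun h" "smooth_form m \<alpha>"
  shows "smooth_form m (\<lambda>z v. of_real (h (pt z)) * \<alpha> z v)"
proof -
  have d: "diff_form m \<alpha>" using assms(2) by (simp add: smooth_form_def)
  note D = diff_formD[OF d]
  have "diff_form m (\<lambda>z v. of_real (h (pt z)) * \<alpha> z v)"
  proof (rule diff_formI, goal_cases)
    case (1 z v v')
    then show ?case using D(1)[of v v' z] by simp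
  next
    case (3 z v i)
    then show ?case
      using linear_compose[OF D(3) bounded_linear.linear[OF bounded_linear_mult_right]]
      by (simp add: o_def)
  next
    case (4 z v i j)
    then show ?case using D(4)[of i j v z] by simp
  next
    case (6 z v i c)
    then show ?case using D(6)[of i v c z] by simp
  qed (simp_all add: D(2,5) pt_scaleC)
  moreover have "smooth_on (- {0}) (\<lambda>z. of_real (h (pt z)) * \<alpha> z v)" for v
  proof -
    have o: "open (- {0 :: 'a hvec})" by auto
    have "Ck k (- {0}) (\<lambda>z. h (pt z))" "Ck k (- {0}) (\<lambda>z. \<alpha> z v)" for k
      using assms by (simp_all add: smooth_form_def smooth_fun_def smooth_on_iff_Ck)
    then have "Ck k (- {0}) (\<lambda>z. of_real (h (pt z)) * \<alpha> z v)" for k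
      by (intro Ck_mult[OF o] Ck_bounded_linear[OF o bounded_linear_of_real])
    then show ?thesis by (simp add: smooth_on_iff_Ck)
  qed
  ultimately show ?thesis by (simp add: smooth_form_def)
qed

text \<open>Instead of a partition of unity, multiply \<open>\<beta>\<close> by \<open>\<Prod>(1 - \<psi>\<^sub>i)\<close>, which vanishes on its support, with
  plateau functions \<open>\<psi>\<^sub>i\<close>; this avoids dividing by \<open>\<Sum>\<psi>\<^sub>i\<close>.\<close>

lemma current_eq_0:
  assumes S: "current m S" and \<beta>: "smooth_form m \<beta>"
    and disj: "form_support \<beta> \<inter> current_support m S = {}"
  shows "S \<beta> = 0"
proof -
  \<comment> \<open>Membership records that S annihilates every multiple of \<psi>; this is how the
    local vanishing of S enters the induction below.\<close>
  define B where "B = {(N, \<psi>). open N \<and> smooth_fun \<psi> \<and> (\<forall>y\<in>N. \<psi> y = 1) \<and>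
    (\<forall>\<alpha>. smooth_form m \<alpha> \<longrightarrow> S (\<lambda>z v. of_real (\<psi> (pt z)) * \<alpha> z v) = 0)}"
  have "\<exists>b\<in>B. x \<in> fst b" if "x \<in> form_support \<beta>" for x
  proof -
    have "x \<notin> current_support m S" using that disj by blast
    then obtain V where V: "open V" "x \<in> V"
      "\<forall>\<alpha>. smooth_form m \<alpha> \<and> form_support \<alpha> \<subseteq> V \<longrightarrow> S \<alpha> = 0"
      by (auto simp: current_support_def)
    obtain N \<psi> where \<psi>: "open N" "x \<in> N" "smooth_fun \<psi>" "\<forall>y\<in>N. \<psi> y = 1"
      "closure {y. \<psi> y \<noteq> 0} \<subseteq> V"
      using bump_exists[OF V(1,2)] by blast
    have "form_support (\<lambda>z v. of_real (\<psi> (pt z)) * \<alpha> z v) \<subseteq> V" for \<alpha>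
      unfolding form_support_def by (rule order_trans[OF closure_mono \<psi>(5)]) auto
    then have "(N, \<psi>) \<in> B" using \<psi> V by (auto simp: B_def smooth_form_mult)
    then show ?thesis using \<psi> by force
  qed
  then have "form_support \<beta> \<subseteq> \<Union> (fst ` B)" by blast
  moreover have "compact (form_support \<beta>)"
    unfolding form_support_def by (rule compact_closed_pspace) simp
  moreover have "\<And>N. N \<in> fst ` B \<Longrightarrow> open N" by (auto simp: B_def)
  ultimately obtain C where C: "C \<subseteq> fst ` B" "finite C" "form_support \<beta> \<subseteq> \<Union> C"
    by (meson compactE)
  obtain G where G: "G \<subseteq> B" "finite G" "C = fst ` G"
    using finite_subset_image[OF C(2,1)] by metis
  have ind: "\<exists>h. smooth_fun h \<and> (\<forall>b\<in>G. \<forall>y\<in>fst b. h y = 0) \<and> S \<beta> = S (\<lambda>z v. of_real (h (pt z)) * \<beta> z v)"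
    using G(2,1)
  proof (induction G rule: finite_induct)
    case empty
    show ?case
      by (intro exI[of _ "\<lambda>_. 1"]) (simp add: smooth_fun_def smooth_on_iff_Ck Ck_const)
  next
    case (insert b G)
    then obtain h where h: "smooth_fun h" "\<forall>b\<in>G. \<forall>y\<in>fst b. h y = 0"
      "S \<beta> = S (\<lambda>z v. of_real (h (pt z)) * \<beta> z v)" by auto
    obtain N \<psi> where b: "b = (N, \<psi>)" by (cases b)
    then have \<psi>: "smooth_fun \<psi>" "\<And>y. y \<in> N \<Longrightarrow> \<psi> y = 1"
      "\<And>\<alpha>. smooth_form m \<alpha> \<Longrightarrow> S (\<lambda>z v. of_real (\<psi> (pt z)) * \<alpha> z v) = 0"
      using insert.prems by (auto simp: B_def)
    let ?\<gamma> = "\<lambda>z v. of_real (h (pt z)) * \<beta> z v"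
    have o: "open (- {0 :: 'a hvec})" by auto
    have "smooth_fun (\<lambda>y. 1 + (- 1) * \<psi> y)"
      using \<psi>(1) unfolding smooth_fun_def smooth_on_iff_Ck
      by (intro allI Ck_mult[OF o] Ck_add[OF o] Ck_const) simp
    then have \<psi>': "smooth_fun (\<lambda>y. 1 - \<psi> y)" by simp
    have \<gamma>: "smooth_form m ?\<gamma>" using smooth_form_mult[OF h(1) \<beta>] .
    \<comment> \<open>Split \<gamma> into \<psi>\<gamma> and (1 - \<psi>)\<gamma>: S annihilates the
      first part, so passing to the second leaves the value of S unchanged and makes the factor
      vanish on N too.\<close>
    have "S (\<lambda>z v. of_real (\<psi> (pt z)) * ?\<gamma> z v + of_real (1 - \<psi> (pt z)) * ?\<gamma> z v) =
       S (\<lambda>z v. of_real (\<psi> (pt z)) * ?\<gamma> z v) + S (\<lambda>z v. of_real (1 - \<psi> (pt z)) * ?\<gamma> z v)"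
      using S smooth_form_mult[OF \<psi>(1) \<gamma>] smooth_form_mult[OF \<psi>' \<gamma>] unfolding current_def by blast
    moreover have "(\<lambda>z v. of_real (\<psi> (pt z)) * ?\<gamma> z v + of_real (1 - \<psi> (pt z)) * ?\<gamma> z v) = ?\<gamma>"
      by (simp add: algebra_simps)
    ultimately have "S \<beta> = S (\<lambda>z v. of_real (1 - \<psi> (pt z)) * ?\<gamma> z v)"
      using \<psi>(3)[OF \<gamma>] h(3) by simp
    moreover have "smooth_fun (\<lambda>y. (1 - \<psi> y) * h y)"
      using \<psi>' h(1) unfolding smooth_fun_def smooth_on_iff_Ck
      by (intro allI Ck_mult[OF o]) simp_all
    ultimately show ?case using h(2) \<psi>(2) b
      by (intro exI[of _ "\<lambda>y. (1 - \<psi> y) * h y"]) (auto simp: mult.assoc)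
  qed
  then obtain h where h: "\<forall>b\<in>G. \<forall>y\<in>fst b. h y = 0" "S \<beta> = S (\<lambda>z v. of_real (h (pt z)) * \<beta> z v)"
    by blast
  have "of_real (h (pt z)) * \<beta> z v = 0" for z v
  proof (cases "z = 0 \<or> \<beta> z v = 0")
    case True
    then show ?thesis using \<beta> by (auto simp: smooth_form_def diff_form_def)
  next
    case False
    then have "pt z \<in> form_support \<beta>"
      unfolding form_support_def by (intro subsetD[OF closure_subset]) blast
    then show ?thesis using C(3) G(3) h(1) by auto
  qed
  then have "(\<lambda>z v. of_real (h (pt z)) * \<beta> z v) = (\<lambda>z v. 0 * \<beta> z v)"
    by (intro ext) simp
  then have "S \<beta> = S (\<lambda>z v. 0 * \<beta> z v)" using h(2) by simp
  also have "\<dots> = 0 * S \<beta>" using S \<beta> unfolding current_def by blast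
  finally show ?thesis by simp
qed

section \<open>Currents and unitary transformations\<close>

lemma smooth_form_add:
  assumes "smooth_form m \<alpha>" "smooth_form m \<beta>"
  shows "smooth_form m (\<lambda>z v. \<alpha> z v + \<beta> z v)"
proof -
  have d: "diff_form m \<alpha>" "diff_form m \<beta>" using assms by (auto simp: smooth_form_def)
  note D = diff_formD[OF d(1)] and E = diff_formD[OF d(2)]
  have "diff_form m (\<lambda>z v. \<alpha> z v + \<beta> z v)"
  proof (rule diff_formI, goal_cases)
    case (1 z v v')
    then show ?case using D(1)[of v v' z] E(1)[of v v' z] by simp
  next
    case (4 z v i j)
    then show ?case using D(4)[of i j v z] E(4)[of i j v z] by simp
  next
    case (6 z v i c)
    then show ?case using D(6)[of i v c z] E(6)[of i v c z] by simp
  qed (simp_all add: D(2,3,5) E(2,3,5) linear_compose_add)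
  moreover have o: "open (- {0 :: 'a hvec})" by auto
  have "Ck k (- {0}) (\<lambda>z. \<alpha> z v + \<beta> z v)" for k v
    by (rule Ck_add[OF o]) (use assms in \<open>auto simp: smooth_form_def smooth_on_iff_Ck\<close>)
  ultimately show ?thesis by (simp add: smooth_form_def smooth_on_iff_Ck)
qed

lemma smooth_form_cmult:
  assumes "smooth_form m \<alpha>"
  shows "smooth_form m (\<lambda>z v. c * \<alpha> z v)"
proof -
  have d: "diff_form m \<alpha>" using assms by (auto simp: smooth_form_def)
  note D = diff_formD[OF d]
  have "diff_form m (\<lambda>z v. c * \<alpha> z v)"
  proof (rule diff_formI, goal_cases)
    case (1 z v v')
    then show ?case using D(1)[of v v' z] by simp
  next
    case (3 z v i)
    then show ?case
      using linear_compose[OF D(3) bounded_linear.linear[OF bounded_linear_mult_right]]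
      by (simp add: o_def)
  next
    case (4 z v i j)
    then show ?case using D(4)[of i j v z] by simp
  next
    case (6 z v i c')
    then show ?case using D(6)[of i v c' z] by simp
  qed (simp_all add: D(2,5))
  moreover have o: "open (- {0 :: 'a hvec})" by auto
  have "Ck k (- {0}) (\<lambda>z. c * \<alpha> z v)" for k v
    by (rule Ck_mult[OF o Ck_const]) (use assms in \<open>auto simp: smooth_form_def smooth_on_iff_Ck\<close>)
  ultimately show ?thesis by (simp add: smooth_form_def smooth_on_iff_Ck)
qed

section \<open>Transport of forms and currents by unitary maps\<close>

definition unitary :: "('k::finite hvec \<Rightarrow> 'k hvec) \<Rightarrow> bool" where
  "unitary A \<longleftrightarrow> linear A \<and> (\<forall>c z. A (c *\<^sub>C z) = c *\<^sub>C A z) \<and> (\<forall>z. norm (A z) = norm z)"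

definition unitary_act :: "('k::finite hvec \<Rightarrow> 'k hvec) \<Rightarrow> 'k pspace \<Rightarrow> 'k pspace" where
  "unitary_act A x = pt (A (hrep x))"

text \<open>A is a global linear lift of the map it induces and is its own derivative, so this is
  the pull-back of \<alpha> by \<open>unitary_act A\<close>.\<close>

definition unitary_pull :: "('k::finite hvec \<Rightarrow> 'k hvec) \<Rightarrow> 'k form \<Rightarrow> 'k form" where
  "unitary_pull A \<alpha> = (\<lambda>z v. \<alpha> (A z) (\<lambda>i. A (v i)))"

definition unitary_push :: "nat \<Rightarrow> ('k::finite hvec \<Rightarrow> 'k hvec) \<Rightarrow> 'k functional \<Rightarrow> 'k functional" where
  "unitary_push m A S \<alpha> = (if smooth_form m \<alpha> then S (unitary_pull A \<alpha>) else 0)"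

context
  fixes A :: "'k::finite hvec \<Rightarrow> 'k hvec"
  assumes A: "unitary A"
begin

lemma unitary_bounded_linear: "bounded_linear A"
  using A by (simp add: unitary_def linear_conv_bounded_linear)

lemma unitary_scaleC: "A (c *\<^sub>C z) = c *\<^sub>C A z"
  using A by (simp add: unitary_def)

lemma unitary_norm: "norm (A z) = norm z"
  using A by (simp add: unitary_def)

lemma unitary_eq_0_iff: "A z = 0 \<longleftrightarrow> z = 0"
  using unitary_norm[of z] by (metis norm_eq_zero)

lemma unitary_herm: "herm (A z) (A w) = herm z w"
proof -
  have "orthogonal_transformation A"
    using A by (simp add: orthogonal_transformation unitary_def)
  then have "A z \<bullet> A w = z \<bullet> w" for z w by (simp add: orthogonal_transformation_def)
  then show ?thesis by (simp add: herm_eq_inner flip: unitary_scaleC)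
qed

lemma unitary_surj: "surj A"
proof -
  have "orthogonal_transformation A"
    using A by (simp add: orthogonal_transformation unitary_def)
  then show ?thesis by (rule orthogonal_transformation_surj)
qed

lemma unitary_act_pt:
  assumes "z \<noteq> 0"
  shows "unitary_act A (pt z) = pt (A z)"
proof -
  obtain a where a: "a \<noteq> 0" "hrep (pt z) = a *\<^sub>C z"
    using hrep[of "pt z"] pt_eq_iff[of "hrep (pt z)" z] assms by auto
  then show ?thesis by (simp add: unitary_act_def unitary_scaleC pt_scaleC)
qed

lemma fs_cos_unitary_act: "fs_cos (unitary_act A x) (unitary_act A y) = fs_cos x y"
proof -
  obtain z w where z: "z \<noteq> 0" "pt z = x" and w: "w \<noteq> 0" "pt w = y" using hrep by metis
  have "fs_cos (unitary_act A (pt z)) (unitary_act A (pt w)) = fs_cos (pt z) (pt w)"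
    using z(1) w(1) by (simp add: unitary_act_pt fs_cos_pt unitary_eq_0_iff unitary_herm unitary_norm)
  then show ?thesis using z w by simp
qed

lemma dist_unitary_act: "dist (unitary_act A x) (unitary_act A y) = dist x y"
  by (simp add: dist_pspace_def fs_cos_unitary_act)

lemma continuous_on_unitary_act: "continuous_on X (unitary_act A)"
  by (auto simp: continuous_on_iff dist_unitary_act)

lemma inj_unitary_act: "inj (unitary_act A)"
  by (rule injI) (metis dist_unitary_act dist_eq_0_iff)

lemma surj_unitary_act: "surj (unitary_act A)"
proof (rule surjI)
  fix x :: "'k pspace"
  show "unitary_act A (pt (inv A (hrep x))) = x"
    using hrep[of x] unitary_eq_0_iff[of "inv A (hrep x)"]
    by (simp add: unitary_act_pt surj_f_inv_f[OF unitary_surj])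
qed

lemma deriv_along_unitary:
  assumes "smooth_on (- {0}) g" "z \<noteq> 0"
  shows "deriv_along ws (\<lambda>z. g (A z)) z = deriv_along (map A ws) g (A z)"
    and "deriv_along ws (\<lambda>z. g (A z)) differentiable (at z)"
proof -
  have D: "((\<lambda>z. deriv_along us g (A z)) has_derivative
      (\<lambda>w. frechet_derivative (deriv_along us g) (at (A z)) (A w))) (at z)" if "z \<noteq> 0" for us z
  proof (rule has_derivative_compose[OF bounded_linear_imp_has_derivative[OF unitary_bounded_linear]])
    show "(deriv_along us g has_derivative frechet_derivative (deriv_along us g) (at (A z))) (at (A z))"
      using assms(1) that by (simp add: smooth_on_def unitary_eq_0_iff flip: frechet_derivative_works)
  qed
  have o: "open (- {0 :: 'k hvec})" by auto
  have eq: "deriv_along ws (\<lambda>z. g (A z)) z = deriv_along (map A ws) g (A z)" if "z \<noteq> 0" for ws z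
    using that
  proof (induction ws arbitrary: z)
    case (Cons w ws)
    have "(deriv_along ws (\<lambda>z. g (A z)) has_derivative
        (\<lambda>w. frechet_derivative (deriv_along (map A ws) g) (at (A z)) (A w))) (at z)"
      by (rule has_derivative_cong_open[OF o _ _ D]) (use Cons in auto)
    from fun_cong[OF frechet_derivative_at[OF this], of w] show ?case by (simp add: deriv_along_Cons)
  qed simp
  then show "deriv_along ws (\<lambda>z. g (A z)) z = deriv_along (map A ws) g (A z)" using assms by blast
  have "(deriv_along ws (\<lambda>z. g (A z)) has_derivative
        (\<lambda>w. frechet_derivative (deriv_along (map A ws) g) (at (A z)) (A w))) (at z)"
    by (rule has_derivative_cong_open[OF o _ _ D]) (use assms eq in auto)
  then show "deriv_along ws (\<lambda>z. g (A z)) differentiable (at z)" by (auto simp: differentiable_def)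
qed

lemma smooth_form_unitary_pull:
  assumes "smooth_form m \<alpha>"
  shows "smooth_form m (unitary_pull A \<alpha>)"
proof -
  have d: "diff_form m \<alpha>" using assms by (auto simp: smooth_form_def)
  note D = diff_formD[OF d]
  have A0: "A 0 = 0" by (simp add: unitary_eq_0_iff)
  have "diff_form m (unitary_pull A \<alpha>)"
    unfolding unitary_pull_def
  proof (rule diff_formI, goal_cases)
    case (1 z v v')
    then show ?case using D(1)[of "\<lambda>i. A (v i)" "\<lambda>i. A (v' i)" "A z"] by simp
  next
    case (3 z v i)
    have "(\<lambda>ia. A ((v(i := x)) ia)) = (\<lambda>ia. A (v ia))(i := A x)" for x by auto
    then show ?case
      using linear_compose[OF bounded_linear.linear[OF unitary_bounded_linear]
          D(3)[OF 3, of "A z" "\<lambda>i. A (v i)"]]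
      by (simp add: o_def)
  next
    case (4 z v i j)
    then show ?case using D(4)[of i j "\<lambda>i. A (v i)" "A z"] by simp
  next
    case (6 z v i c')
    then show ?case using D(6)[of i "\<lambda>i. A (v i)" c' "A z"] by (simp add: unitary_scaleC)
  qed (simp_all add: A0 D(2,5) unitary_scaleC)
  moreover have "smooth_on (- {0}) (\<lambda>z. unitary_pull A \<alpha> z v)" for v
    using assms deriv_along_unitary(2)[of "\<lambda>z. \<alpha> z (\<lambda>i. A (v i))"]
    by (simp add: smooth_form_def smooth_on_def unitary_pull_def)
  ultimately show ?thesis by (simp add: smooth_form_def)
qed

text \<open>Convergence of forms is tested on the unit sphere, which A preserves. Derivatives of the
  pull-back along \<open>ws\<close> are derivatives along \<open>map A ws\<close>, and the test
  covers all directions.\<close>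

lemma form_tendsto_0_unitary_pull:
  assumes "\<And>n. smooth_form m (B n)" "form_tendsto_0 B"
  shows "form_tendsto_0 (\<lambda>n. unitary_pull A (B n))"
  unfolding form_tendsto_0_def
proof (intro allI)
  fix v :: "nat \<Rightarrow> 'k hvec" and ws :: "'k hvec list"
  have "uniform_limit (sphere 0 1) (\<lambda>n. deriv_along (map A ws) (\<lambda>z. B n z (\<lambda>i. A (v i)))) (\<lambda>_. 0) sequentially"
    using assms(2) by (simp add: form_tendsto_0_def)
  then have "uniform_limit (sphere 0 1)
      (\<lambda>n z. deriv_along (map A ws) (\<lambda>z. B n z (\<lambda>i. A (v i))) (A z)) (\<lambda>_. 0) sequentially"
    by (rule uniform_limit_compose') (auto simp: unitary_norm)
  moreover have "deriv_along (map A ws) (\<lambda>z. B n z (\<lambda>i. A (v i))) (A z) =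
      deriv_along ws (\<lambda>z. unitary_pull A (B n) z v) z" if "z \<in> sphere 0 1" for n z
  proof -
    have "z \<noteq> 0" using that by auto
    then show ?thesis
      using deriv_along_unitary(1)[of "\<lambda>z. B n z (\<lambda>i. A (v i))" z ws] assms(1)
      by (simp add: smooth_form_def unitary_pull_def)
  qed
  ultimately show "uniform_limit (sphere 0 1)
      (\<lambda>n. deriv_along ws (\<lambda>z. unitary_pull A (B n) z v)) (\<lambda>_. 0) sequentially"
    by (subst uniform_limit_cong'[of _ _ "\<lambda>n z. deriv_along (map A ws) (\<lambda>z. B n z (\<lambda>i. A (v i))) (A z)"]) auto
qed

lemma current_unitary_push:
  assumes S: "current m S"
  shows "current m (unitary_push m A S)"
  unfolding current_def
proof (intro conjI allI impI)
  fix \<alpha> \<beta> :: "'k form" assume ab: "smooth_form m \<alpha> \<and> smooth_form m \<beta>"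
  then have "S (\<lambda>z v. unitary_pull A \<alpha> z v + unitary_pull A \<beta> z v) =
      S (unitary_pull A \<alpha>) + S (unitary_pull A \<beta>)"
    using S smooth_form_unitary_pull unfolding current_def by blast
  then show "unitary_push m A S (\<lambda>z v. \<alpha> z v + \<beta> z v) = unitary_push m A S \<alpha> + unitary_push m A S \<beta>"
    using ab smooth_form_add[of m \<alpha> \<beta>] by (simp add: unitary_push_def) (simp add: unitary_pull_def)
next
  fix c and \<alpha> :: "'k form" assume a: "smooth_form m \<alpha>"
  then have "S (\<lambda>z v. c * unitary_pull A \<alpha> z v) = c * S (unitary_pull A \<alpha>)"
    using S smooth_form_unitary_pull[OF a] unfolding current_def by simp
  then show "unitary_push m A S (\<lambda>z v. c * \<alpha> z v) = c * unitary_push m A S \<alpha>"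
    using a smooth_form_cmult[of m \<alpha> c] by (simp add: unitary_push_def) (simp add: unitary_pull_def)
next
  fix B :: "nat \<Rightarrow> 'k form" assume B: "(\<forall>n. smooth_form m (B n)) \<and> form_tendsto_0 B"
  then have "(\<lambda>n. S (unitary_pull A (B n))) \<longlonglongrightarrow> 0"
    using S smooth_form_unitary_pull form_tendsto_0_unitary_pull[of m B] unfolding current_def by simp
  then show "(\<lambda>n. unitary_push m A S (B n)) \<longlonglongrightarrow> 0" using B by (simp add: unitary_push_def)
qed (simp add: unitary_push_def)

text \<open>The induced map is a bijective isometry: if S vanishes on forms supported in V, the
  push-forward vanishes on those supported in the image of V, because they pull back to forms
  supported in V.\<close>

lemma current_support_unitary_push:
  "current_support m (unitary_push m A S) \<subseteq> unitary_act A ` current_support m S"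
proof
  fix y assume y: "y \<in> current_support m (unitary_push m A S)"
  obtain x where x: "y = unitary_act A x" using surj_unitary_act by blast
  have "x \<in> current_support m S"
  proof (rule ccontr)
    assume "x \<notin> current_support m S"
    then obtain V where V: "open V" "x \<in> V"
      "\<forall>\<alpha>. smooth_form m \<alpha> \<and> form_support \<alpha> \<subseteq> V \<longrightarrow> S \<alpha> = 0"
      by (auto simp: current_support_def)
    let ?V = "unitary_act A ` V"
    have "open ?V"
      unfolding open_dist
    proof
      fix u assume "u \<in> ?V"
      then obtain a where a: "a \<in> V" "u = unitary_act A a" by blast
      obtain e where e: "e > 0" "\<And>b. dist b a < e \<Longrightarrow> b \<in> V" using V(1) a(1) unfolding open_dist by blast
      have "w \<in> ?V" if "dist w u < e" for w
      proof -
        obtain b where b: "w = unitary_act A b" using surj_unitary_act by blast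
        then show ?thesis using that a e(2)[of b] by (simp add: dist_unitary_act)
      qed
      then show "\<exists>e>0. \<forall>w. dist w u < e \<longrightarrow> w \<in> ?V" using e(1) by blast
    qed
    moreover have "unitary_push m A S \<alpha> = 0" if \<alpha>: "smooth_form m \<alpha>" "form_support \<alpha> \<subseteq> ?V" for \<alpha>
    proof -
      have "closed (unitary_act A -` form_support \<alpha>)"
        unfolding form_support_def
        by (rule closed_vimage[OF closed_closure continuous_on_unitary_act])
      moreover have "{x. \<exists>z v. z \<noteq> 0 \<and> pt z = x \<and> unitary_pull A \<alpha> z v \<noteq> 0} \<subseteq> unitary_act A -` form_support \<alpha>"
      proof
        fix x assume "x \<in> {x. \<exists>z v. z \<noteq> 0 \<and> pt z = x \<and> unitary_pull A \<alpha> z v \<noteq> 0}"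
        then obtain z v where "z \<noteq> 0" "pt z = x" "\<alpha> (A z) (\<lambda>i. A (v i)) \<noteq> 0"
          unfolding unitary_pull_def by blast
        then have "A z \<noteq> 0" "pt (A z) = unitary_act A x" "\<alpha> (A z) (\<lambda>i. A (v i)) \<noteq> 0"
          by (auto simp: unitary_act_pt unitary_eq_0_iff)
        then have "unitary_act A x \<in> form_support \<alpha>"
          unfolding form_support_def by (intro subsetD[OF closure_subset] CollectI exI conjI)
        then show "x \<in> unitary_act A -` form_support \<alpha>" by simp
      qed
      ultimately have "form_support (unitary_pull A \<alpha>) \<subseteq> unitary_act A -` form_support \<alpha>"
        unfolding form_support_def[of "unitary_pull A \<alpha>"] by (rule closure_minimal[rotated])
      also have "\<dots> \<subseteq> V"
        using \<alpha>(2) inj_image_mem_iff[OF inj_unitary_act, of _ V] by fast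
      finally show ?thesis
        using V(3) \<alpha>(1) by (simp add: unitary_push_def smooth_form_unitary_pull)
    qed
    ultimately have "y \<in> \<Union>{V. open V \<and> (\<forall>\<alpha>. smooth_form m \<alpha> \<and> form_support \<alpha> \<subseteq> V \<longrightarrow> unitary_push m A S \<alpha> = 0)}"
      using V(2) x by (intro UnionI[of ?V]) auto
    then show False using y by (simp add: current_support_def)
  qed
  then show "y \<in> unitary_act A ` current_support m S" using x by blast
qed

text \<open>The Fubini-Study form is built from \<open>herm\<close> and \<open>norm\<close>, both
  invariant. Hence the transport of currents respects the normalisation in
  \<open>\<C> p\<close>.\<close>

lemma fs_power_unitary: "unitary_pull A (fs_power s) = fs_power s"
proof (induction s)
  case 0
  show ?case by (intro ext) (simp add: unitary_pull_def unitary_eq_0_iff)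
next
  case (Suc s)
  have "fs_power s (A z) (\<lambda>i. A (v i)) = fs_power s z v" for z v
    using fun_cong[OF fun_cong[OF Suc]] by (simp add: unitary_pull_def)
  moreover have "fs_form (A z) (\<lambda>i. A (v i)) = fs_form z v" for z v
    by (simp add: fs_form_def unitary_eq_0_iff unitary_herm unitary_norm)
  ultimately show ?case by (intro ext) (simp add: unitary_pull_def wedge_def)
qed

lemma ext_deriv_unitary:
  assumes "smooth_form n \<beta>"
  shows "unitary_pull A (ext_deriv n \<beta>) = ext_deriv n (unitary_pull A \<beta>)"
proof (intro ext)
  fix z v
  show "unitary_pull A (ext_deriv n \<beta>) z v = ext_deriv n (unitary_pull A \<beta>) z v"
  proof (cases "z = 0")
    case False
    have "frechet_derivative (\<lambda>y. \<beta> y (\<lambda>j. if j < i then A (v j) else A (v (Suc j)))) (at (A z)) (A (v i)) =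
        frechet_derivative (\<lambda>y. unitary_pull A \<beta> y (\<lambda>j. if j < i then v j else v (Suc j))) (at z) (v i)" for i
    proof -
      let ?g = "\<lambda>y. \<beta> y (\<lambda>j. if j < i then A (v j) else A (v (Suc j)))"
      have "smooth_on (- {0}) ?g" using assms by (simp add: smooth_form_def)
      from deriv_along_unitary(1)[OF this False, of "[v i]"]
      have "frechet_derivative (\<lambda>z. ?g (A z)) (at z) (v i) = frechet_derivative ?g (at (A z)) (A (v i))"
        by (simp add: deriv_along_Cons)
      moreover have "(\<lambda>j. A (if j < i then v j else v (Suc j))) = (\<lambda>j. if j < i then A (v j) else A (v (Suc j)))"
        by auto
      ultimately show ?thesis by (simp add: unitary_pull_def)
    qed
    then show ?thesis using False unfolding ext_deriv_def unitary_pull_def[of A "\<lambda>z v. _ z v"] 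
      by (simp add: unitary_eq_0_iff)
  qed (simp add: unitary_pull_def ext_deriv_def unitary_eq_0_iff)
qed

lemma unitary_push_C:
  assumes S: "S \<in> \<C> p E" and E': "unitary_act A ` current_support (2 * (CARD('k) - p)) S \<subseteq> E'"
  shows "unitary_push (2 * (CARD('k) - p)) A S \<in> \<C> p E'"
proof -
  define s where "s = CARD('k) - p"
  have p: "p \<le> CARD('k)" and S': "bidim_current s S" "strongly_positive s S" "closed_current (2 * s) S"
    "S (fs_power s) = 1"
    using S by (auto simp: \<C>_def Let_def s_def)
  have cur: "current (2 * s) S" using S' by (simp add: bidim_current_def)
  let ?T = "unitary_push (2 * s) A S"
  have bid: "of_bidegree a b (unitary_pull A \<alpha>)" if "of_bidegree a b \<alpha>" for a b \<alpha>
    using that by (simp add: of_bidegree_def unitary_pull_def unitary_scaleC)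
  have "bidim_current s ?T"
    using S'(1) current_unitary_push[OF cur] bid smooth_form_unitary_pull
    unfolding bidim_current_def unitary_push_def by metis
  moreover have "weakly_positive (unitary_pull A \<alpha>)" if "weakly_positive \<alpha>" for \<alpha>
  proof -
    have "(\<lambda>i. A (real_frame v i)) = real_frame (\<lambda>i. A (v i))" for v
      by (auto simp: real_frame_def unitary_scaleC)
    then show ?thesis using that by (simp add: weakly_positive_def unitary_pull_def)
  qed
  then have "strongly_positive s ?T"
    using S'(2) bid smooth_form_unitary_pull unfolding strongly_positive_def unitary_push_def by simp
  moreover have "closed_current (2 * s) ?T"
    using S'(3) smooth_form_unitary_pull
    unfolding closed_current_def unitary_push_def by (auto simp: ext_deriv_unitary)
  moreover have "?T (fs_power s) = 1"
  proof -
    \<comment> \<open>A current takes the value 0 on everything that is not a smooth form, so its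
      value 1 here certifies the smoothness of this power.\<close>
    have "smooth_form (2 * s) (fs_power s :: 'k form)"
      using cur S'(4) unfolding current_def by (metis zero_neq_one)
    then show ?thesis using S'(4) by (simp add: unitary_push_def fs_power_unitary)
  qed
  ultimately show ?thesis
    using p E' current_support_unitary_push[of "2 * s" S] by (auto simp: \<C>_def Let_def s_def)
qed

end

text \<open>With unit lifts u of x and v of y in phases making \<open>herm u v\<close> a real c
  \<ge> 0, the map A is the reflection along u followed by the reflection along u + v. It fixes the
  orthogonal complement of u and v and sends u to v. As |u + v|^2 = 2(1 + c) \<ge> 2, the formula
  also covers x = y, where A is the identity.\<close>

lemma rotation_exists:
  obtains A where "unitary A" "unitary_act A x = y"
    "\<And>w. 1 - 4 * (1 - fs_cos x y) \<le> fs_cos (unitary_act A w) w"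
proof -
  define v where "v = urep y"
  obtain g where g: "cmod g = 1" "g * herm (urep x) v = of_real (cmod (herm (urep x) v))"
    using phase_exists by blast
  define u where "u = g *\<^sub>C urep x"
  define c where "c = fs_cos x y"
  have g0: "g \<noteq> 0" using g by auto
  have n: "norm u = 1" "norm v = 1" using g by (simp_all add: u_def v_def norm_scaleC urep)
  then have uv0: "u \<noteq> 0" "v \<noteq> 0" by auto
  have x: "pt u = x" "pt v = y" using g0 by (simp_all add: u_def v_def pt_scaleC urep)
  have c: "0 \<le> c" "c \<le> 1" using fs_cos_bounds by (auto simp: c_def)
  have huv: "herm u v = of_real c"
    using g(2) by (simp add: u_def v_def herm_scaleC_left fs_cos_urep c_def)
  then have h: "herm u u = 1" "herm v v = 1" "herm u v = of_real c" "herm v u = of_real c"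
    using n by (simp_all add: herm_self herm_commute[of v u])
  define s where "s z = (herm z u + herm z v) / (1 + c)" for z
  define A where "A z = z + (- s z) *\<^sub>C u + (2 * herm z u - s z) *\<^sub>C v" for z
  have c1: "1 + complex_of_real c \<noteq> 0" using c by (metis add_nonneg_eq_0_iff of_real_1 of_real_add of_real_eq_0_iff zero_le_one zero_neq_one)
  have s: "s z * (1 + c) = herm z u + herm z v" for z using c1 by (simp add: s_def)
  have norm_A: "herm (A z) (A z) = herm z z" for z
  proof -
    have s': "cnj (s z) * (1 + c) = cnj (herm z u) + cnj (herm z v)"
      using arg_cong[OF s[of z], of cnj] by simp
    define a b t a' b' t' where "a = herm z u" "b = herm z v" "t = s z"
      "a' = cnj (herm z u)" "b' = cnj (herm z v)" "t' = cnj (s z)"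
    have "herm (A z) (A z) = herm z z - t' * a + (2 * a' - t') * b - t * a' + t * t' - t * (2 * a' - t') * c
        + (2 * a - t) * b' - (2 * a - t) * t' * c + (2 * a - t) * (2 * a' - t')"
      unfolding a_b_t_a'_b'_t'_def A_def
      by (simp add: herm_add_left herm_add_right herm_scaleC_left herm_scaleC_right h
          herm_commute[of u z] herm_commute[of v z] algebra_simps)
    \<comment> \<open>The defect from \<open>herm z z\<close> is a combination of the relation t(1 +
      c) = a + b and its conjugate; treating the conjugates as independent letters reduces this to
      polynomial algebra.\<close>
    also have "\<dots> = herm z z + t' * (t * (1 + c) - (a + b)) + t * (t' * (1 + c) - (a' + b'))
        - 2 * a * (t' * (1 + c) - (a' + b')) - 2 * a' * (t * (1 + c) - (a + b))"
      by (simp add: algebra_simps)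
    also have "\<dots> = herm z z"
      using s[of z] s' by (simp add: a_b_t_a'_b'_t'_def)
    finally show ?thesis .
  qed
  have "linear A"
    unfolding A_def s_def
    by (rule linearI) (simp_all add: herm_add_left scaleC_add_right scaleC_add_left vec_eq_iff
        add_divide_distrib algebra_simps flip: scaleC_of_real, simp_all add: herm_scaleC_left algebra_simps)
  moreover have "A (k *\<^sub>C z) = k *\<^sub>C A z" for k z
    unfolding A_def s_def by (simp add: vec_eq_iff herm_scaleC_left algebra_simps add_divide_distrib)
  moreover have "norm (A z) = norm z" for z
  proof -
    have "(norm (A z))\<^sup>2 = (norm z)\<^sup>2"
      using norm_A[of z] unfolding herm_self of_real_eq_iff .
    then show ?thesis by simp
  qed
  ultimately have A: "unitary A" by (simp add: unitary_def)
  have "s u = 1" using s[of u] c1 h by simp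
  then have "A u = v" by (simp add: A_def h vec_eq_iff)
  then have "unitary_act A x = y" using unitary_act_pt[OF A uv0(1)] x by simp
  moreover have "1 - 4 * (1 - fs_cos x y) \<le> fs_cos (unitary_act A w) w" for w
  proof -
    define z where "z = urep w"
    have z: "norm z = 1" "pt z = w" by (simp_all add: z_def urep)
    then have z0: "z \<noteq> 0" by auto
    define a b where "a = herm z u" and "b = herm z v"
    have ab: "cmod a \<le> 1" "cmod b \<le> 1"
      using cmod_herm_le[of z u] cmod_herm_le[of z v] z n by (simp_all add: a_def b_def)
    have "(norm (u - v))\<^sup>2 = 2 * (1 - c)"
      using n arg_cong[OF h(3), of Re] 
      by (simp add: power2_norm_eq_inner inner_diff_left inner_diff_right inner_commute[of v u] Re_herm)
        (simp flip: power2_norm_eq_inner)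
    moreover have "a - b = herm z (u - v)"
      using herm_add_right[of z "u - v" v] by (simp add: a_def b_def)
    ultimately have d: "(cmod (a - b))\<^sup>2 \<le> 2 * (1 - c)"
      using cmod_herm_le[of z "u - v"] z by (metis mult_1 norm_ge_zero power_mono)
    have "cmod (a * cnj b) \<le> 1 * 1" unfolding norm_mult using ab by (intro mult_mono) auto
    then have r: "Re (a * cnj b) \<le> 1" using complex_Re_le_cmod[of "a * cnj b"] by linarith
    have "herm (A z) z = 1 - (a + b) * cnj (a + b) / (1 + c) + 2 * (a * cnj b)"
      using z unfolding A_def s_def a_def b_def
      by (simp add: herm_add_left herm_scaleC_left herm_self herm_commute[of u z] herm_commute[of v z]
          algebra_simps add_divide_distrib)
    also have "(a + b) * cnj (a + b) / (1 + c) = of_real ((cmod (a + b))\<^sup>2 / (1 + c))"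
      by (simp only: of_real_divide complex_norm_square)
    finally have "Re (herm (A z) z) = 1 - (cmod (a + b))\<^sup>2 / (1 + c) + 2 * Re (a * cnj b)"
      by simp
    moreover have "(cmod (a + b))\<^sup>2 = (cmod (a - b))\<^sup>2 + 4 * Re (a * cnj b)"
      unfolding cmod_power2 by (simp add: power2_eq_square algebra_simps)
    ultimately have "Re (herm (A z) z) = 1 - ((cmod (a - b))\<^sup>2 + 2 * (1 - c) * Re (a * cnj b)) / (1 + c)"
      using c by (simp add: field_simps)
    \<comment> \<open>The factor 4 is 2 + 2: one part from |u - v|^2 = 2(1 - c), the other from Re(a
      b') \<le> 1 with b' the conjugate of b; the denominator 1 + c is at least 1.\<close>
    moreover have "((cmod (a - b))\<^sup>2 + 2 * (1 - c) * Re (a * cnj b)) / (1 + c) \<le> 4 * (1 - c)"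
    proof -
      have "2 * (1 - c) * Re (a * cnj b) \<le> 2 * (1 - c) * 1"
        using r c by (intro mult_left_mono) auto
      then have "(cmod (a - b))\<^sup>2 + 2 * (1 - c) * Re (a * cnj b) \<le> 4 * (1 - c)" using d by simp
      also have "\<dots> \<le> 4 * (1 - c) * (1 + c)" using c by (simp add: mult_le_cancel_left1)
      finally show ?thesis using c by (simp add: pos_divide_le_eq)
    qed
    ultimately have "1 - 4 * (1 - c) \<le> cmod (herm (A z) z)"
      using complex_Re_le_cmod[of "herm (A z) z"] by linarith
    moreover have "fs_cos (unitary_act A w) w = cmod (herm (A z) z)"
      using fs_cos_pt[of "A z" z] unitary_act_pt[OF A z0] z z0 unitary_eq_0_iff[OF A, of z] unitary_norm[OF A, of z]
      by simp
    ultimately show ?thesis by (simp add: c_def)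
  qed
  ultimately show ?thesis by (rule that[OF A])
qed

text \<open>The bound of \<open>rotation_exists\<close> does not depend on w and tends to 1 as y
  approaches x, so one \<delta> serves for all points. Reducing \<epsilon> to at most 1 keeps the
  comparison in the range where the cosine is decreasing.\<close>

lemma small_rotation_exists:
  assumes "\<epsilon> > 0"
  shows "\<exists>\<delta>>0. \<forall>x y :: 'k::finite pspace. dist x y < \<delta> \<longrightarrow>
    (\<exists>A. unitary A \<and> unitary_act A x = y \<and> (\<forall>w. dist (unitary_act A w) w < \<epsilon>))"
proof -
  define e where "e = min \<epsilon> 1"
  have e: "0 < e" "e \<le> 1" "e \<le> \<epsilon>" using assms by (auto simp: e_def)
  have pi: "pi > 3" using pi_gt3 .
  have "cos e < 1" using cos_monotone_0_pi[of 0 e] e pi by simp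
  moreover have "((\<lambda>t::real. 1 - 4 * (1 - cos t)) \<longlongrightarrow> 1 - 4 * (1 - cos 0)) (at 0)"
    by (intro tendsto_intros)
  ultimately have "\<forall>\<^sub>F t in at 0. cos e < 1 - 4 * (1 - cos t)"
    by (intro order_tendstoD(1)[of _ 1]) auto
  then obtain \<delta> where \<delta>: "\<delta> > 0" "\<And>t::real. t \<noteq> 0 \<Longrightarrow> \<bar>t\<bar> < \<delta> \<Longrightarrow> cos e < 1 - 4 * (1 - cos t)"
    unfolding eventually_at by (auto simp: dist_real_def)
  have "\<exists>A. unitary A \<and> unitary_act A x = y \<and> (\<forall>w. dist (unitary_act A w) w < \<epsilon>)"
    if "dist x y < \<delta>" for x y :: "'k pspace"
  proof -
    obtain A where A: "unitary A" "unitary_act A x = y"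
      "\<And>w. 1 - 4 * (1 - fs_cos x y) \<le> fs_cos (unitary_act A w) w"
      by (rule rotation_exists[of x y]) blast
    have "cos e < 1 - 4 * (1 - fs_cos x y)"
      using \<delta>(2)[of "dist x y"] that \<open>cos e < 1\<close> by (cases "x = y") (auto simp: cos_dist[symmetric])
    then have "cos e < cos (dist (unitary_act A w) w)" for w
      using A(3)[of w] by (simp add: cos_dist)
    note cos_less = this
    have "dist (unitary_act A w) w < e" for w
    proof (rule ccontr)
      assume "\<not> dist (unitary_act A w) w < e"
      then have "cos (dist (unitary_act A w) w) \<le> cos e"
        using e pi dist_pspace_bounds(2)[of "unitary_act A w" w]
        by (intro cos_monotone_0_pi_le) linarith+
      then show False using cos_less[of w] by simp
    qed
    then show ?thesis using A e by (metis order_less_le_trans)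
  qed
  then show ?thesis using \<delta>(1) by blast
qed

section \<open>Supports of the currents in \<open>\<C> p E\<close>\<close>

lemma closed_current_support: "closed (current_support m S)"
  unfolding current_support_def by (intro closed_Compl open_Union) auto

text \<open>With empty support S would annihilate every smooth form, in particular the power of the
  Fubini-Study form on which it takes the value 1.\<close>

lemma C_support_nonempty:
  fixes S :: "'k::finite functional"
  assumes "S \<in> \<C> p E"
  shows "current_support (2 * (CARD('k) - p)) S \<noteq> {}"
proof
  assume empty: "current_support (2 * (CARD('k) - p)) S = {}"
  have S: "current (2 * (CARD('k) - p)) S" "S (fs_power (CARD('k) - p)) = 1"
    using assms by (auto simp: \<C>_def Let_def bidim_current_def)
  then have "smooth_form (2 * (CARD('k) - p)) (fs_power (CARD('k) - p) :: 'k form)"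
    unfolding current_def by (metis zero_neq_one)
  from current_eq_0[OF S(1) this] show False using S(2) empty by simp
qed

text \<open>A small rotation moving a point of the support maps \<open>S\<close> to an element of \<open>\<C> p E\<close>, hence fixes \<open>S\<close>;
  so the support is open.\<close>

lemma current_support_eq_UNIV:
  fixes S :: "'k::finite functional" and p m :: nat
  defines "m \<equiv> 2 * (CARD('k) - p)"
  assumes "open E" "S \<in> \<C> p E" "\<And>T. T \<in> \<C> p E \<Longrightarrow> T = S"
  shows "current_support m S = UNIV"
proof -
  define K where "K = current_support m S"
  have K: "K \<subseteq> E"
    using assms(3) by (auto simp: \<C>_def Let_def K_def m_def)
  have "K \<noteq> {}"
    using C_support_nonempty[OF assms(3)] by (simp add: K_def m_def)
  have "closed K" unfolding K_def by (rule closed_current_support)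
  then have cK: "compact K" by (rule compact_closed_pspace)
  obtain \<epsilon> where \<epsilon>: "\<epsilon> > 0" "(\<Union>x\<in>K. ball x \<epsilon>) \<subseteq> E"
    using compact_subset_open_imp_ball_epsilon_subset[OF cK assms(2) K] by metis
  obtain \<delta> where \<delta>: "\<delta> > 0" "\<And>x y :: 'k pspace. dist x y < \<delta> \<Longrightarrow>
    \<exists>A. unitary A \<and> unitary_act A x = y \<and> (\<forall>w. dist (unitary_act A w) w < \<epsilon>)"
    using small_rotation_exists[OF \<epsilon>(1)] by metis
  have "y \<in> K" if xy: "x \<in> K" "dist y x < \<delta>" for x y
  proof -
    \<comment> \<open>A moves y to x rather than x to y: invariance of S gives K \<subseteq> A(K),
      so x is the image of a point of K, and injectivity identifies that point with y.\<close>
    obtain A where A: "unitary A" "unitary_act A y = x" "\<And>w. dist (unitary_act A w) w < \<epsilon>"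
      using \<delta>(2) xy(2) by blast
    have "unitary_act A ` K \<subseteq> E"
      using \<epsilon>(2) A(3) by (fastforce simp: dist_commute)
    then have "unitary_push m A S = S"
      using unitary_push_C[OF A(1) assms(3)] assms(4) by (simp add: K_def m_def)
    then have "K \<subseteq> unitary_act A ` K"
      using current_support_unitary_push[OF A(1), of m S] by (simp add: K_def)
    then obtain w where "w \<in> K" "x = unitary_act A w" using xy(1) by blast
    then show ?thesis using A(2) inj_unitary_act[OF A(1)] by (metis injD)
  qed
  then have "open K" unfolding open_dist using \<delta>(1) by blast
  then show ?thesis
    using connected_pspace \<open>closed K\<close> \<open>K \<noteq> {}\<close> by (auto simp: connected_clopen K_def)
qed

section \<open>Polynomial lifts and pull-backs\<close>

definition cdiff_at :: "'k::finite hvec \<Rightarrow> ('k hvec \<Rightarrow> 'b::{complex_space,real_normed_vector}) \<Rightarrow> bool" where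
  "cdiff_at x f \<longleftrightarrow> (\<exists>D. (f has_derivative D) (at x) \<and> (\<forall>c v. D (c *\<^sub>C v) = c *\<^sub>C D v))"

lemma hol_on_iff_cdiff_at: "hol_on S f \<longleftrightarrow> (\<forall>x\<in>S. cdiff_at x f)"
  by (simp add: hol_on_def cdiff_at_def)

lemma cdiff_atD:
  assumes "cdiff_at x f"
  shows "(f has_derivative frechet_derivative f (at x)) (at x)"
    and "frechet_derivative f (at x) (c *\<^sub>C v) = c *\<^sub>C frechet_derivative f (at x) v"
proof -
  obtain D where D: "(f has_derivative D) (at x)" "\<forall>c v. D (c *\<^sub>C v) = c *\<^sub>C D v"
    using assms by (auto simp: cdiff_at_def)
  then show "(f has_derivative frechet_derivative f (at x)) (at x)"
    by (metis differentiable_def frechet_derivative_works)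
  show "frechet_derivative f (at x) (c *\<^sub>C v) = c *\<^sub>C frechet_derivative f (at x) v"
    using frechet_derivative_at[OF D(1)] D(2) by simp
qed

lemma scaleC_zero_right [simp]: "c *\<^sub>C (0 :: 'a::complex_space) = 0"
  using scaleC_add_right[of c 0 0] by simp

lemma cdiff_at_const: "cdiff_at x (\<lambda>_. c)"
  unfolding cdiff_at_def by (intro exI[of _ "\<lambda>_. 0"]) auto

lemma cdiff_at_add:
  assumes "cdiff_at x f" "cdiff_at x g"
  shows "cdiff_at x (\<lambda>z. f z + g z)"
proof -
  obtain D E where D: "(f has_derivative D) (at x)" "\<forall>c v. D (c *\<^sub>C v) = c *\<^sub>C D v"
    and E: "(g has_derivative E) (at x)" "\<forall>c v. E (c *\<^sub>C v) = c *\<^sub>C E v"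
    using assms by (auto simp: cdiff_at_def)
  show ?thesis
    unfolding cdiff_at_def
    by (intro exI[of _ "\<lambda>v. D v + E v"] conjI has_derivative_add D E) (simp add: D E scaleC_add_right)
qed

lemma cdiff_at_scaleC:
  fixes g :: "'k::finite hvec \<Rightarrow> 'k hvec"
  assumes "cdiff_at x f" "cdiff_at x g"
  shows "cdiff_at x (\<lambda>z. f z *\<^sub>C g z)"
proof -
  obtain D E where D: "(f has_derivative D) (at x)" "\<forall>c v. D (c *\<^sub>C v) = c *\<^sub>C D v"
    and E: "(g has_derivative E) (at x)" "\<forall>c v. E (c *\<^sub>C v) = c *\<^sub>C E v"
    using assms by (auto simp: cdiff_at_def)
  show ?thesis
    unfolding cdiff_at_def
    by (intro exI[of _ "\<lambda>v. f x *\<^sub>C E v + D v *\<^sub>C g x"] conjI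
        bounded_bilinear.FDERIV[OF bounded_bilinear_scaleC] D E)
      (simp add: D E scaleC_add_right scaleC_scaleC scaleC_complex_def mult.commute)
qed

lemma cdiff_at_mult:
  fixes f g :: "'k::finite hvec \<Rightarrow> complex"
  assumes "cdiff_at x f" "cdiff_at x g"
  shows "cdiff_at x (\<lambda>z. f z * g z)"
proof -
  obtain D E where D: "(f has_derivative D) (at x)" "\<forall>c v. D (c *\<^sub>C v) = c *\<^sub>C D v"
    and E: "(g has_derivative E) (at x)" "\<forall>c v. E (c *\<^sub>C v) = c *\<^sub>C E v"
    using assms by (auto simp: cdiff_at_def)
  show ?thesis
    unfolding cdiff_at_def
    by (intro exI[of _ "\<lambda>v. f x * E v + D v * g x"] conjI has_derivative_mult D E)
      (simp add: D E scaleC_complex_def algebra_simps)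
qed

lemma cdiff_at_sum:
  assumes "\<And>i. i \<in> I \<Longrightarrow> cdiff_at x (f i)"
  shows "cdiff_at x (\<lambda>z. \<Sum>i\<in>I. f i z)"
  using assms by (induction I rule: infinite_finite_induct) (auto intro: cdiff_at_const cdiff_at_add)

lemma cdiff_at_prod:
  fixes f :: "'i \<Rightarrow> 'k::finite hvec \<Rightarrow> complex"
  assumes "\<And>i. i \<in> I \<Longrightarrow> cdiff_at x (f i)"
  shows "cdiff_at x (\<lambda>z. \<Prod>i\<in>I. f i z)"
  using assms by (induction I rule: infinite_finite_induct) (auto intro: cdiff_at_const cdiff_at_mult)

lemma cdiff_at_nth: "cdiff_at x (\<lambda>z. z $ i)"
  unfolding cdiff_at_def
  by (intro exI[of _ "\<lambda>z. z $ i"]) (auto simp: scaleC_complex_def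
      intro!: bounded_linear_imp_has_derivative bounded_linear_vec_nth)

lemma cdiff_at_ident: "cdiff_at x (\<lambda>z. z)"
  unfolding cdiff_at_def by (intro exI[of _ "\<lambda>z. z"]) auto

lemma cdiff_at_compose:
  fixes g :: "'k::finite hvec \<Rightarrow> 'k hvec"
  assumes "cdiff_at x g" "cdiff_at (g x) f"
  shows "cdiff_at x (\<lambda>z. f (g z))"
proof -
  obtain D E where D: "(g has_derivative D) (at x)" "\<forall>c v. D (c *\<^sub>C v) = c *\<^sub>C D v"
    and E: "(f has_derivative E) (at (g x))" "\<forall>c v. E (c *\<^sub>C v) = c *\<^sub>C E v"
    using assms by (auto simp: cdiff_at_def)
  show ?thesis
    unfolding cdiff_at_def
    by (intro exI[of _ "\<lambda>v. E (D v)"] conjI has_derivative_compose[OF D(1) E(1)]) (simp add: D E)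
qed

lemma cdiff_at_power:
  fixes f :: "'k::finite hvec \<Rightarrow> complex"
  assumes "cdiff_at x f"
  shows "cdiff_at x (\<lambda>z. f z ^ n)"
  by (induction n) (auto intro: cdiff_at_const cdiff_at_mult assms)

lemma Ck_power:
  fixes f :: "'a::real_normed_vector \<Rightarrow> 'b::real_normed_field"
  assumes "open X" "Ck k X f"
  shows "Ck k X (\<lambda>z. f z ^ n)"
  by (induction n) (auto intro: Ck_const Ck_mult[OF assms(1)] assms)

lemma homogeneous_poly_cdiff_at:
  assumes "homogeneous_poly d q"
  shows "cdiff_at x q"
proof -
  obtain c where q: "q = (\<lambda>z. \<Sum>a | (\<Sum>i\<in>UNIV. a i) = d. c a * (\<Prod>i\<in>UNIV. (z $ i) ^ a i))"
    using assms by (auto simp: homogeneous_poly_def)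
  show ?thesis unfolding q
    by (intro cdiff_at_sum cdiff_at_mult cdiff_at_const cdiff_at_prod cdiff_at_power cdiff_at_nth)
qed

lemma homogeneous_poly_Ck:
  assumes "homogeneous_poly d q" "open X"
  shows "Ck k X q"
proof -
  obtain c where q: "q = (\<lambda>z. \<Sum>a | (\<Sum>i\<in>UNIV. a i) = d. c a * (\<Prod>i\<in>UNIV. (z $ i) ^ a i))"
    using assms by (auto simp: homogeneous_poly_def)
  show ?thesis unfolding q
    by (intro Ck_sum Ck_mult Ck_const Ck_prod Ck_power Ck_linear bounded_linear_vec_nth assms(2))
qed

lemma homogeneous_poly_scaleC:
  assumes "homogeneous_poly d q"
  shows "q (t *\<^sub>C z) = t ^ d * q z"
proof -
  obtain c where q: "\<And>z. q z = (\<Sum>a | (\<Sum>i\<in>UNIV. a i) = d. c a * (\<Prod>i\<in>UNIV. (z $ i) ^ a i))"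
    using assms by (auto simp: homogeneous_poly_def)
  have "(\<Prod>i\<in>UNIV. (t * z $ i) ^ a i) = t ^ d * (\<Prod>i\<in>UNIV. (z $ i) ^ a i)"
    if "(\<Sum>i\<in>UNIV. a i) = d" for a
    using that by (simp add: power_mult_distrib prod.distrib flip: power_sum)
  then show ?thesis unfolding q sum_distrib_left by (intro sum.cong) auto
qed

section \<open>Lifts of endomorphisms to homogeneous coordinates\<close>

definition poly_lift :: "nat \<Rightarrow> ('k::finite pspace \<Rightarrow> 'k pspace) \<Rightarrow> ('k hvec \<Rightarrow> 'k hvec) \<Rightarrow> bool" where
  "poly_lift d f P \<longleftrightarrow> (\<forall>i. homogeneous_poly d (\<lambda>z. P z $ i)) \<and>
     (\<forall>z. z \<noteq> 0 \<longrightarrow> P z \<noteq> 0 \<and> f (pt z) = pt (P z))"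

text \<open>This weaker notion is stable under iteration by the chain rule alone:
  \<open>P ^^ n\<close> lifts \<open>f ^^ n\<close> without an expansion of the iterate as a
  homogeneous polynomial.\<close>

definition hol_lift :: "('k::finite pspace \<Rightarrow> 'k pspace) \<Rightarrow> ('k hvec \<Rightarrow> 'k hvec) \<Rightarrow> bool" where
  "hol_lift f Q \<longleftrightarrow> hol_on (- {0}) Q \<and> (\<forall>z. z \<noteq> 0 \<longrightarrow> Q z \<noteq> 0 \<and> f (pt z) = pt (Q z))"

lemma vec_eq_sum_axis: "(w :: 'k::finite hvec) = (\<Sum>i\<in>UNIV. (w $ i) *\<^sub>C axis i 1)"
  by (simp add: vec_eq_iff axis_def if_distrib cong: if_cong)

lemma poly_lift_cdiff_at:
  assumes "poly_lift d f P"
  shows "cdiff_at x P"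
proof -
  have P: "P = (\<lambda>z. \<Sum>i\<in>UNIV. (P z $ i) *\<^sub>C axis i 1)" using vec_eq_sum_axis by (intro ext)
  show ?thesis
    by (subst P, intro cdiff_at_sum cdiff_at_scaleC cdiff_at_const homogeneous_poly_cdiff_at[of d])
      (use assms in \<open>auto simp: poly_lift_def\<close>)
qed

lemma poly_lift_Ck:
  assumes "poly_lift d f P" "open X"
  shows "Ck k X P"
proof -
  have P: "P = (\<lambda>z. \<Sum>i\<in>UNIV. (P z $ i) *\<^sub>C axis i 1)" using vec_eq_sum_axis by (intro ext)
  show ?thesis
    by (subst P, intro Ck_sum Ck_bilinear[OF _ bounded_bilinear_scaleC] Ck_const
        homogeneous_poly_Ck[of d] assms(2))
      (use assms in \<open>auto simp: poly_lift_def\<close>)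
qed

lemma poly_lift_scaleC:
  assumes "poly_lift d f P"
  shows "P (c *\<^sub>C z) = c ^ d *\<^sub>C P z"
  using assms homogeneous_poly_scaleC[of d "\<lambda>z. P z $ i" for i]
  by (simp add: poly_lift_def vec_eq_iff)

text \<open>Homogeneity differentiated in z and in the scale; the second identity is Euler's. The
  first makes a form pulled back through P invariant under homotheties, the second makes it vanish
  on directions tangent to the fibre.\<close>

lemma poly_lift_deriv:
  assumes "poly_lift d f P"
  shows "frechet_derivative P (at (c *\<^sub>C z)) (c *\<^sub>C v) = c ^ d *\<^sub>C frechet_derivative P (at z) v"
    and "frechet_derivative P (at z) z = of_nat d *\<^sub>C P z"
proof -
  note D = cdiff_atD[OF poly_lift_cdiff_at[OF assms]]
  have bl: "bounded_linear (\<lambda>z :: 'a hvec. c *\<^sub>C z)" for c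
    by (rule bounded_bilinear.bounded_linear_right[OF bounded_bilinear_scaleC])
  have "((\<lambda>z. P (c *\<^sub>C z)) has_derivative (\<lambda>v. frechet_derivative P (at (c *\<^sub>C z)) (c *\<^sub>C v))) (at z)"
    by (rule has_derivative_compose[OF bounded_linear_imp_has_derivative[OF bl] D(1)])
  moreover have "((\<lambda>z. P (c *\<^sub>C z)) has_derivative (\<lambda>v. c ^ d *\<^sub>C frechet_derivative P (at z) v)) (at z)"
    unfolding poly_lift_scaleC[OF assms] by (rule bounded_linear.has_derivative[OF bl D(1)])
  ultimately have "(\<lambda>v. frechet_derivative P (at (c *\<^sub>C z)) (c *\<^sub>C v)) = (\<lambda>v. c ^ d *\<^sub>C frechet_derivative P (at z) v)"
    by (rule has_derivative_unique)
  from fun_cong[OF this] show "frechet_derivative P (at (c *\<^sub>C z)) (c *\<^sub>C v) = c ^ d *\<^sub>C frechet_derivative P (at z) v" .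
  have "((\<lambda>t. P (t *\<^sub>R z)) has_derivative (\<lambda>t. frechet_derivative P (at (1 *\<^sub>R z)) (t *\<^sub>R z))) (at 1)"
    by (rule has_derivative_compose[OF bounded_linear_imp_has_derivative[OF bounded_linear_scaleR_left] D(1)])
  moreover have "P (t *\<^sub>R z) = (t ^ d) *\<^sub>R P z" for t
    using poly_lift_scaleC[OF assms, of "of_real t" z]
    by (simp flip: scaleC_of_real of_real_power)
  ultimately have "((\<lambda>t. (t ^ d) *\<^sub>R P z) has_derivative (\<lambda>t. frechet_derivative P (at z) (t *\<^sub>R z))) (at 1)"
    by simp
  moreover have "((\<lambda>t::real. (t ^ d) *\<^sub>R P z) has_derivative (\<lambda>t. (real d * t) *\<^sub>R P z)) (at 1)"
    by (auto intro!: derivative_eq_intros)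
  ultimately have "(\<lambda>t::real. frechet_derivative P (at z) (t *\<^sub>R z)) = (\<lambda>t. (real d * t) *\<^sub>R P z)"
    by (rule has_derivative_unique)
  from fun_cong[OF this, of 1] show "frechet_derivative P (at z) z = of_nat d *\<^sub>C P z"
    by (simp flip: scaleC_of_real)
qed

lemma poly_lift_imp_hol_lift: "poly_lift d f P \<Longrightarrow> hol_lift f P"
  by (auto simp: hol_lift_def hol_on_iff_cdiff_at poly_lift_cdiff_at) (auto simp: poly_lift_def)

lemma hol_lift_funpow:
  assumes "hol_lift f P"
  shows "hol_lift (f ^^ n) (P ^^ n)"
proof (induction n)
  case 0
  then show ?case by (simp add: hol_lift_def hol_on_iff_cdiff_at cdiff_at_ident id_def)
next
  case (Suc n)
  then show ?case
    using assms cdiff_at_compose[of _ "P ^^ n" P] by (auto simp: hol_lift_def hol_on_iff_cdiff_at o_def)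
qed

text \<open>By multilinearity the arguments can be corrected one at a time, each correction being a
  term with an argument tangent to the fibre.\<close>

lemma diff_form_add_tangent:
  assumes "diff_form m \<alpha>"
  shows "\<alpha> z (\<lambda>i. u i + e i *\<^sub>C z) = \<alpha> z u"
proof -
  note D = diff_formD[OF assms]
  have "n \<le> m \<Longrightarrow> \<alpha> z (\<lambda>i. if i < n then u i + e i *\<^sub>C z else u i) = \<alpha> z u" for n
  proof (induction n)
    case (Suc n)
    define w where "w = (\<lambda>i. if i < n then u i + e i *\<^sub>C z else u i)"
    have "(\<lambda>i. if i < Suc n then u i + e i *\<^sub>C z else u i) = w(n := u n + e n *\<^sub>C z)"
      by (auto simp: w_def less_Suc_eq)
    then have "\<alpha> z (\<lambda>i. if i < Suc n then u i + e i *\<^sub>C z else u i) = \<alpha> z (w(n := u n)) + \<alpha> z (w(n := e n *\<^sub>C z))"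
      using linear_add[OF D(3)[of n z w]] Suc.prems by simp
    also have "w(n := u n) = w" by (auto simp: w_def)
    also have "\<alpha> z (w(n := e n *\<^sub>C z)) = 0" using D(6)[of n "w(n := e n *\<^sub>C z)" "e n" z] Suc.prems by simp
    finally show ?case using Suc by (simp add: w_def)
  qed simp
  from this[of m] show ?thesis
    using D(1)[of "\<lambda>i. if i < m then u i + e i *\<^sub>C z else u i" "\<lambda>i. u i + e i *\<^sub>C z" z] by simp
qed

text \<open>The lift G selected by \<open>SOME\<close> is a scalar function c times Q. Its
  derivative is c times that of Q plus a multiple of Q z; the latter is tangent to the fibre, and
  the factor c disappears by invariance under homotheties.\<close>

lemma pullback_eq:
  assumes Q: "hol_lift f Q" and \<alpha>: "diff_form m \<alpha>" and z: "z \<noteq> 0"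
  shows "pullback f \<alpha> z v = \<alpha> (Q z) (\<lambda>i. frechet_derivative Q (at z) (v i))"
proof -
  have Q': "local_lift f z Q"
    unfolding local_lift_def by (intro exI[of _ "- {0}"]) (use Q z in \<open>auto simp: hol_lift_def\<close>)
  define G where "G = (SOME G. local_lift f z G)"
  have "local_lift f z G" unfolding G_def by (rule someI[of "local_lift f z", OF Q'])
  then obtain N where N: "open N" "z \<in> N" "hol_on N G" 
    "\<And>y. y \<in> N \<Longrightarrow> y \<noteq> 0 \<and> G y \<noteq> 0 \<and> f (pt y) = pt (G y)"
    unfolding local_lift_def by blast
  note DG = cdiff_atD[OF N(3)[unfolded hol_on_iff_cdiff_at, rule_format, OF N(2)]]
  have cQ: "cdiff_at y Q" if "y \<noteq> 0" for y using Q that by (auto simp: hol_lift_def hol_on_iff_cdiff_at)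
  note DQ = cdiff_atD[OF cQ[OF z]]
  obtain i where i: "Q z $ i \<noteq> 0" using Q z by (auto simp: hol_lift_def vec_eq_iff)
  \<comment> \<open>Writing the factor as a quotient of coordinates, with a coordinate of Q that
    does not vanish at z, shows that it is differentiable at z.\<close>
  define c where "c y = G y $ i * inverse (Q y $ i)" for y
  have Gc: "G y = c y *\<^sub>C Q y" if y: "y \<in> N" "Q y $ i \<noteq> 0" for y
  proof -
    obtain b where "G y = b *\<^sub>C Q y"
      using pt_eq_iff[of "G y" "Q y"] Q N(4)[OF y(1)] by (auto simp: hol_lift_def)
    then have "c y = b" using y(2) by (simp add: c_def)
    then show ?thesis using \<open>G y = b *\<^sub>C Q y\<close> by simp
  qed
  have cont: "continuous_on (- {0}) (\<lambda>y. Q y $ i)"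
    using has_derivative_continuous[OF cdiff_atD(1)[OF cQ]]
    by (intro continuous_intros) (simp add: continuous_at_imp_continuous_on)
  define N' where "N' = N \<inter> ((\<lambda>y. Q y $ i) -` (- {0}) \<inter> (- {0}))"
  have N': "open N'" "z \<in> N'"
    unfolding N'_def using N i z
    by (auto intro!: open_Int continuous_open_preimage[OF cont] simp: Int_commute[of _ "- {0}"])
  have "((\<lambda>y. G y $ i) has_derivative (\<lambda>v. frechet_derivative G (at z) v $ i)) (at z)"
    "((\<lambda>y. Q y $ i) has_derivative (\<lambda>v. frechet_derivative Q (at z) v $ i)) (at z)"
    by (rule bounded_linear.has_derivative[OF bounded_linear_vec_nth DG(1)],
        rule bounded_linear.has_derivative[OF bounded_linear_vec_nth DQ(1)])
  from has_derivative_mult[OF this(1) Deriv.has_derivative_inverse[OF i this(2)]]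
  obtain Dc where Dc: "(c has_derivative Dc) (at z)"
    unfolding c_def by blast
  have "((\<lambda>y. c y *\<^sub>C Q y) has_derivative
      (\<lambda>v. c z *\<^sub>C frechet_derivative Q (at z) v + Dc v *\<^sub>C Q z)) (at z)"
    by (rule bounded_bilinear.FDERIV[OF bounded_bilinear_scaleC Dc DQ(1)])
  then have "(G has_derivative (\<lambda>v. c z *\<^sub>C frechet_derivative Q (at z) v + Dc v *\<^sub>C Q z)) (at z)"
    by (rule has_derivative_cong_open[OF N', rotated]) (auto simp: N'_def Gc)
  from frechet_derivative_at[OF this]
  have fG: "frechet_derivative G (at z) v = c z *\<^sub>C frechet_derivative Q (at z) v + Dc v *\<^sub>C Q z" for v
    by (metis (no_types))
  have Gz: "G z = c z *\<^sub>C Q z" using Gc N(2) i by blast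
  then have c0: "c z \<noteq> 0" using N(2,4) by auto
  define e where "e i = Dc (v i) / c z" for i
  have "pullback f \<alpha> z v = \<alpha> (G z) (\<lambda>i. frechet_derivative G (at z) (v i))"
    using z by (simp add: pullback_def Let_def G_def)
  also have "\<dots> = \<alpha> (c z *\<^sub>C Q z) (\<lambda>i. c z *\<^sub>C (frechet_derivative Q (at z) (v i) + e i *\<^sub>C Q z))"
    using c0 by (simp add: fG Gz e_def scaleC_add_right scaleC_scaleC)
  also have "\<dots> = \<alpha> (Q z) (\<lambda>i. frechet_derivative Q (at z) (v i))"
    by (simp add: diff_formD(5)[OF \<alpha> c0] diff_form_add_tangent[OF \<alpha>])
  finally show ?thesis .
qed

text \<open>Smoothness of a form concerns constant arguments only. Arguments that vary with z are
  brought in one at a time, each expanded in the basis.\<close>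

lemma Ck_form:
  assumes "open X" "smooth_form m \<alpha>" "Ck k X P" "P ` X \<subseteq> - {0}" "\<And>i. Ck k X (U i)"
  shows "Ck k X (\<lambda>z. \<alpha> (P z) (\<lambda>i. U i z))"
proof -
  have d: "diff_form m \<alpha>" using assms(2) by (simp add: smooth_form_def)
  note D = diff_formD[OF d]
  have "n \<le> m \<Longrightarrow> Ck k X (\<lambda>z. \<alpha> (P z) (\<lambda>i. if i < n then U i z else v i))" for n v
  proof (induction n arbitrary: v)
    case 0
    have "Ck k (- {0}) (\<lambda>z. \<alpha> z v)" using assms(2) by (simp add: smooth_form_def smooth_on_iff_Ck)
    then show ?case using Ck_compose[OF assms(1,4) _ assms(3)] by simp
  next
    case (Suc n)
    then have n: "n < m" by simp
    have "\<alpha> (P z) (\<lambda>i. if i < Suc n then U i z else v i) =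
        (\<Sum>b\<in>Basis. (U n z \<bullet> b) *\<^sub>R \<alpha> (P z) (\<lambda>i. if i < n then U i z else (v(n := b)) i))" for z
    proof -
      define w where "w = (\<lambda>i. if i < n then U i z else v i)"
      have w: "(\<lambda>b. w(n := b)) = (\<lambda>b i. if i < n then U i z else (v(n := b)) i)"
        by (auto simp: w_def fun_eq_iff)
      have "(\<lambda>i. if i < Suc n then U i z else v i) = w(n := U n z)"
        by (auto simp: w_def less_Suc_eq)
      also have "\<dots> = w(n := (\<Sum>b\<in>Basis. (U n z \<bullet> b) *\<^sub>R b))"
        by (simp add: euclidean_representation)
      finally have "\<alpha> (P z) (\<lambda>i. if i < Suc n then U i z else v i) =
          \<alpha> (P z) (w(n := (\<Sum>b\<in>Basis. (U n z \<bullet> b) *\<^sub>R b)))" by (rule arg_cong)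
      also have "\<dots> = (\<Sum>b\<in>Basis. (U n z \<bullet> b) *\<^sub>R \<alpha> (P z) (w(n := b)))"
        unfolding linear_sum[OF D(3)[OF n, of "P z" w]] linear_scale[OF D(3)[OF n, of "P z" w]] ..
      finally show ?thesis unfolding fun_cong[OF w] .
    qed
    then show ?case
      by (auto intro!: Ck_sum[OF assms(1)] Ck_bilinear[OF assms(1) bounded_bilinear_scaleR]
          Ck_bounded_linear[OF assms(1) bounded_linear_inner_left] assms(5) Suc.IH simp del: fun_upd_apply)
        (use Suc in auto)
  qed
  from this[of m "\<lambda>_. 0"] show ?thesis
    using D(1)[of "\<lambda>i. if i < m then U i _ else 0" "\<lambda>i. U i _"] by simp
qed

lemma smooth_form_pullback:
  assumes f: "algebraic_degree f d" and \<alpha>: "smooth_form m \<alpha>"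
  shows "smooth_form m (pullback f \<alpha>)"
proof -
  obtain P where P: "poly_lift d f P" using f by (auto simp: algebraic_degree_def poly_lift_def)
  have d: "diff_form m \<alpha>" using \<alpha> by (simp add: smooth_form_def)
  note D = diff_formD[OF d]
  note dP = cdiff_atD[OF poly_lift_cdiff_at[OF P]]
  define L where "L z v = frechet_derivative P (at z) v" for z v
  have eq: "pullback f \<alpha> z v = (if z = 0 then 0 else \<alpha> (P z) (\<lambda>i. L z (v i)))" for z v
    using pullback_eq[OF poly_lift_imp_hol_lift[OF P] d] by (simp add: L_def pullback_def)
  have L: "linear (L z)" for z
    unfolding L_def using dP(1) has_derivative_linear by blast
  have "diff_form m (pullback f \<alpha>)"
  proof (rule diff_formI, goal_cases)
    case (1 z v v')
    then show ?case using D(1)[of "\<lambda>i. L z (v i)" "\<lambda>i. L z (v' i)" "P z"] by (simp add: eq)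
  next
    case (3 z v i)
    have "(\<lambda>ia. L z ((v(i := x)) ia)) = (\<lambda>ia. L z (v ia))(i := L z x)" for x by auto
    then show ?case
      using linear_compose[OF L D(3)[OF 3, of "P z" "\<lambda>i. L z (v i)"]]
      by (cases "z = 0") (simp_all add: eq o_def linear_zero)
  next
    case (4 z v i j)
    then show ?case using D(4)[of i j "\<lambda>i. L z (v i)" "P z"] by (simp add: eq)
  next
    case (5 z v c)
    then show ?case
      using poly_lift_scaleC[OF P] poly_lift_deriv(1)[OF P] D(5)[of "c ^ d"] by (simp add: eq L_def)
  next
    case (6 z v i c)
    then have "L z (v i) = (c * of_nat d) *\<^sub>C P z"
      by (simp add: L_def dP(2) poly_lift_deriv(2)[OF P] scaleC_scaleC)
    then show ?case using D(6)[of i "\<lambda>i. L z (v i)" _ "P z"] 6 by (simp add: eq)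
  qed (simp add: eq)
  moreover have o: "open (- {0 :: 'a hvec})" by auto
  have "Ck k (- {0}) (\<lambda>z. pullback f \<alpha> z v)" for k v
  proof (rule Ck_cong[OF o])
    show "Ck k (- {0}) (\<lambda>z. \<alpha> (P z) (\<lambda>i. L z (v i)))"
    proof (rule Ck_form[OF o \<alpha> poly_lift_Ck[OF P o]])
      show "Ck k (- {0}) (\<lambda>z. L z (v i))" for i
        using poly_lift_Ck[OF P o, of "Suc k"] by (simp add: L_def)
    qed (use P in \<open>auto simp: poly_lift_def\<close>)
  qed (simp add: eq)
  ultimately show ?thesis by (simp add: smooth_form_def smooth_on_iff_Ck)
qed

section \<open>Invariant currents and their supports\<close>

lemma pullback_pullback:
  assumes f: "algebraic_degree f d" and \<alpha>: "smooth_form m \<alpha>"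
  shows "pullback (f ^^ n) (pullback f \<alpha>) = pullback (f ^^ Suc n) \<alpha>"
proof (intro ext)
  fix z v
  obtain P where P: "poly_lift d f P" using f by (auto simp: algebraic_degree_def poly_lift_def)
  note hP = poly_lift_imp_hol_lift[OF P]
  note hn = hol_lift_funpow[OF hP]
  have da: "diff_form m \<alpha>" "diff_form m (pullback f \<alpha>)"
    using \<alpha> smooth_form_pullback[OF f \<alpha>] by (auto simp: smooth_form_def)
  show "pullback (f ^^ n) (pullback f \<alpha>) z v = pullback (f ^^ Suc n) \<alpha> z v"
  proof (cases "z = 0")
    case True then show ?thesis by (simp add: pullback_def)
  next
    case False
    let ?w = "(P ^^ n) z"
    have w: "?w \<noteq> 0" using hn False by (auto simp: hol_lift_def)
    have cn: "cdiff_at z (P ^^ n)" using hn False by (auto simp: hol_lift_def hol_on_iff_cdiff_at)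
    have "((\<lambda>z. P ((P ^^ n) z)) has_derivative
        (\<lambda>v. frechet_derivative P (at ?w) (frechet_derivative (P ^^ n) (at z) v))) (at z)"
      by (rule has_derivative_compose[OF cdiff_atD(1)[OF cn] cdiff_atD(1)[OF poly_lift_cdiff_at[OF P]]])
    from frechet_derivative_at[OF this]
    have "frechet_derivative (P ^^ Suc n) (at z) = (\<lambda>v. frechet_derivative P (at ?w) (frechet_derivative (P ^^ n) (at z) v))"
      by (simp add: o_def)
    then show ?thesis
      using pullback_eq[OF hn da(2) False, of n] pullback_eq[OF hn da(1) False, of "Suc n"]
        pullback_eq[OF hP da(1) w] by simp
  qed
qed

text \<open>Testing against \<open>pullback f \<alpha>\<close> instead of \<alpha> shifts the
  averaged sequence by one index and multiplies it by \<open>of_nat d ^ s\<close>; a shift does not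
  change a Cesaro limit.\<close>

lemma cesaro_limit_invariant:
  assumes f: "algebraic_degree f d" and d: "d \<noteq> 0" and \<alpha>: "smooth_form (2 * s) \<alpha>"
    and lim: "\<And>\<alpha>. smooth_form (2 * s) \<alpha> \<Longrightarrow>
      (\<lambda>n. 1 / of_nat n * (\<Sum>i=1..n. pushforward (2 * s) (f ^^ i) R \<alpha> / of_nat d ^ (i * s))) \<longlonglongrightarrow> \<tau> \<alpha>"
  shows "\<tau> (pullback f \<alpha>) = of_nat d ^ s * \<tau> \<alpha>"
proof -
  define x where "x i = pushforward (2 * s) (f ^^ i) R \<alpha> / of_nat d ^ (i * s)" for i
  note sm = smooth_form_pullback[OF f \<alpha>]
  have "pushforward (2 * s) (f ^^ i) R (pullback f \<alpha>) / of_nat d ^ (i * s) = of_nat d ^ s * x (Suc i)" for i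
    using sm \<alpha> d pullback_pullback[OF f \<alpha>, of i]
    by (simp add: x_def pushforward_def power_add field_simps)
  then have 1: "(\<lambda>n. 1 / of_nat n * (\<Sum>i=1..n. of_nat d ^ s * x (Suc i))) \<longlonglongrightarrow> \<tau> (pullback f \<alpha>)"
    using lim[OF sm] by simp
  have "(\<lambda>n. 1 / of_nat n * (\<Sum>i=1..n. x i)) \<longlonglongrightarrow> \<tau> \<alpha>"
    using lim[OF \<alpha>] by (simp add: x_def)
  then have S: "(\<lambda>n. 1 / of_nat (Suc n) * (\<Sum>i=1..Suc n. x i)) \<longlonglongrightarrow> \<tau> \<alpha>"
    by (rule LIMSEQ_Suc)
  have inv: "(\<lambda>n. 1 / of_nat n :: complex) \<longlonglongrightarrow> 0"
    by (rule lim_1_over_n)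
  \<comment> \<open>The factor 1 + 1/n converts the normalisation 1/(n + 1) into 1/n, and the
    subtracted term removes the first entry, which the shift drops.\<close>
  have "(\<lambda>n. of_nat d ^ s * ((1 + 1 / of_nat n) * (1 / of_nat (Suc n) * (\<Sum>i=1..Suc n. x i)) - 1 / of_nat n * x 1))
      \<longlonglongrightarrow> of_nat d ^ s * ((1 + 0) * \<tau> \<alpha> - 0 * x 1)"
    by (intro tendsto_intros inv S)
  moreover have "\<forall>\<^sub>F n in sequentially. of_nat d ^ s * ((1 + 1 / of_nat n) * (1 / of_nat (Suc n) * (\<Sum>i=1..Suc n. x i)) - 1 / of_nat n * x 1) =
      1 / of_nat n * (\<Sum>i=1..n. of_nat d ^ s * x (Suc i))"
    using eventually_gt_at_top[of 0]
  proof eventually_elim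
    case (elim n)
    have "(\<Sum>i=1..Suc n. x i) = x 1 + (\<Sum>i=1..n. x (Suc i))"
      using sum.atLeast_Suc_atMost[of 1 "Suc n" x] sum.shift_bounds_cl_Suc_ivl[of x 1 n] by simp
    moreover have "(1 + 1 / of_nat n) * (1 / of_nat (Suc n)) = (1 / of_nat n :: complex)"
      using elim by (simp add: divide_simps del: of_nat_Suc) (simp add: algebra_simps)
    ultimately show ?case
      unfolding mult.assoc[symmetric] by (simp add: algebra_simps sum_distrib_left)
  qed
  ultimately have "(\<lambda>n. 1 / of_nat n * (\<Sum>i=1..n. of_nat d ^ s * x (Suc i))) \<longlonglongrightarrow> of_nat d ^ s * \<tau> \<alpha>"
    using Lim_transform_eventually by fastforce
  then show ?thesis using LIMSEQ_unique 1 by blast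
qed

text \<open>The preimage of V under f is the image under the open map \<open>pt\<close> of the set
  of nonzero vectors that P sends above V.\<close>

lemma continuous_on_endomorphism:
  assumes "algebraic_degree f d"
  shows "continuous_on UNIV f"
proof -
  obtain P where P: "poly_lift d f P" using assms by (auto simp: algebraic_degree_def poly_lift_def)
  have "continuous_on (- {0}) P"
    using has_derivative_continuous[OF cdiff_atD(1)[OF poly_lift_cdiff_at[OF P]]]
    by (simp add: continuous_at_imp_continuous_on)
  then have "continuous_on (- {0}) (\<lambda>z. pt (P z))"
    by (rule continuous_on_compose2[OF continuous_on_pt]) (use P in \<open>auto simp: poly_lift_def\<close>)
  moreover have "open (pt ` (((\<lambda>z. pt (P z)) -` V) \<inter> (- {0})))" if "continuous_on (- {0}) (\<lambda>z. pt (P z))" "open V" for V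
  proof (rule open_pt_image)
    show "open (((\<lambda>z. pt (P z)) -` V) \<inter> (- {0}))"
      using continuous_open_preimage[OF that(1) open_Compl[OF closed_singleton] that(2)]
      by (simp add: Int_commute)
  qed auto
  moreover have "pt ` (((\<lambda>z. pt (P z)) -` V) \<inter> (- {0})) = f -` V" for V
  proof (intro equalityI subsetI)
    fix x assume x: "x \<in> f -` V"
    obtain z where "z \<noteq> 0" "pt z = x" using hrep by metis
    then show "x \<in> pt ` (((\<lambda>z. pt (P z)) -` V) \<inter> (- {0}))"
      using P x by (intro image_eqI[of _ _ z]) (auto simp: poly_lift_def)
  qed (use P in \<open>auto simp: poly_lift_def\<close>)
  ultimately show ?thesis by (simp add: continuous_on_open_vimage)
qed

text \<open>Let K be the support; f(K) is closed by compactness. A form supported off f(K) pulls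
  back to one supported off K, which S annihilates; by invariance S annihilates the form
  itself.\<close>

lemma current_support_subset_image:
  assumes f: "algebraic_degree f d" and S: "current m S" and c: "c \<noteq> 0"
    and inv: "\<And>\<alpha>. smooth_form m \<alpha> \<Longrightarrow> S (pullback f \<alpha>) = c * S \<alpha>"
  shows "current_support m S \<subseteq> f ` current_support m S"
proof -
  let ?K = "current_support m S"
  obtain P where P: "poly_lift d f P" using f by (auto simp: algebraic_degree_def poly_lift_def)
  note cont = continuous_on_endomorphism[OF f]
  have "closed ?K" by (rule closed_current_support)
  then have "compact (f ` ?K)"
    by (intro compact_continuous_image continuous_on_subset[OF cont] compact_closed_pspace) auto
  then have o: "open (- (f ` ?K))" by (intro open_Compl compact_imp_closed)
  have "S \<alpha> = 0" if \<alpha>: "smooth_form m \<alpha>" "form_support \<alpha> \<subseteq> - (f ` ?K)" for \<alpha>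
  proof -
    have "closed (f -` form_support \<alpha>)"
      unfolding form_support_def by (rule closed_vimage[OF closed_closure cont])
    moreover have "{x. \<exists>z v. z \<noteq> 0 \<and> pt z = x \<and> pullback f \<alpha> z v \<noteq> 0} \<subseteq> f -` form_support \<alpha>"
    proof
      fix x assume "x \<in> {x. \<exists>z v. z \<noteq> 0 \<and> pt z = x \<and> pullback f \<alpha> z v \<noteq> 0}"
      then obtain z v where z: "z \<noteq> 0" "pt z = x" "pullback f \<alpha> z v \<noteq> 0" by blast
      then have "\<alpha> (P z) (\<lambda>i. frechet_derivative P (at z) (v i)) \<noteq> 0"
        using pullback_eq[OF poly_lift_imp_hol_lift[OF P] _ z(1)] \<alpha>(1) by (auto simp: smooth_form_def)
      moreover have "P z \<noteq> 0" "pt (P z) = f x" using P z by (auto simp: poly_lift_def)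
      ultimately have "f x \<in> form_support \<alpha>"
        unfolding form_support_def by (intro subsetD[OF closure_subset] CollectI exI conjI)
      then show "x \<in> f -` form_support \<alpha>" by simp
    qed
    ultimately have "form_support (pullback f \<alpha>) \<subseteq> f -` form_support \<alpha>"
      unfolding form_support_def[of "pullback f \<alpha>"] by (rule closure_minimal[rotated])
    then have "form_support (pullback f \<alpha>) \<inter> ?K = {}" using \<alpha>(2) by fast
    then have "S (pullback f \<alpha>) = 0" by (rule current_eq_0[OF S smooth_form_pullback[OF f \<alpha>(1)]])
    then show ?thesis using inv[OF \<alpha>(1)] c by simp
  qed
  then have "- (f ` ?K) \<subseteq> - ?K"
    using o by (subst current_support_def) auto
  then show ?thesis by blast
qed

section \<open>Surjectivity of endomorphisms\<close>

text \<open>Four times a discrete circular mean, over \<epsilon> times the fourth roots of unity.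
  The values of t and of t^2 both sum to 0 over these points, which is all the cancellation that the
  second-order argument uses.\<close>

definition sum4 :: "(complex \<Rightarrow> real) \<Rightarrow> real \<Rightarrow> real" where
  "sum4 h \<epsilon> = h (of_real \<epsilon>) + h (- of_real \<epsilon>) + h (\<i> * of_real \<epsilon>) + h (- \<i> * of_real \<epsilon>)"

lemma sum4_sum: "(\<Sum>i\<in>I. sum4 (h i) \<epsilon>) = sum4 (\<lambda>t. \<Sum>i\<in>I. h i t) \<epsilon>"
  by (simp add: sum4_def sum.distrib)

lemma sum4_mono:
  assumes "\<And>t. cmod t = \<bar>\<epsilon>\<bar> \<Longrightarrow> g t \<le> h t"
  shows "sum4 g \<epsilon> \<le> sum4 h \<epsilon>"
  unfolding sum4_def by (intro add_mono assms) (simp_all add: norm_mult)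

text \<open>Write p = a + b t^2 + t^3 q. The cross term of a and b t^2 has order 2 but cancels in
  the sum; |b t^2|^2 has order 4, and everything involving q has order at least 3.\<close>

lemma sum4_poly_le:
  fixes p :: "complex poly"
  assumes "coeff p 1 = 0"
  obtains C where "\<And>\<epsilon>. 0 < \<epsilon> \<Longrightarrow> \<epsilon> \<le> 1 \<Longrightarrow>
    sum4 (\<lambda>t. (cmod (poly p t))\<^sup>2) \<epsilon> \<le> 4 * (cmod (coeff p 0))\<^sup>2 + C * \<epsilon> ^ 3"
proof -
  obtain a b q where "p = pCons a (pCons 0 (pCons b q))"
    using assms by (metis One_nat_def coeff_pCons_0 coeff_pCons_Suc pCons_cases)
  then have p: "poly p t = (a + t\<^sup>2 * b) + t ^ 3 * poly q t" "coeff p 0 = a" for t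
    by (simp_all add: power2_eq_square power3_eq_cube algebra_simps)
  have "compact ((\<lambda>t. poly q t) ` cball 0 1)"
    by (intro compact_continuous_image continuous_intros compact_cball)
  then obtain R where R: "\<And>t. cmod t \<le> 1 \<Longrightarrow> cmod (poly q t) \<le> R" "R > 0"
    using bounded_pos[of "(\<lambda>t. poly q t) ` cball 0 1"] compact_imp_bounded by fastforce
  \<comment> \<open>The cross term with t^3 q contributes the first summand; its square contributes
    R^2, since \<epsilon>^6 \<le> \<epsilon>^3.\<close>
  define C0 where "C0 = 2 * (cmod a + cmod b) * R + R\<^sup>2"
  have "sum4 (\<lambda>t. (cmod (poly p t))\<^sup>2) \<epsilon> \<le> 4 * (cmod (coeff p 0))\<^sup>2 + (4 * (cmod b)\<^sup>2 + 4 * C0) * \<epsilon> ^ 3"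
    if \<epsilon>: "0 < \<epsilon>" "\<epsilon> \<le> 1" for \<epsilon>
  proof -
    have "(cmod (poly p t))\<^sup>2 \<le> (cmod (a + t\<^sup>2 * b))\<^sup>2 + C0 * \<epsilon> ^ 3" if t: "cmod t = \<bar>\<epsilon>\<bar>" for t
    proof -
      define s where "s = cmod (t ^ 3 * poly q t)"
      have s: "0 \<le> s" "s \<le> R * \<epsilon> ^ 3"
        using R(1)[of t] t \<epsilon> by (auto simp: s_def norm_mult norm_power mult.commute mult_left_mono)
      have "\<epsilon> ^ 2 \<le> 1" "\<epsilon> ^ 3 \<le> 1" using \<epsilon> by (auto intro: power_le_one)
      have "cmod (t\<^sup>2 * b) \<le> cmod b"
        using t \<epsilon> \<open>\<epsilon> ^ 2 \<le> 1\<close> by (simp add: norm_mult norm_power mult_left_le_one_le)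
      then have ab: "cmod (a + t\<^sup>2 * b) \<le> cmod a + cmod b"
        using norm_triangle_ineq[of a "t\<^sup>2 * b"] by linarith
      have "cmod (poly p t) \<le> cmod (a + t\<^sup>2 * b) + s"
        unfolding p s_def by (rule norm_triangle_ineq)
      then have "(cmod (poly p t))\<^sup>2 \<le> (cmod (a + t\<^sup>2 * b) + s)\<^sup>2"
        by (intro power_mono) auto
      also have "\<dots> = (cmod (a + t\<^sup>2 * b))\<^sup>2 + 2 * cmod (a + t\<^sup>2 * b) * s + s * s"
        by (simp add: power2_eq_square algebra_simps)
      also have "2 * cmod (a + t\<^sup>2 * b) * s \<le> 2 * (cmod a + cmod b) * (R * \<epsilon> ^ 3)"
        using ab s by (intro mult_mono) auto
      also have "s * s \<le> (R * 1) * (R * \<epsilon> ^ 3)"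
        using s R(2) \<epsilon> order_trans[OF s(2), of "R * 1"] \<open>\<epsilon> ^ 3 \<le> 1\<close> by (intro mult_mono) auto
      finally show ?thesis by (simp add: C0_def power2_eq_square algebra_simps)
    qed
    then have "sum4 (\<lambda>t. (cmod (poly p t))\<^sup>2) \<epsilon> \<le> sum4 (\<lambda>t. (cmod (a + t\<^sup>2 * b))\<^sup>2 + C0 * \<epsilon> ^ 3) \<epsilon>"
      by (rule sum4_mono)
    also have "\<dots> = 4 * (cmod a)\<^sup>2 + 4 * (\<epsilon> ^ 4 * (cmod b)\<^sup>2) + 4 * (C0 * \<epsilon> ^ 3)"
      unfolding sum4_def cmod_power2
      by (simp add: power_mult_distrib power2_eq_square algebra_simps)
         (simp add: power4_eq_xxxx algebra_simps)
    also have "\<epsilon> ^ 4 * (cmod b)\<^sup>2 \<le> \<epsilon> ^ 3 * (cmod b)\<^sup>2"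
      using \<epsilon> by (intro mult_right_mono power_decreasing) auto
    finally show ?thesis by (simp add: p algebra_simps)
  qed
  then show ?thesis by (rule that)
qed

section \<open>Polynomial dependence along complex lines, and surjectivity\<close>

definition is_poly :: "(complex \<Rightarrow> complex) \<Rightarrow> bool" where
  "is_poly g \<longleftrightarrow> (\<exists>p. \<forall>t. g t = poly p t)"

lemma is_poly_const: "is_poly (\<lambda>t. c)"
  unfolding is_poly_def by (intro exI[of _ "[:c:]"]) auto

lemma is_poly_ident: "is_poly (\<lambda>t. t)"
  unfolding is_poly_def by (intro exI[of _ "[:0, 1:]"]) auto

lemma is_poly_add: "is_poly f \<Longrightarrow> is_poly g \<Longrightarrow> is_poly (\<lambda>t. f t + g t)"
  unfolding is_poly_def by (metis poly_add)

lemma is_poly_diff: "is_poly f \<Longrightarrow> is_poly g \<Longrightarrow> is_poly (\<lambda>t. f t - g t)"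
  unfolding is_poly_def by (metis poly_diff)

lemma is_poly_mult: "is_poly f \<Longrightarrow> is_poly g \<Longrightarrow> is_poly (\<lambda>t. f t * g t)"
  unfolding is_poly_def by (metis poly_mult)

lemma is_poly_sum: "(\<And>i. i \<in> I \<Longrightarrow> is_poly (f i)) \<Longrightarrow> is_poly (\<lambda>t. \<Sum>i\<in>I. f i t)"
  by (induction I rule: infinite_finite_induct) (auto intro: is_poly_const is_poly_add)

lemma is_poly_prod: "(\<And>i. i \<in> I \<Longrightarrow> is_poly (f i)) \<Longrightarrow> is_poly (\<lambda>t. \<Prod>i\<in>I. f i t)"
  by (induction I rule: infinite_finite_induct) (auto intro: is_poly_const is_poly_mult)

lemma is_poly_power: "is_poly f \<Longrightarrow> is_poly (\<lambda>t. f t ^ n)"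
  by (induction n) (auto intro: is_poly_const is_poly_mult)

lemma homogeneous_poly_is_poly:
  assumes "homogeneous_poly d q"
  shows "is_poly (\<lambda>t. q (z + t *\<^sub>C v))"
proof -
  obtain c where q: "q = (\<lambda>z. \<Sum>a | (\<Sum>i\<in>UNIV. a i) = d. c a * (\<Prod>i\<in>UNIV. (z $ i) ^ a i))"
    using assms by (auto simp: homogeneous_poly_def)
  show ?thesis unfolding q vector_add_component scaleC_nth
    by (intro is_poly_sum is_poly_mult is_poly_const is_poly_prod is_poly_power is_poly_add is_poly_ident)
qed

text \<open>If \<open>y = pt w\<close> is not in the image, project the lift \<open>P\<close> orthogonally to \<open>w\<close>: the resulting \<open>Q\<close>
  has no zero on the unit sphere.  At a minimum \<open>Z\<close> of \<open>|Q|\<close> on the sphere, the derivative of \<open>Q\<close>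
  has a kernel vector \<open>v\<close>.  Averaged over \<open>t, - t, \<i>t, - \<i>t\<close>, the function \<open>|Q (Z + t v)|\<^sup>2\<close> is then
  constant up to the third order, while \<open>|Z + t v|\<^sup>2\<close> is not; this contradicts
  \<open>|Q z|\<^sup>2 \<ge> |Q Z|\<^sup>2 |z|\<^sup>2\<^sup>d\<close>.\<close>

lemma surj_endomorphism:
  fixes f :: "'k::finite pspace \<Rightarrow> 'k pspace"
  assumes "algebraic_degree f d" "1 \<le> d"
  shows "surj f"
proof (rule ccontr)
  assume "\<not> surj f"
  then obtain y where y: "y \<notin> range f" by blast
  obtain P where P: "poly_lift d f P" using assms by (auto simp: algebraic_degree_def poly_lift_def)
  define w where "w = urep y"
  have w: "norm w = 1" "pt w = y" by (simp_all add: w_def urep)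
  then have w0: "w \<noteq> 0" by auto
  define \<pi> where "\<pi> u = u - herm u w *\<^sub>C w" for u
  have "linear \<pi>"
    by (rule linearI) (simp_all add: \<pi>_def vec_eq_iff herm_add_left herm_scaleC_left
      scaleC_complex_def algebra_simps flip: scaleC_of_real)
  then have bl: "bounded_linear \<pi>" by (simp add: linear_conv_bounded_linear)
  have \<pi>C: "\<pi> (c *\<^sub>C u) = c *\<^sub>C \<pi> u" for c u
    by (simp add: \<pi>_def vec_eq_iff herm_scaleC_left algebra_simps)
  define Q where "Q z = \<pi> (P z)" for z
  have Q0: "Q z \<noteq> 0" if "z \<noteq> 0" for z
  proof
    assume "Q z = 0"
    then have Pz: "P z = herm (P z) w *\<^sub>C w" by (simp add: Q_def \<pi>_def)
    moreover have "P z \<noteq> 0" "f (pt z) = pt (P z)" using P that by (auto simp: poly_lift_def)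
    ultimately have "f (pt z) = pt w"
      using pt_scaleC[of "herm (P z) w" w] by (metis scaleC_zero_left)
    then show False using y w(2) by (metis rangeI)
  qed
  have QC: "Q (c *\<^sub>C z) = c ^ d *\<^sub>C Q z" for c z
    by (simp add: Q_def poly_lift_scaleC[OF P] \<pi>C)
  note dP = cdiff_atD[OF poly_lift_cdiff_at[OF P]]
  have dQ: "(Q has_derivative (\<lambda>v. \<pi> (frechet_derivative P (at z) v))) (at z)" for z
    unfolding Q_def by (rule bounded_linear.has_derivative[OF bl dP(1)])
  have "continuous_on (sphere 0 1) (\<lambda>z. norm (Q z))"
    using has_derivative_continuous[OF dQ] by (intro continuous_intros continuous_at_imp_continuous_on) auto
  moreover have "sphere (0 :: 'k hvec) 1 \<noteq> {}" by auto
  ultimately obtain Z where Z: "norm Z = 1" "\<And>z. norm z = 1 \<Longrightarrow> norm (Q Z) \<le> norm (Q z)"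
    using continuous_attains_inf[OF compact_sphere, of "0 :: 'k hvec" 1 "\<lambda>z. norm (Q z)"] by auto
  define \<mu> where "\<mu> = (norm (Q Z))\<^sup>2"
  have "Z \<noteq> 0" using Z(1) by auto
  then have "\<mu> > 0" using Q0[of Z] by (simp add: \<mu>_def)
  have min: "\<mu> * ((norm z)\<^sup>2) ^ d \<le> (norm (Q z))\<^sup>2" for z
  proof (cases "z = 0")
    case True
    then show ?thesis using assms(2) by (simp add: zero_power)
  next
    case False
    define u where "u = of_real (inverse (norm z)) *\<^sub>C z"
    have "norm u = 1" using False by (simp add: u_def norm_scaleC norm_inverse)
    then have "norm (Q Z) \<le> norm (Q u)" by (rule Z(2))
    also have "Q u = of_real (inverse (norm z)) ^ d *\<^sub>C Q z" by (simp add: u_def QC)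
    also have "norm \<dots> = norm (Q z) / norm z ^ d"
      by (simp add: norm_scaleC norm_power norm_inverse divide_inverse power_inverse)
    finally have "norm (Q Z) * norm z ^ d \<le> norm (Q z)" using False by (simp add: pos_le_divide_eq)
    then have "(norm (Q Z) * norm z ^ d)\<^sup>2 \<le> (norm (Q z))\<^sup>2" by (intro power_mono) auto
    then show ?thesis by (simp add: \<mu>_def power_mult_distrib power_even_eq[symmetric] mult.commute flip: power_mult)
  qed
  define L where "L v = \<pi> (frechet_derivative P (at Z) v)" for v
  have L: "linear L" unfolding L_def using dQ has_derivative_linear by blast
  \<comment> \<open>All values of L are orthogonal to w, so L misses w; a linear endomorphism in
    finite dimension that is not surjective has a nonzero kernel vector.\<close>
  have "herm (\<pi> u) w = 0" for u
  proof -
    have "herm u w = herm (\<pi> u) w + herm (herm u w *\<^sub>C w) w"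
      by (subst herm_add_left[symmetric]) (simp add: \<pi>_def)
    then show ?thesis using w(1) by (simp add: herm_scaleC_left herm_self)
  qed
  then have "L v \<noteq> w" for v using w(1) by (metis L_def herm_self of_real_1 one_power2 zero_neq_one)
  then have "\<not> surj L" by (metis surjD)
  then have "\<not> inj L" using linear_injective_imp_surjective[OF L] by blast
  then obtain v where v: "v \<noteq> 0" "L v = 0" using linear_injective_0[OF L] by blast
  have "\<exists>p. (\<forall>t. Q (Z + t *\<^sub>C v) $ i = poly p t) \<and> coeff p 1 = 0 \<and> coeff p 0 = Q Z $ i" for i
  proof -
    have "is_poly (\<lambda>t. P (Z + t *\<^sub>C v) $ j)" for j
      using P by (intro homogeneous_poly_is_poly[of d "\<lambda>z. P z $ j"]) (simp add: poly_lift_def)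
    then have "is_poly (\<lambda>t. Q (Z + t *\<^sub>C v) $ i)"
      unfolding Q_def \<pi>_def vector_minus_component scaleC_nth herm_def
      by (intro is_poly_diff is_poly_mult is_poly_sum is_poly_const)
    then obtain p where p: "\<And>t. Q (Z + t *\<^sub>C v) $ i = poly p t"
      unfolding is_poly_def by metis
    \<comment> \<open>The derivative along real t already determines the coefficient of t in p, and
      it is 0 because L v = 0.\<close>
    have "((\<lambda>t::real. Z + of_real t *\<^sub>C v) has_derivative (\<lambda>t. t *\<^sub>R v)) (at 0)"
      unfolding scaleC_of_real by (auto intro!: derivative_eq_intros)
    moreover have "(Q has_derivative L) (at (Z + of_real 0 *\<^sub>C v))"
      using dQ[of Z] unfolding L_def by simp
    ultimately have "((\<lambda>t::real. Q (Z + of_real t *\<^sub>C v)) has_derivative (\<lambda>t. L (t *\<^sub>R v))) (at 0)"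
      by (rule has_derivative_compose)
    from bounded_linear.has_derivative[OF bounded_linear_vec_nth this, of i]
    have "((\<lambda>t::real. poly p (of_real t)) has_derivative (\<lambda>t. L (t *\<^sub>R v) $ i)) (at 0)"
      by (simp add: p)
    moreover have "(\<lambda>t. L (t *\<^sub>R v) $ i) = (\<lambda>t. 0)"
      using v(2) by (simp add: linear_scale[OF L])
    moreover have "((\<lambda>t::real. poly p (of_real t)) has_derivative (\<lambda>t. poly (pderiv p) 0 * of_real t)) (at 0)"
      using has_derivative_compose[OF bounded_linear_imp_has_derivative[OF bounded_linear_of_real],
          of "poly p" "(*) (poly (pderiv p) 0)" 0] poly_DERIV[of p 0]
      by (simp add: has_field_derivative_def)
    ultimately have "(\<lambda>t::real. poly (pderiv p) 0 * of_real t) = (\<lambda>t. 0)"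
      using has_derivative_unique by metis
    from fun_cong[OF this, of 1] have "coeff p 1 = 0"
      by (simp add: poly_0_coeff_0 coeff_pderiv)
    moreover have "coeff p 0 = Q Z $ i" using p[of 0] by (simp add: poly_0_coeff_0)
    ultimately show ?thesis using p by blast
  qed
  then obtain p where p: "\<And>i t. Q (Z + t *\<^sub>C v) $ i = poly (p i) t" "\<And>i. coeff (p i) 1 = 0"
    "\<And>i. coeff (p i) 0 = Q Z $ i" by metis
  have "\<exists>C. \<forall>\<epsilon>. 0 < \<epsilon> \<longrightarrow> \<epsilon> \<le> 1 \<longrightarrow>
    sum4 (\<lambda>t. (cmod (poly (p i) t))\<^sup>2) \<epsilon> \<le> 4 * (cmod (Q Z $ i))\<^sup>2 + C * \<epsilon> ^ 3" for i
    using sum4_poly_le[OF p(2)[of i]] p(3)[of i] by metis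
  then obtain C where C: "\<And>i \<epsilon>. 0 < \<epsilon> \<Longrightarrow> \<epsilon> \<le> 1 \<Longrightarrow>
    sum4 (\<lambda>t. (cmod (poly (p i) t))\<^sup>2) \<epsilon> \<le> 4 * (cmod (Q Z $ i))\<^sup>2 + C i * \<epsilon> ^ 3" by metis
  have nsq: "(norm u)\<^sup>2 = (\<Sum>i\<in>UNIV. (cmod (u $ i))\<^sup>2)" for u :: "'k hvec"
    by (simp add: norm_vec_def L2_set_def sum_nonneg)
  define E where "E = (\<Sum>i\<in>UNIV. C i)"
  have key: "4 * \<mu> * d * (norm v)\<^sup>2 \<le> E * \<epsilon>" if \<epsilon>: "0 < \<epsilon>" "\<epsilon> \<le> 1" for \<epsilon>
  proof -
    have "sum4 (\<lambda>t. \<mu> * (1 + d * ((norm (Z + t *\<^sub>C v))\<^sup>2 - 1))) \<epsilon> \<le> sum4 (\<lambda>t. (norm (Q (Z + t *\<^sub>C v)))\<^sup>2) \<epsilon>"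
    proof (rule sum4_mono)
      fix t
      let ?x = "(norm (Z + t *\<^sub>C v))\<^sup>2"
      \<comment> \<open>Bernoulli replaces the d-th power by an affine function of the squared norm,
        which \<open>sum4\<close> evaluates exactly: the terms linear in t cancel and
        \<open>d * (norm v)\<^sup>2 * \<epsilon>\<^sup>2\<close> survives from each of the four
        points.\<close>
      have "1 + d * (?x - 1) \<le> (1 + (?x - 1)) ^ d"
        by (rule Bernoulli_inequality) simp
      then have "\<mu> * (1 + d * (?x - 1)) \<le> \<mu> * ?x ^ d"
        using \<open>\<mu> > 0\<close> by (intro mult_left_mono) auto
      also have "\<dots> \<le> (norm (Q (Z + t *\<^sub>C v)))\<^sup>2" by (rule min)
      finally show "\<mu> * (1 + d * (?x - 1)) \<le> (norm (Q (Z + t *\<^sub>C v)))\<^sup>2" .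
    qed
    also have "\<dots> = (\<Sum>i\<in>UNIV. sum4 (\<lambda>t. (cmod (poly (p i) t))\<^sup>2) \<epsilon>)"
      unfolding sum4_sum nsq p ..
    also have "\<dots> \<le> (\<Sum>i\<in>UNIV. 4 * (cmod (Q Z $ i))\<^sup>2 + C i * \<epsilon> ^ 3)"
      using \<epsilon> by (intro sum_mono C)
    also have "\<dots> = 4 * \<mu> + E * \<epsilon> ^ 3"
      by (simp add: \<mu>_def nsq E_def sum.distrib sum_distrib_left sum_distrib_right)
    finally have 1: "sum4 (\<lambda>t. \<mu> * (1 + d * ((norm (Z + t *\<^sub>C v))\<^sup>2 - 1))) \<epsilon> \<le> 4 * \<mu> + E * \<epsilon> ^ 3" .
    have "(norm (Z + t *\<^sub>C v))\<^sup>2 = 1 + 2 * (Z \<bullet> (t *\<^sub>C v)) + (cmod t * norm v)\<^sup>2" for t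
      using Z(1) by (simp add: power2_norm_eq_inner inner_add_left inner_add_right inner_commute
          flip: norm_scaleC) (simp flip: power2_norm_eq_inner)
    moreover have "(- t) *\<^sub>C v = - (t *\<^sub>C v)" for t
      by (simp add: vec_eq_iff)
    ultimately have "sum4 (\<lambda>t. \<mu> * (1 + d * ((norm (Z + t *\<^sub>C v))\<^sup>2 - 1))) \<epsilon> = 4 * \<mu> + 4 * \<mu> * d * (norm v)\<^sup>2 * \<epsilon>\<^sup>2"
      by (simp add: sum4_def norm_mult power_mult_distrib algebra_simps)
    then have "(4 * \<mu> * d * (norm v)\<^sup>2) * \<epsilon>\<^sup>2 \<le> (E * \<epsilon>) * \<epsilon>\<^sup>2"
      using 1 by (simp add: power2_eq_square power3_eq_cube mult.assoc)
    then show ?thesis by (rule mult_right_le_imp_le) (use \<epsilon> in simp)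
  qed
  define c where "c = 4 * \<mu> * d * (norm v)\<^sup>2"
  have c: "c > 0" using \<open>\<mu> > 0\<close> v(1) assms(2) by (simp add: c_def)
  have "E \<ge> c" using key[of 1] by (simp add: c_def)
  \<comment> \<open>This choice of \<epsilon> turns the bound into c \<le> c/2; E \<ge> c, the case
    \<epsilon> = 1, makes it admissible.\<close>
  then have "c \<le> E * (c / (2 * E))" using c key[of "c / (2 * E)"] by (simp add: c_def[symmetric])
  then show False using c \<open>E \<ge> c\<close> by simp
qed

section \<open>Semicontinuity of the attracting sets\<close>

lemma surj_funpow:
  fixes f :: "'a \<Rightarrow> 'a"
  assumes "surj f" shows "surj (f ^^ n)"
proof (induction n)
  case (Suc n)
  then show ?case using comp_surj[OF Suc assms] by simp
qed simp

lemma C_mono: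
  fixes S :: "'k::finite functional"
  assumes "S \<in> \<C> p E" "current_support (2 * (CARD('k) - p)) S \<subseteq> E'"
  shows "S \<in> \<C> p E'"
  using assms by (simp add: \<C>_def Let_def)

lemma attracting_current_support:
  fixes \<tau> :: "'k::finite functional" and p m :: nat
  defines "m \<equiv> 2 * (CARD('k) - p)"
  assumes f: "algebraic_degree f d" "1 \<le> d" and U: "open U" "\<tau> \<in> \<C> p U"
    and \<tau>: "attracting_current d p f \<tau>"
    and unique: "\<And>T. T \<in> \<C> p U \<Longrightarrow> attracting_current d p f T \<Longrightarrow> T = \<tau>"
  shows "current_support m \<tau> \<subseteq> attracting_set f U"
proof -
  let ?K = "current_support m \<tau>"
  obtain V where V: "trapping_region_codim p f V" "attractive_on d p f V \<tau>"
    using \<tau> by (auto simp: attracting_current_def)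
  have oV: "open V" using V(1) by (simp add: trapping_region_codim_def trapping_region_def)
  have \<tau>V: "\<tau> \<in> \<C> p V" using V(2) by (simp add: attractive_on_def)
  have KU: "?K \<subseteq> U" and KV: "?K \<subseteq> V" and cur: "current m \<tau>"
    using U(2) \<tau>V by (auto simp: \<C>_def Let_def m_def bidim_current_def)
  show ?thesis
  proof (cases "\<exists>R\<in>\<C> p V. given_by_continuous_form p R")
    case True
    then obtain R where R: "R \<in> \<C> p V" "given_by_continuous_form p R" by blast
    have "\<tau> (pullback f \<alpha>) = of_nat d ^ (CARD('k) - p) * \<tau> \<alpha>" if "smooth_form m \<alpha>" for \<alpha>
    proof (rule cesaro_limit_invariant[OF f(1) _ that[unfolded m_def], of R])
      show "d \<noteq> 0" using f(2) by simp
      show "(\<lambda>n. 1 / of_nat n * (\<Sum>i=1..n. pushforward (2 * (CARD('k) - p)) (f ^^ i) R \<beta> /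
          of_nat d ^ (i * (CARD('k) - p)))) \<longlonglongrightarrow> \<tau> \<beta>"
        if "smooth_form (2 * (CARD('k) - p)) \<beta>" for \<beta>
        using V(2) R that unfolding attractive_on_def Let_def by blast
    qed
    then have K: "?K \<subseteq> f ` ?K"
      using f(2) by (intro current_support_subset_image[OF f(1) cur, of "of_nat d ^ (CARD('k) - p)"]) auto
    have "?K \<subseteq> (f ^^ n) ` ?K" for n
    proof (induction n)
      case (Suc n)
      have "?K \<subseteq> f ` ?K" by (rule K)
      also have "\<dots> \<subseteq> f ` (f ^^ n) ` ?K" by (rule image_mono) (rule Suc.IH)
      finally show ?case by (simp add: image_comp)
    qed simp
    then have "?K \<subseteq> (f ^^ n) ` U" for n using image_mono[OF KU, of "f ^^ n"] by blast
    then show ?thesis by (auto simp: attracting_set_def)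
  next
    case False
    \<comment> \<open>A support inside U makes the uniqueness hypothesis applicable, a support
      inside V makes T attractive on V; \<open>\<C> p (U \<inter> V)\<close> secures both and its
      set is still open, as the rotation argument requires.\<close>
    have uniq: "T = \<tau>" if T: "T \<in> \<C> p (U \<inter> V)" for T
    proof (rule unique)
      have supp: "current_support m T \<subseteq> U \<inter> V" using T by (simp add: \<C>_def Let_def m_def)
      show "T \<in> \<C> p U" using C_mono[OF T] supp by (simp add: m_def)
      have "T \<in> \<C> p V" using C_mono[OF T] supp by (simp add: m_def)
      then have "attractive_on d p f V T"
        using False unfolding attractive_on_def Let_def by blast
      then show "attracting_current d p f T" using V(1) by (auto simp: attracting_current_def)
    qed
    have "\<tau> \<in> \<C> p (U \<inter> V)" using C_mono[OF U(2)] KU KV by (simp add: m_def)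
    then have "?K = UNIV"
      unfolding m_def by (rule current_support_eq_UNIV[OF open_Int[OF U(1) oV] _ uniq])
    then have "U = UNIV" using KU by blast
    then show ?thesis
      using surj_funpow[OF surj_endomorphism[OF f]] by (auto simp: attracting_set_def)
  qed
qed

section \<open>Joint continuity of the family and upper semicontinuity\<close>

lemma hol_on_imp_continuous_on:
  assumes "hol_on S f" shows "continuous_on S f"
  using assms unfolding hol_on_def
  by (intro continuous_at_imp_continuous_on ballI) (blast intro: has_derivative_continuous)

text \<open>In a chart and homogeneous coordinates F is \<open>pt\<close> after a holomorphic map. A
  box of good coordinates yields a neighbourhood of the point because charts are homeomorphisms onto
  their images and \<open>pt\<close> is open.\<close>

lemma continuous_on_holomorphic_family:
  fixes F :: "'m::topological_space \<Rightarrow> 'k::finite pspace \<Rightarrow> 'k pspace"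
    and \<A> :: "('m, 'j::finite) atlas"
  assumes M: "complex_manifold M \<A>" and F: "holomorphic_family M \<A> F"
  shows "continuous_on (M \<times> UNIV) (\<lambda>(l, x). F l x)"
  unfolding continuous_on_topological
proof (intro ballI allI impI)
  fix q :: "'m \<times> 'k pspace" and W assume q: "q \<in> M \<times> UNIV" and W: "open W" "(case q of (l, x) \<Rightarrow> F l x) \<in> W"
  obtain l1 x1 where lx: "q = (l1, x1)" "l1 \<in> M" using q by auto
  have "l1 \<in> (\<Union>(D, \<phi>)\<in>\<A>. D)" using M lx(2) by (simp add: complex_manifold_def)
  then obtain D \<phi> where D: "(D, \<phi>) \<in> \<A>" "l1 \<in> D" by blast
  have "openin (top_of_set M) D \<and> homeomorphism D (\<phi> ` D) \<phi> (inv_into D \<phi>)"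
    using M D(1) unfolding complex_manifold_def by blast
  then have oD: "openin (top_of_set M) D" and hom: "homeomorphism D (\<phi> ` D) \<phi> (inv_into D \<phi>)" by auto
  obtain z where z: "z \<noteq> 0" "pt z = x1" using hrep by metis
  have "\<forall>t\<in>\<phi> ` D. \<forall>z. z \<noteq> 0 \<longrightarrow>
       (\<exists>N L. open N \<and> (t, z) \<in> N \<and> N \<subseteq> \<phi> ` D \<times> (- {0}) \<and> hol_on N L \<and>
          (\<forall>(t', y)\<in>N. L (t', y) \<noteq> 0 \<and> F (inv_into D \<phi> t') (pt y) = pt (L (t', y))))"
    using bspec[OF F[unfolded holomorphic_family_def] D(1)] by (simp only: prod.case)
  from bspec[OF this imageI[OF D(2)], THEN spec, THEN mp, OF z(1)]
  obtain N L where N: "open N" "(\<phi> l1, z) \<in> N" "N \<subseteq> \<phi> ` D \<times> (- {0})" "hol_on N L"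
    "\<forall>(t', y)\<in>N. L (t', y) \<noteq> 0 \<and> F (inv_into D \<phi> t') (pt y) = pt (L (t', y))"
    by (elim exE conjE)
  have inv: "inv_into D \<phi> (\<phi> l) = l" if "l \<in> D" for l
    using hom that by (rule homeomorphism_apply1)
  have "continuous_on N (\<lambda>q. pt (L q))"
    by (rule continuous_on_compose2[OF continuous_on_pt hol_on_imp_continuous_on[OF N(4)]])
       (use N(5) in auto)
  then have "open (N \<inter> (\<lambda>q. pt (L q)) -` W)"
    by (rule continuous_open_preimage[OF _ N(1) W(1)])
  moreover have "(\<phi> l1, z) \<in> N \<inter> (\<lambda>q. pt (L q)) -` W"
    using N(2,5) W(2) lx z inv[OF D(2)] by auto
  ultimately obtain T Z where TZ: "open T" "open Z" "(\<phi> l1, z) \<in> T \<times> Z" "T \<times> Z \<subseteq> N \<inter> (\<lambda>q. pt (L q)) -` W"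
    by (rule open_prod_elim)
  have "openin (top_of_set D) (D \<inter> \<phi> -` T)"
    using homeomorphism_cont1[OF hom] TZ(1) by (rule continuous_openin_preimage_gen)
  then have "openin (top_of_set M) (D \<inter> \<phi> -` T)" using oD by (rule openin_trans)
  then obtain O1 where O1: "open O1" "D \<inter> \<phi> -` T = M \<inter> O1" by (auto simp: openin_open)
  have "open (pt ` Z)"
    using TZ N(3) by (intro open_pt_image) auto
  then have "open (O1 \<times> pt ` Z)" using O1(1) by (intro open_Times)
  moreover have "q \<in> O1 \<times> pt ` Z" using lx z D(2) TZ(3) O1(2) by auto
  moreover have "(case q of (l, x) \<Rightarrow> F l x) \<in> W" if q: "q \<in> M \<times> UNIV" "q \<in> O1 \<times> pt ` Z" for q
  proof -
    obtain l y where ly: "q = (l, pt y)" "l \<in> M" "l \<in> O1" "y \<in> Z" using q by auto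
    then have "l \<in> D" "\<phi> l \<in> T" using O1(2) by auto
    then show ?thesis using ly TZ(4) N(5) inv by fastforce
  qed
  ultimately show "\<exists>A. open A \<and> q \<in> A \<and> (\<forall>q\<in>M \<times> UNIV. q \<in> A \<longrightarrow> (case q of (l, x) \<Rightarrow> F l x) \<in> W)"
    by blast
qed

lemma continuous_on_funpow_family:
  fixes F :: "'m::topological_space \<Rightarrow> 'x::topological_space \<Rightarrow> 'x"
  assumes "continuous_on (M \<times> UNIV) (\<lambda>(l, x). F l x)"
  shows "continuous_on (M \<times> UNIV) (\<lambda>(l, x). (F l ^^ n) x)"
proof (induction n)
  case 0
  then show ?case by (simp add: case_prod_unfold continuous_on_snd)
next
  case (Suc n)
  have "continuous_on (M \<times> UNIV) (\<lambda>q. (\<lambda>(l, x). F l x) (fst q, (\<lambda>(l, x). (F l ^^ n) x) q))"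
    by (rule continuous_on_compose2[OF assms])
       (auto intro!: continuous_on_Pair continuous_on_fst continuous_on_id Suc)
  then show ?case by (simp add: case_prod_unfold)
qed

text \<open>The iterated images of the compact closure C of f(U) decrease to a set contained in the
  attracting set, so one of them lies in N. Hence some iterate maps the closure of U into N, which
  persists for nearby parameters, and every attracting set lies in the corresponding image of
  U.\<close>

lemma attracting_set_upper_semicontinuous:
  fixes F :: "'m::topological_space \<Rightarrow> 'k::finite pspace \<Rightarrow> 'k pspace"
  assumes cont: "continuous_on (M \<times> UNIV) (\<lambda>(l, x). F l x)"
    and l0: "l\<^sub>0 \<in> M" and f0: "F l\<^sub>0 ` U \<Subset> U" "continuous_on UNIV (F l\<^sub>0)"
    and N: "open N" "attracting_set (F l\<^sub>0) U \<subseteq> N"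
  shows "\<forall>\<^sub>F l in at l\<^sub>0 within M. attracting_set (F l) U \<subseteq> N"
proof -
  let ?f = "F l\<^sub>0"
  define C where "C = closure (?f ` U)"
  have C: "compact C" "C \<subseteq> U" using f0 by (auto simp: rel_compact_in_def C_def)
  have fC: "?f ` C \<subseteq> C" using C(2) closure_subset[of "?f ` U"] by (auto simp: C_def)
  have contn: "continuous_on UNIV (?f ^^ n)" for n
  proof (induction n)
    case (Suc n)
    then show ?case using continuous_on_compose2[OF f0(2) Suc] by (simp add: o_def)
  qed (simp add: id_def)
  have dec: "(?f ^^ n) ` C \<subseteq> (?f ^^ m) ` C" if "m \<le> n" for m n
    using that
  proof (induction rule: dec_induct)
    case (step n)
    have "(?f ^^ Suc n) ` C = (?f ^^ n) ` ?f ` C" by (simp add: funpow_Suc_right image_comp del: funpow.simps)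
    also have "\<dots> \<subseteq> (?f ^^ n) ` C" by (rule image_mono) (rule fC)
    finally show ?case using step by blast
  qed simp
  have "\<exists>n. (?f ^^ n) ` C \<subseteq> N"
  proof (rule ccontr)
    assume not: "\<nexists>n. (?f ^^ n) ` C \<subseteq> N"
    have "UNIV \<inter> (\<Inter>n\<in>UNIV. (?f ^^ n) ` C - N) \<noteq> {}"
    proof (rule compact_imp_fip_image[OF compact_pspace])
      show "closed ((?f ^^ n) ` C - N)" for n
        by (intro closed_Diff compact_imp_closed compact_continuous_image
            continuous_on_subset[OF contn] C(1) N(1)) auto
      fix I :: "nat set" assume I: "finite I"
      \<comment> \<open>Inserting 0 keeps \<open>Max\<close> meaningful when I is empty.\<close>
      have "(?f ^^ Max (insert 0 I)) ` C - N \<subseteq> (?f ^^ n) ` C - N" if "n \<in> I" for n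
        using dec[of n "Max (insert 0 I)"] I that by auto
      moreover have "(?f ^^ Max (insert 0 I)) ` C - N \<noteq> {}" using not by blast
      ultimately show "UNIV \<inter> (\<Inter>n\<in>I. (?f ^^ n) ` C - N) \<noteq> {}" by blast
    qed
    then obtain x where x: "\<And>n. x \<in> (?f ^^ n) ` C" "x \<notin> N" by blast
    have "x \<in> (?f ^^ n) ` U" for n using x(1)[of n] C(2) by blast
    then show False using N(2) x(2) by (auto simp: attracting_set_def)
  qed
  then obtain n where n: "(?f ^^ n) ` C \<subseteq> N" by blast
  have "?f ` closure U \<subseteq> C"
    unfolding C_def by (rule image_closure_subset) (auto intro: continuous_on_subset[OF f0(2)] subsetD[OF closure_subset])
  then have "(?f ^^ n) ` ?f ` closure U \<subseteq> N" using n by blast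
  then have Un: "(?f ^^ Suc n) x \<in> N" if "x \<in> closure U" for x
    using that by (auto simp: funpow_Suc_right simp del: funpow.simps)
  obtain W where W: "open W" "W \<inter> (M \<times> UNIV) = (\<lambda>(l, x). (F l ^^ Suc n) x) -` N \<inter> (M \<times> UNIV)"
    using continuous_on_funpow_family[OF cont, of "Suc n"] N(1) unfolding continuous_on_open_invariant by blast
  have "compact (closure U)" by (rule compact_closed_pspace) simp
  moreover have "{l\<^sub>0} \<times> closure U \<subseteq> W" using W(2) Un l0 by auto
  \<comment> \<open>Compactness of the closure of U gives one parameter neighbourhood that works for
    all starting points.\<close>
  ultimately obtain X where X: "l\<^sub>0 \<in> X" "open X" "X \<times> closure U \<subseteq> W"
    using Elementary_Topology.tube_lemma[of "closure U" W l\<^sub>0] W(1) by auto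
  have "attracting_set (F l) U \<subseteq> N" if "l \<in> X" "l \<in> M" for l
  proof
    fix x assume "x \<in> attracting_set (F l) U"
    then obtain u where "u \<in> U" "x = (F l ^^ Suc n) u" unfolding attracting_set_def by blast
    moreover have "(l, u) \<in> W \<inter> (M \<times> UNIV)"
      using that X(3) \<open>u \<in> U\<close> closure_subset by auto
    ultimately show "x \<in> N" unfolding W(2) by auto
  qed
  then show ?thesis unfolding eventually_at_topological using X by blast
qed

section \<open>Hausdorff distance and lower semicontinuity\<close>

lemma hausdorff_dist_le:
  assumes "A \<noteq> {}" "B \<noteq> {}" "\<And>a. a \<in> A \<Longrightarrow> infdist a B \<le> e" "\<And>b. b \<in> B \<Longrightarrow> infdist b A \<le> e"
  shows "hausdorff_dist A B \<le> e"
  using assms by (auto simp: hausdorff_dist_def intro!: cSUP_least)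

lemma hausdorff_dist_nonneg:
  fixes A B :: "'k::finite pspace set"
  assumes "A \<noteq> {}" "B \<noteq> {}"
  shows "0 \<le> hausdorff_dist A B"
proof -
  obtain a b where ab: "a \<in> A" "b \<in> B" using assms by blast
  \<comment> \<open>The real supremum can be estimated from below only for a bounded family; the
    diameter bound \<pi>/2 supplies this.\<close>
  have "bdd_above ((\<lambda>a. infdist a B) ` A)"
    using ab infdist_le2[OF ab(2) dist_pspace_bounds(2)] by (intro bdd_aboveI2[of _ _ "pi / 2"])
  then have "0 \<le> (SUP a\<in>A. infdist a B)"
    using ab infdist_nonneg by (intro cSUP_upper2[of _ _ a]) auto
  then show ?thesis by (simp add: hausdorff_dist_def le_max_iff_disj)
qed

text \<open>Near each point of the limit support some form has nonzero pairing; by weak continuity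
  the pairing stays nonzero, so nearby supports meet the same ball. A finite e/2-net of the compact
  support reduces this to finitely many test forms.\<close>

lemma current_support_lower_semicontinuous:
  fixes T :: "'m::topological_space \<Rightarrow> 'k::finite functional"
  assumes T: "\<And>l. l \<in> M \<Longrightarrow> current m (T l)"
    and lim: "\<And>\<alpha>. smooth_form m \<alpha> \<Longrightarrow> ((\<lambda>l. T l \<alpha>) \<longlongrightarrow> T l\<^sub>0 \<alpha>) (at l\<^sub>0 within M)"
    and e: "e > 0"
  shows "\<forall>\<^sub>F l in at l\<^sub>0 within M. \<forall>x\<in>current_support m (T l\<^sub>0). infdist x (current_support m (T l)) \<le> e"
proof -
  let ?K = "current_support m (T l\<^sub>0)"
  have "compact ?K" by (rule compact_closed_pspace[OF closed_current_support])
  then obtain Y where Y: "Y \<subseteq> ?K" "finite Y" "?K \<subseteq> (\<Union>y\<in>Y. ball y (e / 2))"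
    by (rule compactE_image[of ?K ?K "\<lambda>y. ball y (e / 2)"]) (use e in auto)
  have "\<forall>\<^sub>F l in at l\<^sub>0 within M. current_support m (T l) \<inter> ball y (e / 2) \<noteq> {}" if "y \<in> Y" for y
  proof -
    have "\<exists>\<alpha>. smooth_form m \<alpha> \<and> form_support \<alpha> \<subseteq> ball y (e / 2) \<and> T l\<^sub>0 \<alpha> \<noteq> 0"
    proof (rule ccontr)
      assume "\<not> ?thesis"
      then have "ball y (e / 2) \<subseteq> - ?K" by (subst current_support_def) auto
      moreover have "y \<in> ?K" using Y(1) that by blast
      moreover have "y \<in> ball y (e / 2)" using e by simp
      ultimately show False by blast
    qed
    then obtain \<alpha> where \<alpha>: "smooth_form m \<alpha>" "form_support \<alpha> \<subseteq> ball y (e / 2)" "T l\<^sub>0 \<alpha> \<noteq> 0" by blast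
    have "\<forall>\<^sub>F l in at l\<^sub>0 within M. T l \<alpha> \<noteq> 0"
      using tendsto_imp_eventually_ne[OF lim[OF \<alpha>(1)] \<alpha>(3)] .
    moreover have "\<forall>\<^sub>F l in at l\<^sub>0 within M. l \<in> M"
      by (simp add: eventually_at_filter)
    ultimately show ?thesis
    proof eventually_elim
      case (elim l)
      then show ?case using current_eq_0[OF T[OF elim(2)] \<alpha>(1)] \<alpha>(2) by blast
    qed
  qed
  then have "\<forall>\<^sub>F l in at l\<^sub>0 within M. \<forall>y\<in>Y. current_support m (T l) \<inter> ball y (e / 2) \<noteq> {}"
    by (intro eventually_ball_finite Y(2)) blast
  then show ?thesis
  proof eventually_elim
    case (elim l)
    show ?case
    proof
      fix x assume "x \<in> ?K"
      then obtain y where y: "y \<in> Y" "x \<in> ball y (e / 2)" using Y(3) by blast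
      then obtain w where w: "w \<in> current_support m (T l)" "w \<in> ball y (e / 2)" using elim by blast
      then have "dist x w \<le> e"
        using y(2) dist_triangle[of x w y] by (simp add: dist_commute)
      then show "infdist x (current_support m (T l)) \<le> e" by (rule infdist_le2[OF w(1)])
    qed
  qed
qed

theorem proposition5p9:
  fixes \<Theta> :: "complex ^ 'w \<Rightarrow> 'k::finite pspace \<Rightarrow> 'k pspace"
    and \<eta> :: "real \<Rightarrow> real"
    and M :: "'m::topological_space set"
    and \<A> :: "('m, 'j::finite) atlas"
    and F :: "'m \<Rightarrow> 'k pspace \<Rightarrow> 'k pspace"
    and d p :: nat
    and U :: "'k pspace set"
    and r\<^sub>0 :: real
    and \<tau> :: "'m \<Rightarrow> 'k functional"
    and l\<^sub>0 :: 'm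
  assumes W: "aut_parametrization \<Theta>"
    and eta: "\<And>r. 0 < r \<Longrightarrow> r \<le> 1 \<Longrightarrow>
      \<eta> r > 0 \<and> (\<forall>x y. dist x y \<le> \<eta> r \<longrightarrow> (\<exists>\<sigma>\<in>B_W \<Theta> r. \<sigma> x = y))"
    and M: "complex_manifold M \<A>" "biholomorphic_to_ball M \<A>"
    and F: "holomorphic_family M \<A> F"
    and d: "2 \<le> d" "\<And>l. l \<in> M \<Longrightarrow> algebraic_degree (F l) d"
    and U: "open U" "\<And>l. l \<in> M \<Longrightarrow> trapping_region_codim p (F l) U"
    and r0: "0 < r\<^sub>0" "\<And>l. l \<in> M \<Longrightarrow> r\<^sub>0 \<le> trapping_radius \<Theta> (F l) U"
    and a: "\<And>l l' x \<sigma>. l \<in> M \<Longrightarrow> l' \<in> M \<Longrightarrow> \<sigma> \<in> B_W \<Theta> (r\<^sub>0 / 2) \<Longrightarrow>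
      \<exists>\<sigma>'\<in>B_W \<Theta> r\<^sub>0. F l (\<sigma> x) = F l' (\<sigma>' x)"
    and b: "\<And>l l' V. l \<in> M \<Longrightarrow> l' \<in> M \<Longrightarrow> open V \<Longrightarrow>
      F l ` nbhd V (\<eta> (r\<^sub>0 / 2)) \<Subset> V \<Longrightarrow> F l' ` V \<Subset> V"
    and tau: "\<And>l. l \<in> M \<Longrightarrow> \<tau> l \<in> \<C> p U \<and> attracting_current d p (F l) (\<tau> l)"
    and tau_unique: "\<And>l T. l \<in> M \<Longrightarrow> T \<in> \<C> p U \<Longrightarrow> attracting_current d p (F l) T \<Longrightarrow> T = \<tau> l"
    and l0: "l\<^sub>0 \<in> M"
    and tau_continuous: "\<And>\<alpha>. smooth_form (2 * (CARD('k) - p)) \<alpha> \<Longrightarrow>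
      ((\<lambda>l. \<tau> l \<alpha>) \<longlongrightarrow> \<tau> l\<^sub>0 \<alpha>) (at l\<^sub>0 within M)"
    and support: "attracting_set (F l\<^sub>0) U = current_support (2 * (CARD('k) - p)) (\<tau> l\<^sub>0)"
  shows "((\<lambda>l. hausdorff_dist (attracting_set (F l) U) (attracting_set (F l\<^sub>0) U)) \<longlongrightarrow> 0)
    (at l\<^sub>0 within M)"
proof -
  let ?m = "2 * (CARD('k) - p)"
  let ?A = "\<lambda>l. attracting_set (F l) U"
  have cur: "current ?m (\<tau> l)" if "l \<in> M" for l
    using tau[OF that] by (auto simp: \<C>_def Let_def bidim_current_def)
  have ne: "current_support ?m (\<tau> l) \<noteq> {}" if "l \<in> M" for l
    using tau[OF that] C_support_nonempty by blast
  have supp: "current_support ?m (\<tau> l) \<subseteq> ?A l" if "l \<in> M" for l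
    by (rule attracting_current_support[OF d(2)[OF that] _ U(1)])
      (use d(1) tau[OF that] tau_unique[OF that] in auto)
  then have A_ne: "?A l \<noteq> {}" if "l \<in> M" for l
    using ne[OF that] that by blast
  have cont: "continuous_on (M \<times> UNIV) (\<lambda>(l, x). F l x)"
    by (rule continuous_on_holomorphic_family[OF M(1) F])
  have f0: "F l\<^sub>0 ` U \<Subset> U"
    using U(2)[OF l0] by (simp add: trapping_region_codim_def trapping_region_def)
  show ?thesis
  proof (rule tendstoI)
    fix e :: real assume "e > 0"
    \<comment> \<open>The two one-sided estimates give weak inequalities, so they are run with e/2
      to end strictly below e.\<close>
    then have e: "e / 2 > 0" by simp
    have "\<forall>\<^sub>F l in at l\<^sub>0 within M. ?A l \<subseteq> (\<Union>y\<in>?A l\<^sub>0. ball y (e / 2))"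
      by (rule attracting_set_upper_semicontinuous[OF cont l0 f0 continuous_on_endomorphism[OF d(2)[OF l0]]])
        (use e in auto)
    moreover have "\<forall>\<^sub>F l in at l\<^sub>0 within M.
        \<forall>x\<in>current_support ?m (\<tau> l\<^sub>0). infdist x (current_support ?m (\<tau> l)) \<le> e / 2"
      by (rule current_support_lower_semicontinuous[OF cur tau_continuous e])
    moreover have "\<forall>\<^sub>F l in at l\<^sub>0 within M. l \<in> M"
      by (simp add: eventually_at_filter)
    ultimately show "\<forall>\<^sub>F l in at l\<^sub>0 within M. dist (hausdorff_dist (?A l) (?A l\<^sub>0)) 0 < e"
    proof eventually_elim
      case (elim l)
      have "infdist x (?A l\<^sub>0) \<le> e / 2" if "x \<in> ?A l" for x
      proof -
        from elim(1) that obtain y where "y \<in> ?A l\<^sub>0" "dist x y \<le> e / 2"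
          by (force simp: dist_commute)
        then show ?thesis by (rule infdist_le2)
      qed
      moreover have "infdist x (?A l) \<le> e / 2" if "x \<in> ?A l\<^sub>0" for x
      proof -
        \<comment> \<open>The distance to the larger set is smaller, so approximation by the support
          of \<open>\<tau> l\<close> suffices; x itself lies in the support of
          \<open>\<tau> l\<^sub>0\<close> by the assumed equality.\<close>
        have "infdist x (?A l) \<le> infdist x (current_support ?m (\<tau> l))"
          by (rule infdist_mono[OF supp[OF elim(3)] ne[OF elim(3)]])
        also have "\<dots> \<le> e / 2" using elim(2) that support by simp
        finally show ?thesis .
      qed
      ultimately have "hausdorff_dist (?A l) (?A l\<^sub>0) \<le> e / 2"
        by (intro hausdorff_dist_le A_ne elim(3) l0)
      then show ?case
        using hausdorff_dist_nonneg[OF A_ne[OF elim(3)] A_ne[OF l0]] \<open>e > 0\<close> by simp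
    qed
  qed
qed

end
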